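(* Let $\lambda>0$ and suppose the following assumption holds: there exists a power spectral density $\bar\Phi$ (an integrable function on $\mathbb T$ with values in the $m\times m$ Hermitian positive semidefinite matrices) which is positive definite on some open interval of $\mathbb T$ and satisfies $\int_{\mathbb T}[\bar\Phi]_{jh}e^{i\theta k}=[R_k]_{jh}$ for all $(j,h)\in E$ and $k=0,\dots,n$. Then the problem $$\min\ \tilde J_\lambda(\mathbf p,\mathbf Q)\quad\text{s.t. } \mathbf p\in\overline{\mathfrak B_+^o},\ \mathbf Q\in\overline{\mathfrak B_+^m}(E)$$ admits a unique solution $(\hat{\mathbf p},\hat{\mathbf Q})$, and it lies in $\mathfrak B_+^o\times\mathfrak B_+^m(E)$. Moreover, the rational spectral density $\hat\Phi=\hat{\mathbf p}\hat{\mathbf Q}^{-1}$ is bounded and coercive on $\mathbb T$ and satisfies $$\int_{\mathbb T}e^{i\theta k}[\hat\Phi]_{jh}=[R_k]_{jh},\quad k=0,\dots,n,\ (j,h)\in E,$$ $$\int_{\mathbb T}e^{i\theta k}\log\det\hat\Phi=c_k+\varepsilon_k,\quad k=1,\dots,n,\qquad\text{where } \varepsilon_k=\lambda\int_{\mathbb T}e^{i\theta k}\hat{\mathbf p}^{-2}.$$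
   Context: Let $m,n$ be positive integers, $V=\{1,\dots,m\}$, and $E\subseteq V\times V$ a symmetric set containing $(j,j)$ for all $j\in V$. Let $\mathbb T=[0,2\pi)$ and write $\int_{\mathbb T}f$ for $\int_0^{2\pi}f(\theta)\,\frac{d\theta}{2\pi}$. For a matrix $X$, $[X]_{jh}$ is its $(j,h)$ entry (same notation for matrix-valued functions). $\mathfrak B_+^m(E)$ is the set of matrix trigonometric polynomials $\mathbf Q(e^{i\theta})=Q_0+\frac12\sum_{k=1}^n\big(Q_ke^{-i\theta k}+Q_k^Te^{i\theta k}\big)$ with $Q_0\in\mathbb R^{m\times m}$ symmetric, $Q_1,\dots,Q_n\in\mathbb R^{m\times m}$, $[Q_k]_{jh}=0$ for all $k$ and all $(j,h)\notin E$, and $\mathbf Q(e^{i\theta})$ positive definite for every $\theta\in\mathbb T$. $\overline{\mathfrak B_+^m}(E)$ denotes the closure of $\mathfrak B_+^m(E)$ (in the finite-dimensional coefficient space) from which the points $\mathbf Q$ with $\det\mathbf Q(e^{i\theta})=0$ for all $\theta\in\mathbb T$ are removed. $\mathfrak B_+^o$ is the set of scalar trigonometric polynomials $\mathbf p(e^{i\theta})=1+\frac12\sum_{k=1}^n p_k(e^{-i\theta k}+e^{i\theta k})$, $p_k\in\mathbb R$, with $\mathbf p(e^{i\theta})>0$ for all $\theta$; $\overline{\mathfrak B_+^o}$ is its closure. Set $p_0=1$. Data: real $m\times m$ matrices $R_0,\dots,R_n$ ($R_0$ symmetric) and real numbers $c_0,\dots,c_n$. The dual function (with values in the extended reals) is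 $$J(\mathbf p,\mathbf Q)=\int_{\mathbb T}\Big(\mathbf p\log\det(\mathbf p\mathbf Q^{-1})-m\mathbf p\Big)+\sum_{k=0}^n\mathrm{tr}(Q_k^TR_k)-\sum_{k=0}^np_kc_k,$$ $g_\lambda(\mathbf p)=\lambda\int_{\mathbb T}\mathbf p^{-1}$, and $\tilde J_\lambda(\mathbf p,\mathbf Q)=J(\mathbf p,\mathbf Q)+g_\lambda(\mathbf p)$. *)

theory Defs
  imports "HOL-Analysis.Analysis" "HOL-Probability.Probability"
begin

text \<open>Index set V is represented by a finite type 'm (m = CARD('m)).
  Matrix coefficients Q_k are real^'m^'m, indexed by k :: nat, with Q_k = 0 for k > n
  (normalisation of the finite coefficient tuple). The unit circle T is [0, 2 pi),
  and the normalised integral is (1/(2 pi)) times the integral over [0, 2 pi].\<close>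

definition Tset :: "real set" where "Tset = {0..<2*pi}"

definition hermitian :: "complex^'m^'m \<Rightarrow> bool" where
  "hermitian A \<longleftrightarrow> (\<forall>a b. A$a$b = cnj (A$b$a))"

definition qform :: "complex^'m^'m \<Rightarrow> complex^'m \<Rightarrow> complex" where
  "qform A v = (\<Sum>a\<in>UNIV. \<Sum>b\<in>UNIV. cnj (v$a) * A$a$b * v$b)"

definition posdef :: "complex^'m^'m \<Rightarrow> bool" where
  "posdef A \<longleftrightarrow> hermitian A \<and> (\<forall>v. v \<noteq> 0 \<longrightarrow> Re (qform A v) > 0)"

definition possemidef :: "complex^'m^'m \<Rightarrow> bool" where
  "possemidef A \<longleftrightarrow> hermitian A \<and> (\<forall>v. Re (qform A v) \<ge> 0)"

definition bounded_coercive :: "(real \<Rightarrow> complex^'m^'m) \<Rightarrow> bool" where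
  "bounded_coercive Phi \<longleftrightarrow> (\<exists>a b. 0 < a \<and> (\<forall>\<theta>\<in>Tset. hermitian (Phi \<theta>) \<and>
     (\<forall>v. a * (norm v)\<^sup>2 \<le> Re (qform (Phi \<theta>) v) \<and> Re (qform (Phi \<theta>) v) \<le> b * (norm v)\<^sup>2)))"

definition qeval :: "nat \<Rightarrow> (nat \<Rightarrow> real^'m^'m) \<Rightarrow> real \<Rightarrow> complex^'m^'m" where
  "qeval n Q \<theta> = (\<chi> a b. complex_of_real (Q 0 $ a $ b) + (1/2) * (\<Sum>k=1..n.
      complex_of_real (Q k $ a $ b) * cis (- \<theta> * real k)
      + complex_of_real (transpose (Q k) $ a $ b) * cis (\<theta> * real k)))"

definition peval :: "nat \<Rightarrow> (nat \<Rightarrow> real) \<Rightarrow> real \<Rightarrow> real" where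
  "peval n p \<theta> = Re (1 + (1/2) * (\<Sum>k=1..n. complex_of_real (p k) *
      (cis (- \<theta> * real k) + cis (\<theta> * real k))))"

definition Bm :: "nat \<Rightarrow> ('m \<times> 'm) set \<Rightarrow> (nat \<Rightarrow> real^'m^'m) set" where
  "Bm n E = {Q. transpose (Q 0) = Q 0 \<and> (\<forall>k>n. Q k = 0)
      \<and> (\<forall>k a b. (a,b) \<notin> E \<longrightarrow> Q k $ a $ b = 0)
      \<and> (\<forall>\<theta>\<in>Tset. posdef (qeval n Q \<theta>))}"

definition Bm_bar :: "nat \<Rightarrow> ('m \<times> 'm) set \<Rightarrow> (nat \<Rightarrow> real^'m^'m) set" where
  "Bm_bar n E = closure (Bm n E) - {Q. \<forall>\<theta>\<in>Tset. det (qeval n Q \<theta>) = 0}"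

definition Bo :: "nat \<Rightarrow> (nat \<Rightarrow> real) set" where
  "Bo n = {p. p 0 = 1 \<and> (\<forall>k>n. p k = 0) \<and> (\<forall>\<theta>\<in>Tset. peval n p \<theta> > 0)}"

definition Bo_bar :: "nat \<Rightarrow> (nat \<Rightarrow> real) set" where
  "Bo_bar n = closure (Bo n)"

definition Tint :: "(real \<Rightarrow> complex) \<Rightarrow> complex" where
  "Tint f = integral {0..2*pi} f / complex_of_real (2*pi)"

definition Tnn_int :: "(real \<Rightarrow> ennreal) \<Rightarrow> ennreal" where
  "Tnn_int f = ennreal (1/(2*pi)) * (\<integral>\<^sup>+ \<theta>\<in>{0..2*pi}. f \<theta> \<partial>lborel)"

definition Tint_ereal :: "(real \<Rightarrow> ereal) \<Rightarrow> ereal" where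
  "Tint_ereal f = enn2ereal (Tnn_int (\<lambda>\<theta>. e2ennreal (max (f \<theta>) 0)))
                - enn2ereal (Tnn_int (\<lambda>\<theta>. e2ennreal (max (- f \<theta>) 0)))"

definition J_integrand :: "nat \<Rightarrow> (nat \<Rightarrow> real) \<Rightarrow> (nat \<Rightarrow> real^'m^'m) \<Rightarrow> real \<Rightarrow> ereal" where
  "J_integrand n p Q \<theta> =
     (if peval n p \<theta> = 0 then 0
      else if det (qeval n Q \<theta>) = 0 then \<infinity>
      else ereal (peval n p \<theta> * ln (Re (det (peval n p \<theta> *\<^sub>R matrix_inv (qeval n Q \<theta>))))
                  - real CARD('m) * peval n p \<theta>))"

definition Jfun :: "nat \<Rightarrow> (nat \<Rightarrow> real^'m^'m) \<Rightarrow> (nat \<Rightarrow> real) \<Rightarrow> (nat \<Rightarrow> real) \<Rightarrow> (nat \<Rightarrow> real^'m^'m) \<Rightarrow> ereal" where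
  "Jfun n R c p Q = Tint_ereal (J_integrand n p Q)
     + ereal (\<Sum>k=0..n. trace (transpose (Q k) ** R k)) - ereal (\<Sum>k=0..n. p k * c k)"

definition g_lambda :: "nat \<Rightarrow> real \<Rightarrow> (nat \<Rightarrow> real) \<Rightarrow> ereal" where
  "g_lambda n lam p = ereal lam * enn2ereal (Tnn_int (\<lambda>\<theta>.
       if peval n p \<theta> = 0 then \<infinity> else ennreal (1 / peval n p \<theta>)))"

definition Jtilde :: "nat \<Rightarrow> real \<Rightarrow> (nat \<Rightarrow> real^'m^'m) \<Rightarrow> (nat \<Rightarrow> real) \<Rightarrow> (nat \<Rightarrow> real) \<Rightarrow> (nat \<Rightarrow> real^'m^'m) \<Rightarrow> ereal" where
  "Jtilde n lam R c p Q = Jfun n R c p Q + g_lambda n lam p"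

end

theory Submission
  imports Defs
begin

text \<open>
  For positive \<open>p, q\<close>, positive definite \<open>A, B\<close> and \<open>\<Phi> = p A\<^sup>-\<^sup>1\<close>, the inequality \<open>tr M - ln det M - m \<ge> 0\<close>
  (equality iff \<open>M = I\<close>) applied to \<open>M = \<Phi> B / q\<close>, together with \<open>1/q + q/p\<^sup>2 \<ge> 2/p\<close>, says that the integrand
  of the dual functional lies above its tangent at \<open>(p, A)\<close>, strictly away from \<open>(p, A)\<close>. Hence an interior
  stationary point is the unique global minimiser, boundary points included, and the moment conditions
  are the stationarity equations. It remains to find such a point. The feasible density makes
  \<open>\<Sum> tr(Q\<^sub>k\<^sup>T R\<^sub>k) = \<integral> tr(Q \<Phi>)\<close> coercive, so sublevel sets bound \<open>Q\<close> and \<open>\<integral> 1/p\<close>. A positive Lipschitz function \<open>f\<close>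
  with \<open>\<integral> 1/f \<le> C\<close> is bounded below by a constant depending only on \<open>C\<close> and the Lipschitz constant;
  this applies to \<open>p\<close>, and to \<open>v\<^sup>* Q v\<close> once the derivative in the direction \<open>Q = I\<close> has bounded \<open>\<integral> tr Q\<^sup>-\<^sup>1\<close>.
\<close>

section \<open>Hermitian positive definite matrices\<close>

text \<open>The two barriers differ in strength. The reciprocal of a Lipschitz function that touches
  zero is not integrable, so a bounded value alone keeps \<open>p\<close> away from zero. The
  singularity of \<open>ln det\<close> is only logarithmic, hence integrable: the value can stay
  finite while \<open>Q\<close> degenerates. What does blow up is the derivative, through the trace
  of the inverse. A derivative says something only at a minimiser, and the open problem is not yet
  known to have one; hence the auxiliary minimisation over a compact set. There, adding a small
  multiple of the identity leads away from the constraint \<open>Q \<ge> \<eta>\<close>, so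
  one-sided minimality already yields the estimate. The constants have to be chosen in this order:
  the bound \<delta> for \<open>p\<close>, then the bound for the trace of the inverse, which
  divides by \<delta>, then \<eta>. Convexity enters only as a pointwise tangent inequality. This
  avoids differentiation under the integral, and it avoids any semicontinuity of the extended-valued
  functional at boundary points.\<close>

definition ctr :: "complex^'n^'m \<Rightarrow> complex^'m^'n" where
  "ctr A = (\<chi> i j. cnj (A$j$i))"

lemma ctr_nth [simp]: "ctr A $ i $ j = cnj (A$j$i)"
  by (simp add: ctr_def)

lemma ctr_ctr [simp]: "ctr (ctr A) = A"
  by (simp add: vec_eq_iff)

lemma ctr_mult: "ctr (A ** B) = ctr B ** ctr (A :: complex^'n::finite^'m)"
  by (simp add: vec_eq_iff matrix_matrix_mult_def mult.commute)

lemma ctr_mat [simp]: "ctr (mat 1) = (mat 1 :: complex^'m^'m)"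
  by (auto simp: vec_eq_iff mat_def)

lemma hermitian_ctr: "hermitian A \<longleftrightarrow> ctr A = A"
  unfolding hermitian_def vec_eq_iff ctr_nth by metis

lemma det_ctr: "det (ctr A) = cnj (det (A :: complex^'m::finite^'m))"
proof -
  have "ctr A = transpose (\<chi> i j. cnj (A$i$j))"
    by (simp add: vec_eq_iff transpose_def)
  then show ?thesis
    by (simp only: det_transpose) (simp add: det_def)
qed

text \<open>\<open>inner\<close> on complex vectors is the real scalar product, so the real
  Euclidean theory of norms and adjoints becomes available for Hermitian forms.\<close>

lemma qform_inner: "Re (qform A v) = inner v (A *v v)"
  by (simp add: qform_def inner_vec_def matrix_vector_mult_def inner_complex_def
      sum_distrib_left mult.assoc sum_subtractf sum.distrib Re_sum Im_sum algebra_simps flip: sum.distrib)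

lemma inner_ctr: "inner (ctr K *v v) w = inner v (K *v (w :: complex^'m::finite))"
proof -
  have "inner (ctr K *v v) w = (\<Sum>i\<in>UNIV. \<Sum>j\<in>UNIV. Re (cnj (cnj (K$j$i) * v$j) * w$i))"
    by (simp add: inner_vec_def matrix_vector_mult_def inner_complex_def
       sum_distrib_left sum_distrib_right algebra_simps flip: sum.distrib)
  also have "\<dots> = (\<Sum>j\<in>UNIV. \<Sum>i\<in>UNIV. Re (cnj (v$j) * (K$j$i * w$i)))"
    by (subst sum.swap) (simp add: mult_ac)
  also have "\<dots> = inner v (K *v w)"
    by (simp add: inner_vec_def matrix_vector_mult_def inner_complex_def algebra_simps
       sum_distrib_left sum.distrib sum_subtractf Re_sum Im_sum)
  finally show ?thesis .
qed

lemma scaleR_mult_vec: "(r *\<^sub>R M) *v (v :: complex^'m::finite) = r *\<^sub>R (M *v v)"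
  by (simp add: vec_eq_iff matrix_vector_mult_def scaleR_sum_right)

lemma mult_vec_scaleR: "M *v (r *\<^sub>R v :: complex^'m::finite) = r *\<^sub>R (M *v v)"
  by (simp add: vec_eq_iff matrix_vector_mult_def scaleR_sum_right)

lemma qform_congr: "Re (qform (K ** M ** ctr K) v) = Re (qform M (ctr K *v v))"
  by (simp add: qform_inner inner_ctr flip: matrix_vector_mul_assoc)

lemma hermitian_congr: "hermitian M \<Longrightarrow> hermitian (K ** M ** ctr K)"
  by (simp add: hermitian_ctr ctr_mult matrix_mul_assoc)

lemma posdef_congr:
  assumes "posdef M" "det K \<noteq> 0"
  shows "posdef (K ** M ** ctr K)"
proof -
  have "ctr K *v v \<noteq> 0" if "v \<noteq> 0" for v
    using inj_matrix_vector_mult[of "ctr K"] assms(2) that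
    by (metis complex_cnj_zero_iff det_ctr injD invertible_det_nz matrix_vector_mult_0_right)
  then show ?thesis
    using assms by (auto simp: posdef_def hermitian_congr qform_congr)
qed

lemma possemidef_congr: "possemidef M \<Longrightarrow> possemidef (K ** M ** ctr K)"
  by (auto simp: possemidef_def hermitian_congr qform_congr)

lemma posdef_mat_1: "posdef (mat 1 :: complex^'m::finite^'m)"
  by (simp add: posdef_def hermitian_ctr qform_inner)

lemma posdef_diag_pos:
  assumes "posdef (M :: complex^'m::finite^'m)"
  shows "Re (M$a$a) > 0"
proof -
  have "axis a (1::complex) \<noteq> 0" by (simp add: axis_eq_0_iff)
  moreover have "qform M (axis a 1) = M$a$a"
    by (simp add: qform_def axis_def if_distrib[of cnj] if_distrib[of "\<lambda>x. x * _"] if_distrib[of "\<lambda>x. _ * x"] cong: if_cong)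
  ultimately show ?thesis using assms by (metis posdef_def)
qed

lemma hermitian_diag: "hermitian M \<Longrightarrow> M$a$a = of_real (Re (M$a$a))"
  by (metis hermitian_def complex_cnj_cancel_iff complex_is_Real_iff of_real_Re Reals_cnj_iff)

text \<open>A Gauss transformation: as a left factor it scales row \<open>a\<close> by
  \<open>x $ a\<close> and adds multiples of that row to the others, so one matrix performs a whole
  elimination step, and Cramer's lemma gives its determinant.\<close>

definition col_replace :: "'m \<Rightarrow> complex^'m \<Rightarrow> complex^'m::finite^'m" where
  "col_replace a x = (\<chi> i j. if j = a then x$i else if i = j then 1 else 0)"

lemma det_col_replace: "det (col_replace a x) = x$a"
  using cramer_lemma[of a "mat 1" x] unfolding col_replace_def matrix_vector_mul_lid det_I
  by (simp add: mat_def cong: if_cong)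

lemma col_replace_mult:
  "(col_replace a x ** M) $ b $ c = (if b = a then 0 else M$b$c) + x$b * M$a$c"
proof -
  have "(col_replace a x ** M) $ b $ c
      = (\<Sum>d\<in>UNIV. (if d = a then x$b * M$a$c else 0) + (if d = b then (if b = a then 0 else M$b$c) else 0))"
    unfolding matrix_matrix_mult_def col_replace_def vec_lambda_beta by (rule sum.cong) auto
  then show ?thesis by (simp add: sum.distrib)
qed

lemma mult_ctr_col_replace:
  "(M ** ctr (col_replace a x)) $ b $ c = (if c = a then 0 else M$b$c) + M$b$a * cnj (x$c)"
proof -
  have "M ** ctr (col_replace a x) = ctr (col_replace a x ** ctr M)"
    by (simp add: ctr_mult)
  then show ?thesis by (simp add: col_replace_mult)
qed

text \<open>One step of symmetric Gaussian elimination clears the row and column of \<open>a\<close>;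
  the induction is over the set of indices not yet eliminated.\<close>

lemma posdef_eliminate:
  fixes M :: "complex^'m::finite^'m"
  assumes "posdef M"
    and "\<And>a b. a \<notin> S \<or> b \<notin> S \<Longrightarrow> M$a$b = (if a = b then 1 else 0)"
  shows "(\<exists>K. det K \<noteq> 0 \<and> K ** M ** ctr K = mat 1) \<and> Re (det M) > 0 \<and> Im (det M) = 0
    \<and> Re (trace M) - real CARD('m) - ln (Re (det M)) \<ge> 0
    \<and> (Re (trace M) - real CARD('m) - ln (Re (det M)) = 0 \<longrightarrow> M = mat 1)"
  using finite[of S] assms
proof (induction S arbitrary: M rule: finite_induct)
  case empty
  then have "M = mat 1" by (simp add: vec_eq_iff mat_def)
  then show ?case
    by (auto simp: trace_I intro!: exI[of _ "mat 1"])
next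
  case (insert a S)
  have herm: "hermitian M" using insert.prems(1) by (simp add: posdef_def)
  have hab: "M$b$c = cnj (M$c$b)" for b c using herm unfolding hermitian_def by blast
  define r where "r = Re (M$a$a)"
  have r: "r > 0" and Maa: "M$a$a = of_real r"
    using posdef_diag_pos[OF insert.prems(1)] hermitian_diag[OF herm] by (auto simp: r_def)
  \<comment> \<open>\<open>1 / sqrt r\<close> turns the pivot into 1 under the two-sided action; the
    other entries clear column \<open>a\<close>, and the conjugate transpose clears row
    \<open>a\<close>.\<close>
  define x where "x = (\<chi> b. if b = a then of_real (1 / sqrt r) else - M$b$a / of_real r)"
  define K where "K = col_replace a x"
  define N where "N = K ** M ** ctr K"
  have detK: "det K = of_real (1 / sqrt r)"
    by (simp add: K_def det_col_replace x_def)
  have KM: "(K ** M) $ b $ c = (if b = a then of_real (1 / sqrt r) * M$a$c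
       else M$b$c - M$b$a * M$a$c / of_real r)" for b c
    by (simp add: K_def col_replace_mult x_def)
  have KMa: "(K ** M) $ b $ a = (if b = a then of_real (sqrt r) else 0)" for b
    unfolding KM Maa using r by (simp add: real_div_sqrt flip: of_real_mult of_real_divide)
  have N: "N $ b $ c = (if b = a \<or> c = a then if b = c then 1 else 0
       else M$b$c - M$b$a * M$a$c / of_real r)" for b c
  proof -
    have "N $ b $ c = (if c = a then 0 else (K**M)$b$c) + (K**M)$b$a * cnj (x$c)"
      by (simp add: N_def K_def mult_ctr_col_replace)
    also have "\<dots> = (if b = a \<or> c = a then if b = c then 1 else 0
       else M$b$c - M$b$a * M$a$c / of_real r)"
    proof (cases "b = a")
      case True
      have s: "complex_of_real (sqrt r) * of_real (sqrt r) = of_real r"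
        using r by (simp flip: of_real_mult)
      have "complex_of_real (sqrt r) * cnj (M$c$a) / of_real r = M$a$c / of_real (sqrt r)"
        using r hab[of a c] s by (simp add: field_simps)
      with True show ?thesis using r s Maa hab[of a c] by (auto simp: KMa KM x_def field_simps)
    next
      case False
      then show ?thesis using r by (auto simp: KMa KM x_def Maa)
    qed
    finally show ?thesis .
  qed
  have posN: "posdef N"
    unfolding N_def using posdef_congr[OF insert.prems(1)] detK r by simp
  have supp: "N$b$c = (if b = c then 1 else 0)" if "b \<notin> S \<or> c \<notin> S" for b c
  proof (cases "b = a \<or> c = a")
    case False
    with that have out: "b \<notin> insert a S \<or> c \<notin> insert a S" by auto
    then have "M$b$a = 0 \<or> M$a$c = 0" using insert.prems(2) False by metis
    then show ?thesis using False N insert.prems(2)[OF out] by auto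
  qed (auto simp: N)
  note IH = insert.IH[OF posN supp]
  then obtain L where L: "det L \<noteq> 0" "L ** N ** ctr L = mat 1" by blast
  have LK: "det (L ** K) \<noteq> 0" "(L ** K) ** M ** ctr (L ** K) = mat 1"
    using L r detK by (auto simp: det_mul N_def ctr_mult matrix_mul_assoc)
  have "det N = of_real (1/sqrt r) * det M * cnj (of_real (1/sqrt r))"
    unfolding N_def det_mul det_ctr detK by simp
  also have "\<dots> = det M * of_real (1/sqrt r * (1/sqrt r))"
    by (simp only: complex_cnj_complex_of_real of_real_mult mult_ac)
  also have "1/sqrt r * (1/sqrt r) = 1/r" using r by (simp add: real_sqrt_mult_self)
  finally have "det N = det M * of_real (1/r)" .
  then have "det M = of_real r * det N" using r by simp
  then have detM: "Re (det M) = r * Re (det N)" "Im (det M) = r * Im (det N)" by simp_all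
  have ln: "ln (Re (det M)) = ln r + ln (Re (det N))"
    unfolding detM using r IH by (intro ln_mult_pos) auto
  \<comment> \<open>The gap tr - m - ln det splits into three nonnegative terms: the gap of the
    reduced matrix \<open>N\<close>, the scalar gap \<open>r - 1 - ln r\<close> of the pivot, and
    the squares of the eliminated column. Equality therefore forces all three to vanish.\<close>
  have tr: "Re (trace M) = Re (trace N) + (r - 1) + (\<Sum>b\<in>UNIV-{a}. (cmod (M$b$a))\<^sup>2 / r)"
  proof -
    have "M$b$a * M$a$b = of_real ((cmod (M$b$a))\<^sup>2)" for b
      using hab[of a b] complex_norm_square[of "M$b$a"] by simp
    then have "Re (M$b$b) = Re (N$b$b) + (cmod (M$b$a))\<^sup>2 / r" if "b \<noteq> a" for b
      using that by (simp add: N flip: of_real_divide)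
    then have "(\<Sum>b\<in>UNIV-{a}. Re (M$b$b)) = (\<Sum>b\<in>UNIV-{a}. Re (N$b$b)) + (\<Sum>b\<in>UNIV-{a}. (cmod (M$b$a))\<^sup>2 / r)"
      by (simp flip: sum.distrib)
    then show ?thesis
      by (simp add: trace_def Re_sum sum.remove[of UNIV a] Maa N)
  qed
  have s0: "(\<Sum>b\<in>UNIV-{a}. (cmod (M$b$a))\<^sup>2 / r) \<ge> 0"
    using r by (intro sum_nonneg) auto
  have lr: "r - 1 - ln r \<ge> 0" using ln_le_minus_one[OF r] by simp
  have eq: "M = mat 1" if z: "Re (trace M) - real CARD('m) - ln (Re (det M)) = 0"
  proof -
    have "r - 1 - ln r = 0" and s: "(\<Sum>b\<in>UNIV-{a}. (cmod (M$b$a))\<^sup>2 / r) = 0" and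
      "Re (trace N) - real CARD('m) - ln (Re (det N)) = 0"
      using z s0 lr IH unfolding ln tr by linarith+
    then have r1: "r = 1" and N1: "N = mat 1"
      using IH ln_eq_minus_one[OF r] by auto
    have "\<forall>b\<in>UNIV-{a}. (cmod (M$b$a))\<^sup>2 / r = 0"
      using s r by (subst (asm) sum_nonneg_eq_0_iff) auto
    then have Mb: "M$b$a = 0" if "b \<noteq> a" for b using that r by auto
    have "M$b$c = (if b = c then 1 else 0)" for b c
    proof (cases "b = a \<or> c = a")
      case True then show ?thesis
        using Mb hab[of b c] Maa r1 by auto
    next
      case False then show ?thesis
        using N[of b c] N1 Mb[of b] by (simp add: mat_def split: if_splits)
    qed
    then show ?thesis by (simp add: vec_eq_iff mat_def)
  qed
  show ?case
    using LK detM IH r eq s0 lr unfolding ln tr by (auto intro!: exI[of _ "L ** K"])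
qed

lemma posdef_det: "posdef (M :: complex^'m::finite^'m) \<Longrightarrow> Re (det M) > 0 \<and> Im (det M) = 0"
  using posdef_eliminate[of M UNIV] by simp

lemma posdef_invertible: "posdef (M :: complex^'m::finite^'m) \<Longrightarrow> invertible M"
  using posdef_det[of M] by (auto simp: invertible_det_nz)

section \<open>Inverses and Gram factorisations\<close>

lemma matrix_inv_works:
  fixes A :: "'a::semiring_1^'n^'n"
  assumes "invertible A"
  shows "A ** matrix_inv A = mat 1" "matrix_inv A ** A = mat 1"
  using assms someI_ex[of "\<lambda>A'. A ** A' = mat 1 \<and> A' ** A = mat 1"]
  by (auto simp: invertible_def matrix_inv_def)

lemma matrix_inv_unique:
  fixes A B :: "'a::field^'n^'n"
  assumes "A ** B = mat 1"
  shows "matrix_inv A = B"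
proof -
  have "invertible A" using assms invertible_right_inverse by blast
  then have "matrix_inv A ** (A ** B) = B"
    by (simp add: matrix_mul_assoc matrix_inv_works)
  then show ?thesis by (simp add: assms)
qed

text \<open>Writing the inverse as a Gram matrix makes its positivity visible and turns its trace
  into a sum of squares.\<close>

lemma posdef_factor_inv:
  fixes M :: "complex^'m::finite^'m"
  assumes "posdef M"
  obtains K where "det K \<noteq> 0" "K ** M ** ctr K = mat 1" "matrix_inv M = ctr K ** K"
proof -
  obtain K where K: "det K \<noteq> 0" "K ** M ** ctr K = mat 1"
    using posdef_eliminate[OF assms, of UNIV] by auto
  then have "K ** (M ** ctr K) = mat 1" by (simp add: matrix_mul_assoc)
  then have "(M ** ctr K) ** K = mat 1"
    by (simp add: matrix_left_right_inverse)
  then have "matrix_inv M = ctr K ** K"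
    by (intro matrix_inv_unique) (simp add: matrix_mul_assoc)
  with K that show ?thesis by blast
qed

text \<open>Stands in for the positive square root: inverting the elimination matrix gives a factor
  without spectral theory, and a congruence by \<open>W\<close> asks for nothing more.\<close>

lemma posdef_factor:
  fixes M :: "complex^'m::finite^'m"
  assumes "posdef M"
  obtains W where "det W \<noteq> 0" "M = W ** ctr W"
proof -
  obtain K where K: "det K \<noteq> 0" "K ** M ** ctr K = mat 1"
    using posdef_factor_inv[OF assms] by metis
  define W where "W = matrix_inv K"
  have W: "K ** W = mat 1" "W ** K = mat 1"
    using matrix_inv_works[of K] K by (auto simp: W_def invertible_det_nz)
  have "ctr K ** ctr W = mat 1" using W(2) by (metis ctr_mat ctr_mult)
  moreover have "M = (W ** K) ** M ** (ctr K ** ctr W)" using W(2) calculation by simp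
  then have "M = W ** (K ** M ** ctr K) ** ctr W" by (simp add: matrix_mul_assoc)
  then have "M = W ** ctr W" using K by simp
  moreover have "det W \<noteq> 0" using W(1) by (metis det_I det_mul mult_zero_right zero_neq_one)
  ultimately show ?thesis using that by blast
qed

lemma posdef_inv:
  fixes M :: "complex^'m::finite^'m"
  assumes "posdef M"
  shows "posdef (matrix_inv M)"
proof -
  obtain K where "det K \<noteq> 0" "matrix_inv M = ctr K ** K"
    using posdef_factor_inv[OF assms] by metis
  then show ?thesis using posdef_congr[OF posdef_mat_1, of "ctr K"] by (simp add: det_ctr)
qed

lemma posdef_scaleR:
  assumes "posdef (M :: complex^'m::finite^'m)" "r > 0"
  shows "posdef (r *\<^sub>R M)"
proof -
  have "Re (qform (r *\<^sub>R M) v) = r * Re (qform M v)" for v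
    by (simp add: qform_inner scaleR_mult_vec)
  moreover have "hermitian (r *\<^sub>R M)"
    using assms(1) unfolding posdef_def hermitian_def vector_scaleR_component complex_cnj_scaleR by metis
  ultimately show ?thesis using assms by (simp add: posdef_def)
qed

lemma det_scaleR_complex:
  fixes M :: "complex^'m::finite^'m"
  shows "det (r *\<^sub>R M) = of_real r ^ CARD('m) * det M"
proof -
  have "r *\<^sub>R M = (\<chi> i. of_real r *s row i M)"
    by (simp add: vec_eq_iff row_def scaleR_conv_of_real[where 'a = complex])
  moreover have "(\<chi> i. row i M) = M" by (simp add: vec_eq_iff row_def)
  ultimately show ?thesis using det_rows_mul[of "\<lambda>_. of_real r" "\<lambda>i. row i M"]
    by (simp add: prod_constant)
qed

text \<open>Joint Klein-type inequality obtained by applying the one-matrix case to the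
  congruent matrix \<open>W\<^sup>* B W\<close> with \<open>A = W W\<^sup>*\<close>.\<close>

lemma trace_mult_ge_ln_det:
  fixes A B :: "complex^'m::finite^'m"
  assumes "posdef A" "posdef B"
  shows "Re (trace (A ** B)) - real CARD('m) - ln (Re (det A)) - ln (Re (det B)) \<ge> 0"
    and "Re (trace (A ** B)) - real CARD('m) - ln (Re (det A)) - ln (Re (det B)) = 0 \<Longrightarrow> A ** B = mat 1"
proof -
  obtain W where W: "det W \<noteq> 0" "A = W ** ctr W" using posdef_factor[OF assms(1)] .
  define M where "M = ctr W ** B ** W"
  have M: "posdef M" using posdef_congr[OF assms(2), of "ctr W"] W by (simp add: M_def det_ctr)
  have "trace M = trace (W ** (ctr W ** B))"
    unfolding M_def by (rule trace_mul_sym)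
  then have tr: "trace M = trace (A ** B)" by (simp add: W matrix_mul_assoc)
  have "det M = det A * det B" by (simp add: M_def W det_mul)
  then have "Re (det M) = Re (det A) * Re (det B)"
    using posdef_det[OF assms(1)] by simp
  then have ln: "ln (Re (det M)) = ln (Re (det A)) + ln (Re (det B))"
    using posdef_det[OF assms(1)] posdef_det[OF assms(2)] by (simp add: ln_mult_pos)
  note E = posdef_eliminate[OF M, of UNIV, simplified]
  show "Re (trace (A ** B)) - real CARD('m) - ln (Re (det A)) - ln (Re (det B)) \<ge> 0"
    using E ln tr by simp
  assume "Re (trace (A ** B)) - real CARD('m) - ln (Re (det A)) - ln (Re (det B)) = 0"
  then have "M = mat 1" using E ln tr by simp
  then have "W ** (ctr W ** B) = mat 1"
    by (subst matrix_left_right_inverse) (simp add: M_def)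
  then show "A ** B = mat 1" by (simp add: W matrix_mul_assoc)
qed

section \<open>Trace inequalities for semidefinite matrices\<close>

lemma possemidef_trace_0:
  fixes A :: "complex^'m::finite^'m"
  assumes "possemidef A"
  shows "Re (trace A) \<ge> 0" and "Re (trace A) = 0 \<Longrightarrow> A = 0"
proof -
  have q: "qform A (axis a 1) = A$a$a" for a
    by (simp add: qform_def axis_def if_distrib[of cnj] if_distrib[of "\<lambda>x. x * _"] if_distrib[of "\<lambda>x. _ * x"] cong: if_cong)
  have d: "Re (A$a$a) \<ge> 0" for a using assms q[of a] by (metis possemidef_def)
  then show "Re (trace A) \<ge> 0" by (simp add: trace_def Re_sum sum_nonneg)
  assume "Re (trace A) = 0"
  then have "Re (A$a$a) = 0" for a
    using d sum_nonneg_eq_0_iff[of UNIV "\<lambda>a. Re (A$a$a)"] by (simp add: trace_def Re_sum)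
  moreover have herm: "hermitian A" using assms by (simp add: possemidef_def)
  moreover have hab: "A$a$b = cnj (A$b$a)" for a b using herm unfolding hermitian_def by blast
  ultimately have diag: "A$a$a = 0" for a using hermitian_diag[OF herm, of a] by (metis of_real_0)
  have "A$a$b = 0" for a b
  proof (cases "a = b")
    case False
    \<comment> \<open>Since the diagonal is zero, the form at this vector is minus twice the squared
      modulus of the off-diagonal entry.\<close>
    define v where "v = axis a 1 - A$b$a *s axis b (1::complex)"
    have v: "v$i = (if i = a then 1 else if i = b then - (A$b$a) else 0)" for i
      using False by (auto simp: v_def axis_def)
    have two: "(\<Sum>i\<in>UNIV. f i) = f a + f b" if "\<And>i. i \<noteq> a \<Longrightarrow> i \<noteq> b \<Longrightarrow> f i = 0" for f :: "'m \<Rightarrow> complex"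
      using that False by (subst sum.mono_neutral_right[of UNIV "{a,b}"]) auto
    have "qform A v = cnj (v$a) * A$a$b * v$b + cnj (v$b) * A$b$a * v$a"
      unfolding qform_def by (simp add: two v diag)
    also have "\<dots> = - 2 * of_real ((cmod (A$a$b))\<^sup>2)"
      using False hab[of b a] complex_norm_square[of "A$a$b"] unfolding v by simp
    finally have "Re (qform A v) = -2 * (cmod (A$a$b))\<^sup>2" by simp
    moreover have "Re (qform A v) \<ge> 0" using assms by (simp add: possemidef_def)
    ultimately have "(cmod (A$a$b))\<^sup>2 = 0" using zero_le_power2[of "cmod (A$a$b)"] by linarith
    then show ?thesis by simp
  qed (simp add: diag)
  then show "A = 0" by (simp add: vec_eq_iff)
qed

text \<open>Cyclicity moves the factors of \<open>B\<close> around \<open>A\<close>, which leaves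
  the trace of a congruence of \<open>A\<close>. The equality case is what later makes the moment
  pairing strictly positive.\<close>

lemma trace_mult_posdef:
  fixes A B :: "complex^'m::finite^'m"
  assumes "possemidef A" "posdef B"
  shows "Re (trace (A ** B)) \<ge> 0" and "Re (trace (A ** B)) = 0 \<Longrightarrow> A = 0"
proof -
  obtain W where W: "det W \<noteq> 0" "B = W ** ctr W" using posdef_factor[OF assms(2)] .
  define M where "M = ctr W ** A ** W"
  have M: "possemidef M" using possemidef_congr[OF assms(1), of "ctr W"] by (simp add: M_def)
  have tr: "trace M = trace (A ** B)"
    unfolding M_def W matrix_mul_assoc[symmetric] by (subst trace_mul_sym) (simp add: matrix_mul_assoc)
  show "Re (trace (A ** B)) \<ge> 0" using possemidef_trace_0[OF M] tr by simp
  assume "Re (trace (A ** B)) = 0"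
  then have "M = 0" using possemidef_trace_0[OF M] tr by simp
  moreover obtain K where K: "W ** K = mat 1"
    using W(1) by (metis invertible_det_nz invertible_right_inverse)
  moreover have "ctr K ** ctr W = mat 1" using K by (metis ctr_mat ctr_mult)
  then have "A = (ctr K ** ctr W) ** A ** (W ** K)" using K by simp
  then have "A = ctr K ** M ** K" by (simp add: M_def matrix_mul_assoc)
  ultimately show "A = 0" by simp
qed

lemma possemidef_add_posdef:
  assumes "possemidef A" "posdef B" shows "posdef (A + B)"
proof -
  have "Re (qform (A + B) v) = Re (qform A v) + Re (qform B v)" for v
    by (simp add: qform_inner matrix_vector_mult_add_rdistrib inner_add_right)
  moreover have "hermitian (A + B)"
    using assms unfolding posdef_def possemidef_def hermitian_def vector_add_component complex_cnj_add by metis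
  ultimately show ?thesis using assms by (auto simp: posdef_def possemidef_def add_nonneg_pos)
qed

lemma posdef_imp_possemidef: "posdef A \<Longrightarrow> possemidef A"
  unfolding posdef_def possemidef_def
  by (metis matrix_vector_mult_0_right inner_zero_left less_eq_real_def order_refl qform_inner)

text \<open>A vector on which a semidefinite form vanishes minimises the form, so the gradient
  \<open>A *v v\<close> vanishes there and \<open>A\<close> is singular. Expanding the form at
  \<open>v - s *\<^sub>R w\<close> with \<open>w = A *v v\<close> and letting \<open>s\<close> tend
  to 0 shows this without eigenvectors.\<close>

lemma possemidef_det_nz:
  fixes A :: "complex^'m::finite^'m"
  assumes "possemidef A" "det A \<noteq> 0"
  shows "posdef A"
proof -
  have herm: "ctr A = A" using assms(1) by (simp add: possemidef_def hermitian_ctr)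
  have "Re (qform A v) \<noteq> 0" if "v \<noteq> 0" for v
  proof
    assume q: "Re (qform A v) = 0"
    define w where "w = A *v v"
    have le: "(norm w)\<^sup>2 \<le> s * (inner w (A *v w) / 2)" if "s > 0" for s
    proof -
      have "0 \<le> Re (qform A (v - s *\<^sub>R w))" using assms(1) by (simp add: possemidef_def)
      also have "\<dots> = s\<^sup>2 * inner w (A *v w) - s * inner v (A *v w) - s * inner w w"
        using q by (simp add: qform_inner matrix_vector_mult_diff_distrib mult_vec_scaleR
            inner_diff_left inner_diff_right power2_eq_square w_def[symmetric] algebra_simps)
      also have "inner v (A *v w) = inner w w"
        using inner_ctr[of A v w] by (simp add: herm w_def)
      finally have "s * (2 * (norm w)\<^sup>2) \<le> s * (s * inner w (A *v w))"
        by (simp add: power2_norm_eq_inner) (simp add: power2_eq_square algebra_simps)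
      then show ?thesis using that by simp
    qed
    have "(norm w)\<^sup>2 \<le> 0 * (inner w (A *v w) / 2)"
    proof (rule tendsto_lowerbound)
      show "((\<lambda>s. s * (inner w (A *v w) / 2)) \<longlongrightarrow> 0 * (inner w (A *v w) / 2)) (at_right 0)"
        by (intro tendsto_intros)
      show "\<forall>\<^sub>F s in at_right 0. (norm w)\<^sup>2 \<le> s * (inner w (A *v w) / 2)"
        using eventually_at_right_less by (rule eventually_mono) (rule le)
    qed simp
    then have "A *v v = 0" by (simp add: w_def)
    then show False using that assms(2) inj_matrix_vector_mult[of A]
      by (metis injD invertible_det_nz matrix_vector_mult_0_right)
  qed
  then show ?thesis using assms(1) unfolding posdef_def possemidef_def by (metis less_eq_real_def)
qed

text \<open>\<open>B\<close> may be singular, so it is shifted by \<open>e\<close> times the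
  identity and \<open>e\<close> is sent to zero.\<close>

lemma trace_mult_possemidef:
  fixes A B :: "complex^'m::finite^'m"
  assumes "possemidef A" "possemidef B"
  shows "Re (trace (A ** B)) \<ge> 0"
proof -
  have "Re (trace (A ** B)) + e * Re (trace A) \<ge> 0" if "e > 0" for e
  proof -
    have "posdef (B + e *\<^sub>R mat 1)"
      using that assms by (intro possemidef_add_posdef posdef_scaleR posdef_mat_1)
    from trace_mult_posdef(1)[OF assms(1) this]
    show ?thesis
      by (simp add: matrix_add_ldistrib trace_add) (simp add: trace_def matrix_matrix_mult_def mat_def Re_sum sum_distrib_left if_distrib cong: if_cong)
  qed
  then have "eventually (\<lambda>e. Re (trace (A ** B)) + e * Re (trace A) \<ge> 0) (at_right 0)"
    using eventually_at_right_less by (rule eventually_mono[rotated])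
  moreover have "((\<lambda>e. Re (trace (A ** B)) + e * Re (trace A)) \<longlongrightarrow> Re (trace (A ** B)) + 0 * Re (trace A)) (at_right 0)"
    by (intro tendsto_intros)
  ultimately have "0 \<le> Re (trace (A ** B)) + 0 * Re (trace A)"
    by (intro tendsto_lowerbound) auto
  then show ?thesis by simp
qed

text \<open>For unit vectors this bounds the reciprocal of the form by the trace of the inverse,
  uniformly in the vector, and so reduces a lower bound on a matrix to scalar functions. It is
  Cauchy-Schwarz for \<open>v = ctr K *v u\<close>, where
  \<open>matrix_inv A = ctr K ** K\<close>.\<close>

lemma trace_inv_ge:
  fixes A :: "complex^'m::finite^'m"
  assumes "posdef A"
  shows "(norm v)\<^sup>2 \<le> Re (trace (matrix_inv A)) * Re (qform A v)"
proof -
  obtain K :: "complex^'m^'m" where K: "K ** A ** ctr K = mat 1" "matrix_inv A = ctr K ** K"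
    using posdef_factor_inv[OF assms] by metis
  define u where "u = K *v (A *v v)"
  have "ctr K ** (K ** A) = mat 1"
    using K(1) matrix_left_right_inverse[of "ctr K" "K ** A"] by simp
  then have v: "v = ctr K *v u"
    by (simp add: u_def matrix_vector_mul_assoc)
  have tr: "Re (trace (matrix_inv A)) = (\<Sum>i\<in>UNIV. \<Sum>j\<in>UNIV. (cmod (K$j$i))\<^sup>2)"
    unfolding K(2) trace_def matrix_matrix_mult_def
    unfolding cmod_power2 by (simp add: Re_sum power2_eq_square)
  have "inner u u = inner (ctr K *v u) (A *v v)"
    unfolding inner_ctr by (simp add: u_def)
  then have u: "(norm u)\<^sup>2 = Re (qform A v)"
    using v by (simp add: power2_norm_eq_inner qform_inner)
  have "(norm (v$i))\<^sup>2 \<le> (\<Sum>j\<in>UNIV. (cmod (K$j$i))\<^sup>2) * (norm u)\<^sup>2" for i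
  proof -
    have "norm (v$i) \<le> (\<Sum>j\<in>UNIV. norm (K$j$i) * norm (u$j))"
      unfolding v matrix_vector_mult_def using norm_sum[of "\<lambda>j. cnj (K$j$i) * u$j" UNIV] by (simp add: norm_mult)
    then have "(norm (v$i))\<^sup>2 \<le> (\<Sum>j\<in>UNIV. norm (K$j$i) * norm (u$j))\<^sup>2"
      by (intro power_mono) auto
    also have "\<dots> \<le> (\<Sum>j\<in>UNIV. (norm (K$j$i))\<^sup>2) * (\<Sum>j\<in>UNIV. (norm (u$j))\<^sup>2)"
      by (rule Cauchy_Schwarz_ineq_sum)
    also have "(\<Sum>j\<in>UNIV. (norm (u$j))\<^sup>2) = (norm u)\<^sup>2"
      by (simp add: norm_vec_def L2_set_def sum_nonneg)
    finally show ?thesis .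
  qed
  then have "(\<Sum>i\<in>UNIV. (norm (v$i))\<^sup>2) \<le> (\<Sum>i\<in>UNIV. (\<Sum>j\<in>UNIV. (cmod (K$j$i))\<^sup>2) * (norm u)\<^sup>2)"
    by (rule sum_mono)
  moreover have "(norm v)\<^sup>2 = (\<Sum>i\<in>UNIV. (norm (v$i))\<^sup>2)"
    by (simp add: norm_vec_def L2_set_def sum_nonneg)
  ultimately show ?thesis
    unfolding tr u[symmetric] by (simp add: sum_distrib_right)
qed

section \<open>Matrix trigonometric polynomials\<close>

lemma peval_eq: "peval n p \<theta> = 1 + (\<Sum>k=1..n. p k * cos (real k * \<theta>))"
proof -
  have "cis (- \<theta> * real k) + cis (\<theta> * real k) = of_real (2 * cos (real k * \<theta>))" for k
    by (simp add: complex_eq_iff mult.commute)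
  then show ?thesis
    by (simp add: peval_def Re_sum sum_distrib_left del: mult_minus_left)
qed

text \<open>The linear part of the affine map \<open>peval\<close>: the constant coefficient is
  pinned to 1, so a direction has no constant term.\<close>

definition pdir :: "nat \<Rightarrow> (nat \<Rightarrow> real) \<Rightarrow> real \<Rightarrow> real" where
  "pdir n h \<theta> = (\<Sum>k=1..n. h k * cos (real k * \<theta>))"

lemma peval_add: "peval n (\<lambda>k. p k + t * h k) \<theta> = peval n p \<theta> + t * pdir n h \<theta>"
  by (simp add: peval_eq pdir_def sum.distrib sum_distrib_left algebra_simps)

lemma qeval_nth: "qeval n Q \<theta> $ a $ b = complex_of_real (Q 0 $ a $ b) + (1/2) * (\<Sum>k=1..n.
      complex_of_real (Q k $ a $ b) * cis (- \<theta> * real k)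
      + complex_of_real (Q k $ b $ a) * cis (\<theta> * real k))"
  by (simp add: qeval_def transpose_def)

lemma qeval_add: "qeval n (\<lambda>k. Q k + t *\<^sub>R H k) \<theta> = qeval n Q \<theta> + t *\<^sub>R qeval n H \<theta>"
  unfolding vec_eq_iff vector_add_component vector_scaleR_component qeval_nth
  by (simp add: scaleR_conv_of_real sum.distrib sum_distrib_left algebra_simps flip: sum.distrib)

lemma qeval_scale: "qeval n (\<lambda>k. t *\<^sub>R H k) \<theta> = t *\<^sub>R qeval n H \<theta>"
proof -
  have "qeval n (\<lambda>k. 0) \<theta> = 0" by (simp add: vec_eq_iff qeval_nth)
  then show ?thesis using qeval_add[of n "\<lambda>_. 0" t H \<theta>] by simp
qed

lemma hermitian_qeval:
  assumes "transpose (Q 0) = Q 0"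
  shows "hermitian (qeval n Q \<theta>)"
proof -
  have "Q 0 $ a $ b = Q 0 $ b $ a" for a b
    using arg_cong[OF assms, of "\<lambda>M. M $ b $ a"] by (simp add: transpose_def)
  then show ?thesis
    unfolding hermitian_def by (simp add: qeval_nth cis_cnj add.commute)
qed

text \<open>Real coefficients make a reflection of the angle act as complex conjugation. It is the
  reflection about pi that preserves the interval of integration.\<close>

lemma cis_reflect: "cis ((2 * pi - \<theta>) * real k) = cnj (cis (\<theta> * real k))"
proof -
  have "(2 * pi - \<theta>) * real k = - (\<theta> * real k) + 2 * pi * real k"
    by (simp add: algebra_simps)
  then have "cis ((2 * pi - \<theta>) * real k) = cis (- (\<theta> * real k)) * cis (2 * pi * real k)"
    by (simp only: cis_mult)
  also have "cis (2 * pi * real k) = 1"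
    using cis_multiple_2pi[of "real k"] by simp
  finally show ?thesis by (simp add: cis_cnj)
qed

lemma peval_reflect: "peval n p (2 * pi - \<theta>) = peval n p \<theta>"
proof -
  have "cos (real k * (2 * pi - \<theta>)) = cos (real k * \<theta>)" for k
    using arg_cong[OF cis_reflect[of \<theta> k], of Re] by (simp add: mult.commute)
  then show ?thesis by (simp add: peval_eq)
qed

lemma qeval_reflect: "qeval n Q (2 * pi - \<theta>) $ a $ b = cnj (qeval n Q \<theta> $ a $ b)"
proof -
  have "cis (- (2 * pi - \<theta>) * real k) = cnj (cis (- \<theta> * real k))" for k
    using arg_cong[OF cis_reflect[of \<theta> k], of cnj] by (simp only: cis_cnj mult_minus_left)
  then show ?thesis unfolding qeval_nth cis_reflect by simp
qed

section \<open>Continuity in the coefficients and the angle\<close>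

lemma continuous_on_peval:
  fixes f :: "'a::t2_space \<Rightarrow> nat \<Rightarrow> real"
  assumes "continuous_on S f" "continuous_on S g"
  shows "continuous_on S (\<lambda>x. peval n (f x) (g x))"
proof -
  have "continuous_on S (\<lambda>x. f x k)" for k
    by (rule continuous_on_product_then_coordinatewise[OF assms(1)])
  then show ?thesis unfolding peval_eq by (intro continuous_intros assms(2))
qed

lemma continuous_on_pdir [continuous_intros]:
  fixes g :: "'a::t2_space \<Rightarrow> real"
  assumes "continuous_on S g"
  shows "continuous_on S (\<lambda>x. pdir n h (g x))"
  unfolding pdir_def by (intro continuous_intros assms)

lemma continuous_on_qeval:
  fixes f :: "'a::t2_space \<Rightarrow> nat \<Rightarrow> real^'m::finite^'m"
  assumes "continuous_on S f" "continuous_on S g"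
  shows "continuous_on S (\<lambda>x. qeval n (f x) (g x))"
proof -
  have c: "continuous_on S (\<lambda>x. f x k $ a $ b)" for k a b
    by (intro continuous_on_component continuous_on_product_then_coordinatewise[OF assms(1)])
  show ?thesis
    unfolding qeval_def transpose_def vec_lambda_beta
    by (intro continuous_on_vec_lambda continuous_on_add continuous_on_mult continuous_on_const continuous_on_sum
        continuous_on_of_real continuous_on_cis continuous_on_minus c assms(2))
qed

lemma continuous_on_det:
  fixes f :: "'a::topological_space \<Rightarrow> complex^'m::finite^'m"
  assumes "continuous_on S f"
  shows "continuous_on S (\<lambda>x. det (f x))"
  unfolding det_def by (intro continuous_intros assms)

text \<open>Cramer's rule makes the entries of the inverse quotients of determinants, hence
  continuous wherever the determinant is nonzero.\<close>

lemma matrix_inv_nth: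
  fixes A :: "'a::field^'m::finite^'m"
  assumes "det A \<noteq> 0"
  shows "matrix_inv A $ i $ j = det (\<chi> r c. if c = i then (if r = j then 1 else 0) else A $ r $ c) / det A"
proof -
  have "A *v (matrix_inv A *v axis j 1) = axis j 1"
    using assms by (simp add: matrix_vector_mul_assoc matrix_inv_works invertible_det_nz)
  then have "matrix_inv A *v axis j 1
      = (\<chi> k. det (\<chi> r c. if c = k then axis j 1 $ r else A $ r $ c) / det A)"
    using cramer[OF assms] by blast
  moreover have "(matrix_inv A *v axis j 1) $ i = matrix_inv A $ i $ j"
    by (simp add: matrix_vector_mult_def axis_def if_distrib[of "\<lambda>x. _ * x"] cong: if_cong)
  ultimately have "matrix_inv A $ i $ j = det (\<chi> r c. if c = i then axis j 1 $ r else A $ r $ c) / det A"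
    by simp
  then show ?thesis by (simp add: axis_def cong: if_cong)
qed

lemma continuous_on_matrix_inv:
  fixes f :: "'a::topological_space \<Rightarrow> complex^'m::finite^'m"
  assumes "continuous_on S f" "\<And>x. x \<in> S \<Longrightarrow> det (f x) \<noteq> 0"
  shows "continuous_on S (\<lambda>x. matrix_inv (f x))"
proof -
  have "continuous_on S (\<lambda>x. det (\<chi> r c. if c = i then (if r = j then 1 else 0) else f x $ r $ c) / det (f x))" for i j
  proof (intro continuous_intros continuous_on_det assms(1))
    show "continuous_on S (\<lambda>x. if c = i then if r = j then 1 else 0 else f x $ r $ c)" for r c
      by (cases "c = i") (auto intro!: continuous_intros assms(1))
  qed (use assms in auto)
  then have "continuous_on S (\<lambda>x. \<chi> i j. matrix_inv (f x) $ i $ j)"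
    using assms(2) by (intro continuous_on_vec_lambda) (simp add: matrix_inv_nth cong: continuous_on_cong)
  then show ?thesis by simp
qed

lemma continuous_on_trace:
  fixes f :: "'a::topological_space \<Rightarrow> complex^'m::finite^'m"
  assumes "continuous_on S f"
  shows "continuous_on S (\<lambda>x. trace (f x))"
  unfolding trace_def by (intro continuous_intros assms)

lemma continuous_on_matrix_mult:
  fixes f g :: "'a::topological_space \<Rightarrow> complex^'m::finite^'m"
  assumes "continuous_on S f" "continuous_on S g"
  shows "continuous_on S (\<lambda>x. f x ** g x)"
  unfolding matrix_matrix_mult_def by (intro continuous_intros assms)

lemma continuous_on_qform:
  fixes f :: "'a::topological_space \<Rightarrow> complex^'m::finite^'m"
  assumes "continuous_on S f"
  shows "continuous_on S (\<lambda>x. Re (qform (f x) v))"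
  unfolding qform_def by (intro continuous_intros assms)

text \<open>The coefficient tuples live in a function space that carries only the product topology,
  so the size of the coefficients up to \<open>n\<close> is measured separately.\<close>

definition coef_norm :: "nat \<Rightarrow> (nat \<Rightarrow> real^'m::finite^'m) \<Rightarrow> real" where
  "coef_norm n Q = (\<Sum>k\<le>n. norm (Q k))"

lemma coef_norm_nonneg: "coef_norm n Q \<ge> 0"
  by (simp add: coef_norm_def sum_nonneg)

lemma norm_nth_nth_le: "\<bar>A $ a $ b\<bar> \<le> norm (A :: real^'m::finite^'m)"
  using order_trans[OF component_le_norm_cart[of "A $ a" b] Finite_Cartesian_Product.norm_nth_le[of A a]] .

lemma norm_qeval_nth_le: "norm (qeval n Q \<theta> $ a $ b) \<le> coef_norm n Q"
proof -
  have "norm (qeval n Q \<theta> $ a $ b) \<le> norm (Q 0) + (1/2) * (\<Sum>k=1..n. norm (Q k) + norm (Q k))"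
    unfolding qeval_nth
  proof (intro norm_triangle_mono)
    show "norm (complex_of_real (Q 0 $ a $ b)) \<le> norm (Q 0)" using norm_nth_nth_le[of "Q 0"] by simp
    have "norm (\<Sum>k=1..n. complex_of_real (Q k $ a $ b) * cis (- \<theta> * real k)
      + complex_of_real (Q k $ b $ a) * cis (\<theta> * real k)) \<le> (\<Sum>k=1..n. norm (Q k) + norm (Q k))"
      by (intro sum_norm_le norm_triangle_mono) (simp_all add: norm_mult norm_nth_nth_le)
    then show "norm (1/2 * (\<Sum>k=1..n. complex_of_real (Q k $ a $ b) * cis (- \<theta> * real k)
      + complex_of_real (Q k $ b $ a) * cis (\<theta> * real k))) \<le> (1/2) * (\<Sum>k=1..n. norm (Q k) + norm (Q k))"
      by (simp only: norm_mult) simp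
  qed
  also have "\<dots> = coef_norm n Q"
    by (simp add: coef_norm_def sum.atMost_shift sum.distrib atLeast0AtMost[symmetric] sum.atLeast_Suc_atMost sum.atLeast1_atMost_eq flip: sum_distrib_left)
  finally show ?thesis .
qed

lemma norm_cis_diff: "norm (cis a - cis b) \<le> \<bar>a - b\<bar>"
proof -
  have "cis a - cis b = cis b * (exp (\<i> * of_real (a - b)) - 1)"
    by (simp add: cis_mult right_diff_distrib flip: cis_conv_exp del: of_real_diff)
  then have "norm (cis a - cis b) = 2 * \<bar>sin ((a - b) / 2)\<bar>"
    by (simp only: norm_mult dist_exp_i_1) simp
  also have "\<dots> \<le> \<bar>a - b\<bar>" using abs_sin_x_le_abs_x[of "(a-b)/2"] by simp
  finally show ?thesis .
qed

lemma norm_qeval_nth_diff_le: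
  "norm (qeval n Q \<theta> $ a $ b - qeval n Q \<theta>' $ a $ b) \<le> real n * coef_norm n Q * \<bar>\<theta> - \<theta>'\<bar>"
proof -
  have c: "norm (cis (x * real k) - cis (x' * real k)) \<le> real n * \<bar>x - x'\<bar>" if "k \<le> n" for k x x'
  proof -
    have "norm (cis (x * real k) - cis (x' * real k)) \<le> \<bar>x * real k - x' * real k\<bar>"
      by (rule norm_cis_diff)
    also have "\<dots> = real k * \<bar>x - x'\<bar>" by (simp add: abs_mult mult.commute flip: left_diff_distrib)
    also have "\<dots> \<le> real n * \<bar>x - x'\<bar>" using that by (intro mult_right_mono) auto
    finally show ?thesis .
  qed
  have eq: "qeval n Q \<theta> $ a $ b - qeval n Q \<theta>' $ a $ b = (1/2) * (\<Sum>k=1..n.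
      complex_of_real (Q k $ a $ b) * (cis (- \<theta> * real k) - cis (- \<theta>' * real k))
      + complex_of_real (Q k $ b $ a) * (cis (\<theta> * real k) - cis (\<theta>' * real k)))"
    unfolding qeval_nth by (simp add: algebra_simps sum.distrib sum_subtractf)
  have "norm (qeval n Q \<theta> $ a $ b - qeval n Q \<theta>' $ a $ b) = (1/2) * norm (\<Sum>k=1..n.
      complex_of_real (Q k $ a $ b) * (cis (- \<theta> * real k) - cis (- \<theta>' * real k))
      + complex_of_real (Q k $ b $ a) * (cis (\<theta> * real k) - cis (\<theta>' * real k)))"
    by (simp only: eq norm_mult) simp
  also have "\<dots> \<le> (1/2) * (\<Sum>k=1..n. norm (Q k) * (real n * \<bar>\<theta> - \<theta>'\<bar>) + norm (Q k) * (real n * \<bar>\<theta> - \<theta>'\<bar>))"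
  proof (intro mult_left_mono sum_norm_le norm_triangle_mono)
    fix k assume "k \<in> {1..n}"
    then have "norm (cis (- \<theta> * real k) - cis (- \<theta>' * real k)) \<le> real n * \<bar>\<theta> - \<theta>'\<bar>"
      "norm (cis (\<theta> * real k) - cis (\<theta>' * real k)) \<le> real n * \<bar>\<theta> - \<theta>'\<bar>"
      using c[of k "-\<theta>" "-\<theta>'"] c[of k \<theta> \<theta>'] by (auto simp: abs_minus_commute)
    then show "norm (complex_of_real (Q k $ a $ b) * (cis (- \<theta> * real k) - cis (- \<theta>' * real k))) \<le> norm (Q k) * (real n * \<bar>\<theta> - \<theta>'\<bar>)"
      "norm (complex_of_real (Q k $ b $ a) * (cis (\<theta> * real k) - cis (\<theta>' * real k))) \<le> norm (Q k) * (real n * \<bar>\<theta> - \<theta>'\<bar>)"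
      by (auto simp only: norm_mult norm_of_real intro!: mult_mono norm_nth_nth_le norm_ge_zero)
  qed simp
  also have "\<dots> = (\<Sum>k=1..n. norm (Q k)) * (real n * \<bar>\<theta> - \<theta>'\<bar>)"
    by (simp only: sum.distrib sum_distrib_right) simp
  also have "\<dots> \<le> coef_norm n Q * (real n * \<bar>\<theta> - \<theta>'\<bar>)"
    unfolding coef_norm_def by (intro mult_right_mono sum_mono2) auto
  finally show ?thesis by (simp add: mult_ac)
qed

lemma abs_qform_le:
  fixes A :: "complex^'m::finite^'m"
  assumes "\<And>a b. norm (A $ a $ b) \<le> C"
  shows "\<bar>Re (qform A v)\<bar> \<le> (real CARD('m))\<^sup>2 * C * (norm v)\<^sup>2"
proof -
  have C: "C \<ge> 0" using assms norm_ge_zero order_trans by blast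
  have "\<bar>Re (qform A v)\<bar> \<le> norm (qform A v)" by (rule abs_Re_le_cmod)
  also have "\<dots> \<le> (\<Sum>a\<in>(UNIV::'m set). \<Sum>b\<in>(UNIV::'m set). norm v * C * norm v)"
    unfolding qform_def
  proof (intro sum_norm_le)
    fix a b
    have "norm (v$a) \<le> norm v" "norm (v$b) \<le> norm v" by (rule Finite_Cartesian_Product.norm_nth_le)+
    then show "norm (cnj (v$a) * A$a$b * v$b) \<le> norm v * C * norm v"
      unfolding norm_mult complex_mod_cnj using assms[of a b] C by (intro mult_mono) auto
  qed
  also have "\<dots> = (real CARD('m))\<^sup>2 * C * (norm v)\<^sup>2" by (simp add: power2_eq_square)
  finally show ?thesis .
qed

lemma qform_diff: "Re (qform (A - B) v) = Re (qform A v) - Re (qform B v)"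
  by (simp add: qform_inner matrix_vector_mult_diff_rdistrib inner_diff_right)

lemma qform_add: "Re (qform (A + B) v) = Re (qform A v) + Re (qform B v)"
  by (simp add: qform_inner matrix_vector_mult_add_rdistrib inner_add_right)

lemma qform_scaleR: "Re (qform (r *\<^sub>R A) v) = r * Re (qform A v)"
  by (simp add: qform_inner scaleR_mult_vec)

lemma qform_mat_1: "Re (qform (mat 1) v) = (norm v)\<^sup>2"
  by (simp add: qform_inner power2_norm_eq_inner)

lemma qform_qeval_lipschitz:
  fixes Q :: "nat \<Rightarrow> real^'m::finite^'m"
  shows "\<bar>Re (qform (qeval n Q \<theta>) v) - Re (qform (qeval n Q \<theta>') v)\<bar>
      \<le> (real CARD('m))\<^sup>2 * (real n * coef_norm n Q * \<bar>\<theta> - \<theta>'\<bar>) * (norm v)\<^sup>2"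
  unfolding qform_diff[symmetric]
  by (rule abs_qform_le) (simp only: vector_minus_component norm_qeval_nth_diff_le)

text \<open>A trigonometric polynomial times \<open>z\<^sup>n\<close> is a polynomial in \<open>z = cis \<theta>\<close>.\<close>

lemma trig_poly_zero:
  fixes a b :: "nat \<Rightarrow> complex"
  assumes inf: "infinite S" and S: "S \<subseteq> Tset"
    and zero: "\<And>\<theta>. \<theta> \<in> S \<Longrightarrow> c0 + (\<Sum>k=1..n. a k * cis (- \<theta> * real k) + b k * cis (\<theta> * real k)) = 0"
  shows "c0 = 0" and "\<And>k. 1 \<le> k \<Longrightarrow> k \<le> n \<Longrightarrow> a k = 0 \<and> b k = 0"
proof -
  \<comment> \<open>Exponents -n to n are shifted to 0 to 2n, so the constant term sits at position
    \<open>n\<close>. The half-open interval makes \<open>cis\<close> injective, so infinitely many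
    angles give infinitely many roots.\<close>
  define c where "c j = (if j < n then a (n - j) else if j = n then c0 else b (j - n))" for j
  have "inj_on cis S"
  proof (rule inj_onI)
    fix x y assume "x \<in> S" "y \<in> S" and xy: "cis x = cis y"
    then have r: "0 \<le> x" "x < 2 * pi" "0 \<le> y" "y < 2 * pi" using S by (auto simp: Tset_def)
    have a: "Arg2pi (cis x) = x" and b: "Arg2pi (cis y) = y"
      using r by (auto intro!: Arg2pi_unique[of 1] simp: cis_conv_exp)
    show "x = y" by (rule trans[OF sym[OF a]]) (simp only: xy b)
  qed
  then have "infinite (cis ` S)" using inf finite_imageD by blast
  moreover have "cis ` S \<subseteq> {z. (\<Sum>i\<le>2*n. c i * z^i) = 0}"
  proof safe
    fix \<theta> assume "\<theta> \<in> S"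
    define z where "z = cis \<theta>"
    have z: "z \<noteq> 0" by (simp add: z_def)
    have zp: "cis (\<theta> * real k) = z ^ k" for k by (simp add: z_def Complex.DeMoivre mult.commute)
    have zm: "z ^ n * cis (- \<theta> * real k) = z ^ (n - k)" if "k \<le> n" for k
    proof -
      have "z ^ n = z ^ (n - k) * cis (\<theta> * real k)" using that by (simp add: zp flip: power_add)
      then show ?thesis by (simp add: cis_mult)
    qed
    have "(\<Sum>i\<le>2*n. c i * z^i) = (\<Sum>i<n. c i * z^i) + c n * z^n + (\<Sum>i=n+1..2*n. c i * z^i)"
    proof -
      have "{..2*n} = {..<n} \<union> {n} \<union> {n+1..2*n}" by auto
      then show ?thesis by (simp only:) (subst sum.union_disjoint; auto)+
    qed
    also have "(\<Sum>i<n. c i * z^i) = (\<Sum>k=1..n. a k * z ^ (n - k))"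
      by (rule sum.reindex_bij_witness[of _ "\<lambda>k. n - k" "\<lambda>i. n - i"]) (auto simp: c_def)
    also have "(\<Sum>i=n+1..2*n. c i * z^i) = (\<Sum>k=1..n. b k * z ^ (n + k))"
      by (rule sum.reindex_bij_witness[of _ "\<lambda>k. n + k" "\<lambda>i. i - n"]) (auto simp: c_def)
    also have "(\<Sum>k=1..n. a k * z ^ (n - k)) + c n * z ^ n + (\<Sum>k=1..n. b k * z ^ (n + k))
       = z ^ n * (c0 + (\<Sum>k=1..n. a k * cis (- \<theta> * real k) + b k * cis (\<theta> * real k)))"
      by (simp add: c_def zp zm power_add distrib_left sum_distrib_left sum.distrib mult_ac
          flip: sum.distrib del: mult_minus_left) (auto simp: zm[symmetric] simp del: mult_minus_left intro!: sum.cong)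
    also have "\<dots> = 0" using zero[OF \<open>\<theta> \<in> S\<close>] by simp
    finally show "(\<Sum>i\<le>2*n. c i * cis \<theta> ^ i) = 0" by (simp add: z_def)
  qed
  ultimately have "infinite {z. (\<Sum>i\<le>2*n. c i * z^i) = 0}" using finite_subset by blast
  then have c: "c i = 0" if "i \<le> 2 * n" for i
    using that Poly_Roots.polyfun_finite_roots[of c "2*n"] by blast
  show "c0 = 0" using c[of n] by (simp add: c_def)
  show "a k = 0 \<and> b k = 0" if "1 \<le> k" "k \<le> n" for k
    using c[of "n - k"] c[of "n + k"] that by (simp add: c_def)
qed

lemma qeval_zero:
  fixes Q :: "nat \<Rightarrow> real^'m::finite^'m"
  assumes "infinite S" "S \<subseteq> Tset" "\<And>\<theta>. \<theta> \<in> S \<Longrightarrow> qeval n Q \<theta> = 0" "k \<le> n"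
  shows "Q k = 0"
proof -
  have "complex_of_real (Q k $ a $ b) = 0" for a b
  proof -
    have z: "complex_of_real (Q 0 $ a $ b) + (\<Sum>k=1..n.
      (complex_of_real (Q k $ a $ b) / 2) * cis (- \<theta> * real k)
      + (complex_of_real (Q k $ b $ a) / 2) * cis (\<theta> * real k)) = 0" if "\<theta> \<in> S" for \<theta>
      using arg_cong[OF assms(3)[OF that], of "\<lambda>M. M $ a $ b"] unfolding qeval_nth
      by (simp add: sum_distrib_left distrib_left)
    show ?thesis
      using trig_poly_zero[OF assms(1,2) z] assms(4) by (cases "k = 0") auto
  qed
  then show ?thesis by (simp add: vec_eq_iff)
qed

lemma peval_inj:
  assumes "infinite S" "S \<subseteq> Tset" "\<And>\<theta>. \<theta> \<in> S \<Longrightarrow> peval n p \<theta> = peval n q \<theta>" "1 \<le> k" "k \<le> n"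
  shows "p k = q k"
proof -
  have z: "0 + (\<Sum>k=1..n. complex_of_real (p k - q k) * cis (- \<theta> * real k) + complex_of_real (p k - q k) * cis (\<theta> * real k)) = 0"
    if "\<theta> \<in> S" for \<theta>
  proof -
    have "(\<Sum>k=1..n. complex_of_real (p k - q k) * cis (- \<theta> * real k) + complex_of_real (p k - q k) * cis (\<theta> * real k))
      = of_real (\<Sum>k=1..n. 2 * ((p k - q k) * cos (real k * \<theta>)))"
      unfolding of_real_sum by (intro sum.cong) (simp_all add: complex_eq_iff mult.commute)
    also have "(\<Sum>k=1..n. 2 * ((p k - q k) * cos (real k * \<theta>))) = 2 * (peval n p \<theta> - peval n q \<theta>)"
      by (simp add: peval_eq sum_subtractf sum_distrib_left algebra_simps flip: sum_subtractf)
    finally show ?thesis using assms(3)[OF that] by simp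
  qed
  show ?thesis using trig_poly_zero(2)[OF assms(1,2) z assms(4,5)] by simp
qed

text \<open>Passes from an almost-everywhere identity to infinitely many angles, which is all that
  the vanishing criterion for trigonometric polynomials asks for.\<close>

lemma AE_infinite:
  assumes "AE x in lborel. x \<in> {a<..<b::real} \<longrightarrow> P x" "a < b"
  shows "infinite {x\<in>{a<..<b}. P x}"
proof
  assume fin: "finite {x\<in>{a<..<b}. P x}"
  have "AE x in lborel. x \<notin> {x\<in>{a<..<b}. P x}"
    using finite_imp_null_set_lborel[OF fin] by (rule AE_not_in)
  with assms(1) have "AE x in lborel. x \<notin> {a<..<b}" by eventually_elim auto
  then have "{a<..<b} \<in> null_sets lborel" by (subst AE_iff_null_sets) auto
  then show False using assms(2) by (auto simp: null_sets_def)
qed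

section \<open>Lower bounds from the integral of the reciprocal\<close>

lemma has_integral_inverse_linear:
  fixes a b c u :: real
  assumes "a \<le> b" "c \<noteq> 0" "\<And>x. x \<in> {a..b} \<Longrightarrow> u + c * x > 0"
  shows "((\<lambda>x. 1 / (u + c * x)) has_integral (ln (u + c * b) / c - ln (u + c * a) / c)) {a..b}"
proof (rule fundamental_theorem_of_calculus[OF assms(1)])
  fix x assume "x \<in> {a..b}"
  then have p: "u + c * x > 0" by (rule assms(3))
  have "((\<lambda>x. ln (u + c * x) / c) has_real_derivative c * (1 / (u + c * x)) / c) (at x within {a..b})"
    using p by (auto intro!: derivative_eq_intros simp: divide_simps)
  then show "((\<lambda>x. ln (u + c * x) / c) has_vector_derivative 1 / (u + c * x)) (at x within {a..b})"
    using assms(2) by (simp flip: has_real_derivative_iff_has_vector_derivative)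
qed

text \<open>Near \<open>t\<close> the function is at most
  \<open>f t + L * \<bar>\<theta> - t\<bar>\<close>, whose reciprocal integrates over a length pi to
  \<open>ln (1 + L * pi / f t) / L\<close>. This is at most \<open>C\<close>; solving for
  \<open>f t\<close> gives the bound, and \<open>C > 0\<close> shows that the bound is
  positive.\<close>

lemma integral_inverse_lipschitz_bound:
  fixes f :: "real \<Rightarrow> real"
  assumes L: "L > 0" and cont: "continuous_on {0..2*pi} f" and pos: "\<And>\<theta>. \<theta> \<in> {0..2*pi} \<Longrightarrow> f \<theta> > 0"
    and lip: "\<And>\<theta> \<theta>'. \<bar>f \<theta> - f \<theta>'\<bar> \<le> L * \<bar>\<theta> - \<theta>'\<bar>"
    and int: "integral {0..2*pi} (\<lambda>\<theta>. 1 / f \<theta>) \<le> C" and t: "t \<in> {0..2*pi}"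
  shows "L * pi / (exp (C * L) - 1) \<le> f t" "C > 0"
proof -
  have s: "f t > 0" using pos t by blast
  have I: "(\<lambda>\<theta>. 1 / f \<theta>) integrable_on {0..2*pi}"
    using pos by (intro integrable_continuous_interval continuous_intros cont) force
  define b where "b = ln (f t + L * pi) / L - ln (f t) / L"
  have sL: "f t + L * pi > f t" using L by simp
  then have "ln (f t) < ln (f t + L * pi)" using s by (intro iffD2[OF ln_less_cancel_iff]) auto
  then have b0: "b > 0" using L unfolding b_def by (simp add: divide_strict_right_mono)
  have "b \<le> integral {0..2*pi} (\<lambda>\<theta>. 1 / f \<theta>)"
  \<comment> \<open>An interval of length pi with endpoint \<open>t\<close> fits into the domain on
    at least one side.\<close>
  proof (cases "t \<le> pi")
    case True
    have "0 < f t - L * t + L * x" if "x \<in> {t..t+pi}" for x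
    proof -
      have "0 \<le> L * (x - t)" using that L by auto
      then show ?thesis using s by (simp add: algebra_simps)
    qed
    then have hi: "((\<lambda>\<theta>. 1 / (f t + L * (\<theta> - t))) has_integral b) {t..t+pi}"
      using has_integral_inverse_linear[of t "t+pi" L "f t - L * t"] L by (simp add: b_def algebra_simps)
    have sub: "{t..t+pi} \<subseteq> {0..2*pi}" using t True by auto
    have I': "(\<lambda>\<theta>. 1 / f \<theta>) integrable_on {t..t+pi}"
      using integrable_on_subinterval[OF I sub] .
    have "b \<le> integral {t..t+pi} (\<lambda>\<theta>. 1 / f \<theta>)"
    proof (rule has_integral_le[OF hi integrable_integral[OF I']])
      fix x assume x: "x \<in> {t..t+pi}"
      then have "f x \<le> f t + L * (x - t)" using lip[of x t] by auto
      then show "1 / (f t + L * (x - t)) \<le> 1 / f x" using pos[of x] x sub by (intro divide_left_mono) auto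
    qed
    also have "\<dots> \<le> integral {0..2*pi} (\<lambda>\<theta>. 1 / f \<theta>)"
      using pos by (intro integral_subset_le sub I I') (auto simp: less_imp_le)
    finally show ?thesis .
  next
    case False
    have "0 < f t + L * t + - L * x" if "x \<in> {t-pi..t}" for x
    proof -
      have "0 \<le> L * (t - x)" using that L by auto
      then show ?thesis using s by (simp add: algebra_simps)
    qed
    then have hi: "((\<lambda>\<theta>. 1 / (f t + L * (t - \<theta>))) has_integral b) {t-pi..t}"
      using has_integral_inverse_linear[of "t-pi" t "-L" "f t + L * t"] L by (simp add: b_def algebra_simps)
    have sub: "{t-pi..t} \<subseteq> {0..2*pi}" using t False by auto
    have I': "(\<lambda>\<theta>. 1 / f \<theta>) integrable_on {t-pi..t}"
      using integrable_on_subinterval[OF I sub] .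
    have "b \<le> integral {t-pi..t} (\<lambda>\<theta>. 1 / f \<theta>)"
    proof (rule has_integral_le[OF hi integrable_integral[OF I']])
      fix x assume x: "x \<in> {t-pi..t}"
      then have "f x \<le> f t + L * (t - x)" using lip[of x t] by auto
      then show "1 / (f t + L * (t - x)) \<le> 1 / f x" using pos[of x] x sub by (intro divide_left_mono) auto
    qed
    also have "\<dots> \<le> integral {0..2*pi} (\<lambda>\<theta>. 1 / f \<theta>)"
      using pos by (intro integral_subset_le sub I I') (auto simp: less_imp_le)
    finally show ?thesis .
  qed
  then have bC: "b \<le> C" using int by simp
  then show C: "C > 0" using b0 by simp
  have "ln ((f t + L * pi) / f t) = L * b"
  proof -
    have "f t + L * pi > 0" using s sL by linarith
    then show ?thesis using s L by (simp add: ln_divide_pos b_def right_diff_distrib)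
  qed
  then have "(f t + L * pi) / f t = exp (L * b)"
    using s L by (metis divide_pos_pos exp_ln add_pos_pos mult_pos_pos pi_gt_zero)
  also have "\<dots> \<le> exp (C * L)" using bC L by (simp add: mult.commute)
  finally have "L * pi \<le> (exp (C * L) - 1) * f t" using s by (simp add: field_simps)
  moreover have "exp (C * L) - 1 > 0" using C L by simp
  ultimately show "L * pi / (exp (C * L) - 1) \<le> f t" by (simp add: field_simps)
qed

section \<open>Nonnegative cosine polynomials\<close>

lemma integral_cos_multiple:
  "((\<lambda>\<theta>. cos (real k * \<theta>)) has_integral (if k = 0 then 2 * pi else 0)) {0..2*pi}"
proof (cases "k = 0")
  case True
  then show ?thesis using has_integral_const_real[of "1::real" 0 "2*pi"] by simp
next
  case False
  have "((\<lambda>\<theta>. cos (real k * \<theta>)) has_integral sin (real k * (2 * pi)) / real k - sin (real k * 0) / real k) {0..2*pi}"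
    using False by (intro fundamental_theorem_of_calculus)
      (auto intro!: derivative_eq_intros simp flip: has_real_derivative_iff_has_vector_derivative)
  moreover have "sin (real k * (2 * pi)) = 0"
    using sin_npi[of "2 * k"] by (simp add: mult_ac)
  ultimately show ?thesis using False by simp
qed

lemma integral_cos_cos:
  assumes "k \<ge> 1"
  shows "((\<lambda>\<theta>. cos (real j * \<theta>) * cos (real k * \<theta>)) has_integral (if j = k then pi else 0)) {0..2*pi}"
proof -
  define d where "d = (if j \<le> k then k - j else j - k)"
  have "cos (real j * \<theta>) * cos (real k * \<theta>) = (cos (real (j + k) * \<theta>) + cos (real d * \<theta>)) / 2" for \<theta>
  proof -
    have "cos (real d * \<theta>) = cos (real j * \<theta> - real k * \<theta>)"
    proof (cases "j \<le> k")
      case True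
      then have "real d * \<theta> = - (real j * \<theta> - real k * \<theta>)" by (simp add: d_def of_nat_diff algebra_simps)
      then show ?thesis by (metis cos_minus)
    qed (simp add: d_def of_nat_diff algebra_simps)
    moreover have "real (j + k) * \<theta> = real j * \<theta> + real k * \<theta>" by (simp add: algebra_simps)
    ultimately show ?thesis by (simp add: cos_times_cos)
  qed
  moreover have "((\<lambda>\<theta>. (cos (real (j + k) * \<theta>) + cos (real d * \<theta>)) / 2) has_integral
     ((if j + k = 0 then 2 * pi else 0) + (if d = 0 then 2 * pi else 0)) / 2) {0..2*pi}"
    by (intro has_integral_divide has_integral_add integral_cos_multiple)
  moreover have "((if j + k = 0 then 2 * pi else 0) + (if d = 0 then 2 * pi else 0)) / 2 = (if j = k then pi else 0)"
    using assms by (auto simp: d_def)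
  ultimately show ?thesis by (simp only:)
qed

text \<open>Integrate \<open>p\<close> against the nonnegative kernels \<open>1 \<plusminus> cos k\<theta>\<close>.\<close>

lemma nonneg_trig_poly_coeff_bound:
  assumes "\<And>\<theta>. \<theta> \<in> {0..2*pi} \<Longrightarrow> peval n p \<theta> \<ge> 0" "1 \<le> k" "k \<le> n"
  shows "\<bar>p k\<bar> \<le> 2"
proof -
  have *: "0 \<le> 2 * pi + s * (pi * p k)" if s: "\<bar>s\<bar> \<le> 1" for s :: real
  proof -
    have 1: "((\<lambda>\<theta>. peval n p \<theta>) has_integral 2 * pi + (\<Sum>j=1..n. p j * 0)) {0..2*pi}"
      unfolding peval_eq
    proof (intro has_integral_add has_integral_sum has_integral_mult_right)
      show "((\<lambda>x. 1::real) has_integral 2 * pi) {0..2*pi}"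
        using has_integral_const_real[of "1::real" 0 "2*pi"] by simp
      show "((\<lambda>x. cos (real j * x)) has_integral 0) {0..2 * pi}" if "j \<in> {1..n}" for j
        using integral_cos_multiple[of j] that by simp
    qed simp
    have 2: "((\<lambda>\<theta>. peval n p \<theta> * cos (real k * \<theta>)) has_integral 0 + (\<Sum>j=1..n. p j * (if j = k then pi else 0))) {0..2*pi}"
      unfolding peval_eq distrib_right sum_distrib_right mult_1_left mult.assoc
      using integral_cos_multiple[of k] assms(2)
      by (intro has_integral_add has_integral_sum has_integral_mult_right integral_cos_cos) auto
    have "(\<Sum>j=1..n. p j * (if j = k then pi else 0)) = pi * p k"
      using assms(2,3) by (simp add: if_distrib[of "\<lambda>x. _ * x"] cong: if_cong)
    then have "((\<lambda>\<theta>. peval n p \<theta> + s * (peval n p \<theta> * cos (real k * \<theta>))) has_integral 2 * pi + s * (pi * p k)) {0..2*pi}"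
      using has_integral_add[OF 1 has_integral_mult_right[OF 2, of s]] by simp
    then show ?thesis
    proof (rule has_integral_nonneg)
      fix x assume "x \<in> {0..2*pi}"
      have "\<bar>s * cos (real k * x)\<bar> \<le> 1 * 1" unfolding abs_mult using s by (intro mult_mono) auto
      then have "0 \<le> peval n p x * (1 + s * cos (real k * x))"
        using assms(1)[OF \<open>x \<in> _\<close>] by (intro mult_nonneg_nonneg) auto
      then show "0 \<le> peval n p x + s * (peval n p x * cos (real k * x))" by (simp add: algebra_simps)
    qed
  qed
  have "0 \<le> pi * (2 + p k)" "0 \<le> pi * (2 - p k)" using *[of 1] *[of "-1"] by (simp_all add: algebra_simps)
  then show ?thesis using pi_gt_zero by (auto simp: zero_le_mult_iff abs_le_iff)
qed

lemma abs_pdir_le: "\<bar>pdir n h \<theta>\<bar> \<le> (\<Sum>k=1..n. \<bar>h k\<bar>)"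
  unfolding pdir_def by (rule order_trans[OF sum_abs]) (auto intro!: sum_mono simp: abs_mult mult_left_le)

lemma peval_le:
  assumes "\<And>k. 1 \<le> k \<Longrightarrow> k \<le> n \<Longrightarrow> \<bar>p k\<bar> \<le> 2"
  shows "\<bar>peval n p \<theta>\<bar> \<le> 1 + 2 * real n"
proof -
  have "\<bar>pdir n p \<theta>\<bar> \<le> (\<Sum>k=1..n. 2)"
    by (rule order_trans[OF abs_pdir_le], rule sum_mono) (use assms in auto)
  then show ?thesis by (auto simp: peval_eq pdir_def)
qed

text \<open>The constant depends on \<open>n\<close> alone and not on the polynomial, which makes
  the pointwise lower bound for \<open>p\<close> uniform.\<close>

lemma peval_lipschitz:
  assumes "\<And>k. 1 \<le> k \<Longrightarrow> k \<le> n \<Longrightarrow> \<bar>p k\<bar> \<le> 2"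
  shows "\<bar>peval n p \<theta> - peval n p \<theta>'\<bar> \<le> 2 * (real n)\<^sup>2 * \<bar>\<theta> - \<theta>'\<bar>"
proof -
  have "\<bar>p k * (cos (real k * \<theta>) - cos (real k * \<theta>'))\<bar> \<le> 2 * (real n * \<bar>\<theta> - \<theta>'\<bar>)" if "k \<in> {1..n}" for k
  proof -
    have "\<bar>cos (real k * \<theta>) - cos (real k * \<theta>')\<bar> \<le> norm (cis (real k * \<theta>) - cis (real k * \<theta>'))"
      using abs_Re_le_cmod[of "cis (real k * \<theta>) - cis (real k * \<theta>')"] by simp
    also have "\<dots> \<le> \<bar>real k * \<theta> - real k * \<theta>'\<bar>" by (rule norm_cis_diff)
    also have "\<dots> = real k * \<bar>\<theta> - \<theta>'\<bar>" by (simp add: abs_mult flip: right_diff_distrib)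
    also have "\<dots> \<le> real n * \<bar>\<theta> - \<theta>'\<bar>" using that by (intro mult_right_mono) auto
    finally show ?thesis unfolding abs_mult using assms[of k] that by (intro mult_mono) auto
  qed
  then have "\<bar>\<Sum>k=1..n. p k * (cos (real k * \<theta>) - cos (real k * \<theta>'))\<bar> \<le> (\<Sum>k=1..n. 2 * (real n * \<bar>\<theta> - \<theta>'\<bar>))"
    by (intro order_trans[OF sum_abs] sum_mono)
  then show ?thesis by (simp add: peval_eq sum_subtractf algebra_simps power2_eq_square flip: sum_subtractf)
qed

section \<open>The dual functional and its first variation\<close>

definition Phi_of :: "real \<Rightarrow> complex^'m::finite^'m \<Rightarrow> complex^'m^'m" where
  "Phi_of p A = p *\<^sub>R matrix_inv A"

text \<open>This is p log det(p A^-1) - m p + lam / p with the logarithm expanded. Setting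
  \<open>lam\<close> to 0 gives the integrand of J alone, which is how boundary points are
  treated.\<close>

definition dual_integrand :: "real \<Rightarrow> real \<Rightarrow> complex^'m::finite^'m \<Rightarrow> real" where
  "dual_integrand lam p A = real CARD('m) * p * ln p - p * ln (Re (det A)) - real CARD('m) * p + lam / p"

lemma posdef_Phi_of: "posdef A \<Longrightarrow> p > 0 \<Longrightarrow> posdef (Phi_of p A)"
  by (simp add: Phi_of_def posdef_scaleR posdef_inv)

lemma det_Phi_of:
  fixes A :: "complex^'m::finite^'m"
  assumes "posdef A"
  shows "Re (det (Phi_of p A)) = p ^ CARD('m) / Re (det A)"
proof -
  have d: "Re (det A) > 0" "Im (det A) = 0" using posdef_det[OF assms] by auto
  have "det A * det (matrix_inv A) = 1"
    using matrix_inv_works(1)[OF posdef_invertible[OF assms]] by (metis det_I det_mul)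
  moreover have "det A \<noteq> 0" using d by auto
  ultimately have "det (matrix_inv A) = 1 / det A" by (simp add: eq_divide_eq mult.commute)
  also have "\<dots> = of_real (1 / Re (det A))"
    using d by (simp add: complex_eq_iff complex_is_Real_iff Re_divide Im_divide power2_eq_square)
  finally show ?thesis
    by (simp add: Phi_of_def det_scaleR_complex flip: of_real_power of_real_mult del: of_real_divide)
qed

lemma ln_det_Phi_of:
  fixes A :: "complex^'m::finite^'m"
  assumes "posdef A" "p > 0"
  shows "ln (Re (det (Phi_of p A))) = real CARD('m) * ln p - ln (Re (det A))"
  using posdef_det[OF assms(1)] assms by (simp add: det_Phi_of ln_divide_pos ln_realpow)

lemma matrix_diff_ldistrib: "A ** (B - C) = A ** B - A ** (C :: 'a::ring_1^'n^'n::finite)"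
  by (simp add: vec_eq_iff matrix_matrix_mult_def algebra_simps sum_subtractf)

lemma trace_mult_scaleR: "Re (trace (A ** (r *\<^sub>R B))) = r * Re (trace (A ** (B :: complex^'m::finite^'m)))"
  by (simp add: trace_def matrix_matrix_mult_def Re_sum sum_distrib_left algebra_simps)

lemma trace_Phi_of_mult: "Re (trace (Phi_of p A ** B)) = p * Re (trace (matrix_inv A ** B))"
  by (simp add: Phi_of_def trace_def matrix_matrix_mult_def Re_sum sum_distrib_left)

text \<open>The gap is \<open>q (tr M - ln det M - m) + \<lambda> (q - p)\<^sup>2 / (q p\<^sup>2)\<close> with \<open>M = \<Phi> B / q\<close>.\<close>

lemma dual_integrand_convex:
  fixes A B :: "complex^'m::finite^'m"
  assumes A: "posdef A" and B: "posdef B" and p: "p > 0" and q: "q > 0" and lam: "lam > 0"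
  defines "T \<equiv> dual_integrand lam p A + ((q - p) * (ln (Re (det (Phi_of p A))) - lam / p\<^sup>2)
      - Re (trace (Phi_of p A ** (B - A))))"
  shows "T \<le> dual_integrand lam q B" and "T = dual_integrand lam q B \<Longrightarrow> q = p \<and> B = A"
proof -
  define m where "m = real CARD('m)"
  define r where "r = p / q"
  have r: "r > 0" using p q by (simp add: r_def)
  define D where "D = Re (trace (Phi_of r A ** B)) - m - ln (Re (det (Phi_of r A))) - ln (Re (det B))"
  have PA: "posdef (Phi_of r A)" by (rule posdef_Phi_of[OF A r])
  have D0: "D \<ge> 0" and D1: "D = 0 \<Longrightarrow> Phi_of r A ** B = mat 1"
    using trace_mult_ge_ln_det[OF PA B] by (auto simp: D_def m_def)
  have tr: "Re (trace (Phi_of p A ** (B - A))) = q * Re (trace (Phi_of r A ** B)) - m * p"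
  proof -
    have "Phi_of p A ** (B - A) = Phi_of p A ** B - Phi_of p A ** A"
      by (rule matrix_diff_ldistrib)
    moreover have "Re (trace (Phi_of p A ** A)) = m * p"
      using matrix_inv_works(2)[OF posdef_invertible[OF A]] by (simp add: trace_Phi_of_mult trace_I m_def)
    ultimately show ?thesis
      using q by (simp add: trace_sub trace_Phi_of_mult r_def)
  qed
  have lnr: "ln r = ln p - ln q" using p q by (simp add: r_def ln_divide_pos)
  define w z where "w = lam / p\<^sup>2" and "z = lam * ((q - p)\<^sup>2 / (q * p\<^sup>2))"
  have pw: "p * w = lam / p" using p by (simp add: w_def power2_eq_square)
  have z: "z = lam / q - 2 * (lam / p) + q * w"
    using p q unfolding z_def w_def by (simp add: divide_simps) (simp add: power2_eq_square algebra_simps)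
  have gap: "dual_integrand lam q B - T = q * D + z"
    using pw unfolding T_def tr D_def ln_det_Phi_of[OF A r] ln_det_Phi_of[OF A p] dual_integrand_def lnr m_def[symmetric] w_def[symmetric] z
    by (simp add: algebra_simps)
  have sq: "(q - p)\<^sup>2 / (q * p\<^sup>2) \<ge> 0" using p q by simp
  have qD: "q * D \<ge> 0" using q D0 by simp
  have ls: "z \<ge> 0" unfolding z_def using lam sq by (intro mult_nonneg_nonneg) auto
  show "T \<le> dual_integrand lam q B" using gap qD ls by linarith
  assume "T = dual_integrand lam q B"
  then have "q * D = 0" "z = 0" using gap qD ls by linarith+
  then have pq: "q = p" and "D = 0" using p q lam by (auto simp: z_def)
  then have "matrix_inv A ** B = mat 1" using D1 q by (simp add: r_def Phi_of_def)
  then have "A ** (matrix_inv A ** B) = A" by simp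
  then have "B = A" using matrix_inv_works(1)[OF posdef_invertible[OF A]] by (simp add: matrix_mul_assoc)
  with pq show "q = p \<and> B = A" by simp
qed

lemma qeval_2pi: "qeval n Q (2 * pi) = qeval n Q 0"
proof -
  have "cis (2 * pi * real k) = 1" "cis (- (2 * pi * real k)) = 1" for k
    using cis_multiple_2pi[of "real k"] cis_multiple_2pi[of "- real k"] by simp_all
  then show ?thesis by (simp add: vec_eq_iff qeval_nth)
qed

lemma peval_2pi: "peval n p (2 * pi) = peval n p 0"
  using peval_reflect[of n p 0] by simp

text \<open>Positivity is given on the half-open interval, whereas compactness arguments need the
  closed one; periodicity supplies the missing endpoint.\<close>

lemma Tset_closed_interval: "f (2 * pi) = f 0 \<Longrightarrow> (\<And>\<theta>. \<theta> \<in> Tset \<Longrightarrow> P (f \<theta>)) \<Longrightarrow> \<theta> \<in> {0..2*pi} \<Longrightarrow> P (f \<theta>)"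
  by (cases "\<theta> = 2 * pi") (auto simp: Tset_def)

lemma Bo_pos: "p \<in> Bo n \<Longrightarrow> \<theta> \<in> {0..2*pi} \<Longrightarrow> peval n p \<theta> > 0"
  using Tset_closed_interval[of "peval n p" "\<lambda>x. x > 0" \<theta>] by (auto simp: Bo_def peval_2pi)

lemma Bm_posdef: "Q \<in> Bm n E \<Longrightarrow> \<theta> \<in> {0..2*pi} \<Longrightarrow> posdef (qeval n Q \<theta>)"
  using Tset_closed_interval[of "qeval n Q" posdef \<theta>] by (auto simp: Bm_def qeval_2pi)

lemma continuous_on_Phi_of:
  fixes f :: "'a::t2_space \<Rightarrow> nat \<Rightarrow> real" and g :: "'a \<Rightarrow> nat \<Rightarrow> real^'m::finite^'m"
  assumes f: "continuous_on S f" and g: "continuous_on S g" and e: "continuous_on S e"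
    and pd: "\<And>x. x \<in> S \<Longrightarrow> posdef (qeval n (g x) (e x))"
  shows "continuous_on S (\<lambda>x. Phi_of (peval n (f x) (e x)) (qeval n (g x) (e x)))"
  unfolding Phi_of_def
  by (intro continuous_on_scaleR continuous_on_peval continuous_on_matrix_inv continuous_on_qeval f g e)
    (use posdef_det[OF pd] in fastforce)

definition lin_part :: "nat \<Rightarrow> (nat \<Rightarrow> real^'m::finite^'m) \<Rightarrow> (nat \<Rightarrow> real) \<Rightarrow> (nat \<Rightarrow> real) \<Rightarrow> (nat \<Rightarrow> real^'m^'m) \<Rightarrow> real" where
  "lin_part n R c p Q = (\<Sum>k=0..n. trace (transpose (Q k) ** R k)) - (\<Sum>k=0..n. p k * c k)"

text \<open>Real-valued counterpart of \<open>Jtilde\<close> for interior points;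
  \<open>Jtilde_interior\<close> identifies the two.\<close>

definition dual_fun :: "nat \<Rightarrow> real \<Rightarrow> (nat \<Rightarrow> real^'m::finite^'m) \<Rightarrow> (nat \<Rightarrow> real) \<Rightarrow> (nat \<Rightarrow> real) \<Rightarrow> (nat \<Rightarrow> real^'m^'m) \<Rightarrow> real" where
  "dual_fun n lam R c p Q = integral {0..2*pi} (\<lambda>\<theta>. dual_integrand lam (peval n p \<theta>) (qeval n Q \<theta>)) / (2*pi) + lin_part n R c p Q"

text \<open>The formal directional derivative of \<open>dual_integrand\<close>. Differentiating
  \<open>p * ln p\<close> produces a summand m that cancels the derivative of -m p, so the
  derivative in p is \<open>ln det \<Phi> - lam / p\<^sup>2\<close>; the derivative in A pairs with
  -\<Phi>. These two are the origin of the moment conditions.\<close>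

definition dual_deriv_integrand :: "nat \<Rightarrow> real \<Rightarrow> (nat \<Rightarrow> real) \<Rightarrow> (nat \<Rightarrow> real^'m::finite^'m) \<Rightarrow> (nat \<Rightarrow> real) \<Rightarrow> (nat \<Rightarrow> real^'m^'m) \<Rightarrow> real \<Rightarrow> real" where
  "dual_deriv_integrand n lam p Q h H \<theta> = pdir n h \<theta> * (ln (Re (det (Phi_of (peval n p \<theta>) (qeval n Q \<theta>)))) - lam / (peval n p \<theta>)\<^sup>2)
      - Re (trace (Phi_of (peval n p \<theta>) (qeval n Q \<theta>) ** qeval n H \<theta>))"

text \<open>Given by its formula rather than as a limit: the arguments use its tangent inequality
  and its continuity along lines, not differentiability of \<open>dual_fun\<close>.\<close>

definition dual_deriv :: "nat \<Rightarrow> real \<Rightarrow> (nat \<Rightarrow> real^'m::finite^'m) \<Rightarrow> (nat \<Rightarrow> real) \<Rightarrow> (nat \<Rightarrow> real) \<Rightarrow> (nat \<Rightarrow> real^'m^'m)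
    \<Rightarrow> (nat \<Rightarrow> real) \<Rightarrow> (nat \<Rightarrow> real^'m^'m) \<Rightarrow> real" where
  "dual_deriv n lam R c p Q h H = integral {0..2*pi} (dual_deriv_integrand n lam p Q h H) / (2*pi) + lin_part n R c h H"

lemma continuous_on_gfun:
  fixes f :: "'a::t2_space \<Rightarrow> nat \<Rightarrow> real" and g :: "'a \<Rightarrow> nat \<Rightarrow> real^'m::finite^'m"
  assumes f: "continuous_on S f" and g: "continuous_on S g" and e: "continuous_on S e"
    and pos: "\<And>x. x \<in> S \<Longrightarrow> peval n (f x) (e x) > 0"
    and pd: "\<And>x. x \<in> S \<Longrightarrow> posdef (qeval n (g x) (e x))"
  shows "continuous_on S (\<lambda>x. dual_integrand lam (peval n (f x) (e x)) (qeval n (g x) (e x)))"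
proof -
  have p: "continuous_on S (\<lambda>x. peval n (f x) (e x))" by (rule continuous_on_peval[OF f e])
  have d: "continuous_on S (\<lambda>x. Re (det (qeval n (g x) (e x))))"
    by (intro continuous_on_Re continuous_on_det continuous_on_qeval g e)
  have "peval n (f x) (e x) \<noteq> 0" "Re (det (qeval n (g x) (e x))) \<noteq> 0" if "x \<in> S" for x
    using pos[OF that] posdef_det[OF pd[OF that]] by auto
  then show ?thesis
    unfolding dual_integrand_def
    by (intro continuous_on_add continuous_on_diff continuous_on_mult continuous_on_ln continuous_on_divide
        continuous_on_const p d) auto
qed

lemma continuous_on_dint:
  fixes f :: "'a::t2_space \<Rightarrow> nat \<Rightarrow> real" and g :: "'a \<Rightarrow> nat \<Rightarrow> real^'m::finite^'m"
  assumes f: "continuous_on S f" and g: "continuous_on S g" and e: "continuous_on S e"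
    and pos: "\<And>x. x \<in> S \<Longrightarrow> peval n (f x) (e x) > 0"
    and pd: "\<And>x. x \<in> S \<Longrightarrow> posdef (qeval n (g x) (e x))"
  shows "continuous_on S (\<lambda>x. dual_deriv_integrand n lam (f x) (g x) h H (e x))"
proof -
  have p: "continuous_on S (\<lambda>x. peval n (f x) (e x))" by (rule continuous_on_peval[OF f e])
  have Phi: "continuous_on S (\<lambda>x. Phi_of (peval n (f x) (e x)) (qeval n (g x) (e x)))"
    by (rule continuous_on_Phi_of[OF f g e pd])
  have "Re (det (Phi_of (peval n (f x) (e x)) (qeval n (g x) (e x)))) \<noteq> 0" "(peval n (f x) (e x))\<^sup>2 \<noteq> 0" if "x \<in> S" for x
    using posdef_det[OF posdef_Phi_of[OF pd[OF that] pos[OF that]]] pos[OF that] by auto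
  then show ?thesis
    unfolding dual_deriv_integrand_def
    by (intro continuous_on_diff continuous_on_mult continuous_on_ln continuous_on_divide continuous_on_pdir
        continuous_on_power continuous_on_const continuous_on_Re continuous_on_det continuous_on_trace
        continuous_on_matrix_mult continuous_on_qeval p Phi e) auto
qed

lemma dual_integrand_integrable:
  assumes "p \<in> Bo n" "Q \<in> Bm n E"
  shows "(\<lambda>\<theta>. dual_integrand lam (peval n p \<theta>) (qeval n Q \<theta>)) integrable_on {0..2*pi}"
  by (intro integrable_continuous_interval continuous_on_gfun continuous_on_const continuous_on_id)
    (use Bo_pos[OF assms(1)] Bm_posdef[OF assms(2)] in auto)

lemma dual_deriv_integrand_continuous:
  assumes "p \<in> Bo n" "Q \<in> Bm n E"
  shows "continuous_on {0..2*pi} (dual_deriv_integrand n lam p Q h H)"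
  by (intro continuous_on_dint[where f="\<lambda>_. p" and g="\<lambda>_. Q" and e="\<lambda>x. x"] continuous_on_const continuous_on_id)
    (use Bo_pos[OF assms(1)] Bm_posdef[OF assms(2)] in auto)

lemma dual_deriv_integrand_scale:
  "dual_deriv_integrand n lam p Q (\<lambda>k. t * h k) (\<lambda>k. t *\<^sub>R H k) \<theta> = t * dual_deriv_integrand n lam p Q h H \<theta>"
proof -
  have "pdir n (\<lambda>k. t * h k) \<theta> = t * pdir n h \<theta>" by (simp add: pdir_def sum_distrib_left mult.assoc)
  then show ?thesis by (simp add: dual_deriv_integrand_def qeval_scale trace_mult_scaleR algebra_simps)
qed

lemma lin_part_scale: "lin_part n R c (\<lambda>k. t * h k) (\<lambda>k. t *\<^sub>R H k) = t * lin_part n R c h H"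
proof -
  have "trace (transpose (t *\<^sub>R A) ** B) = t * trace (transpose A ** B)" for A B :: "real^'a^'a"
    by (simp add: trace_def matrix_matrix_mult_def transpose_def sum_distrib_left algebra_simps)
  then show ?thesis by (simp add: lin_part_def sum_distrib_left algebra_simps)
qed

lemma lin_part_add: "lin_part n R c (\<lambda>k. p k + t * h k) (\<lambda>k. Q k + t *\<^sub>R H k) = lin_part n R c p Q + t * lin_part n R c h H"
proof -
  have "trace (transpose (C + t *\<^sub>R A) ** B) = trace (transpose C ** B) + t * trace (transpose A ** B)" for A B C :: "real^'a^'a"
    by (simp add: trace_def matrix_matrix_mult_def transpose_def sum_distrib_left algebra_simps sum.distrib)
  then show ?thesis by (simp add: lin_part_def sum_distrib_left algebra_simps sum.distrib)
qed

lemma dual_deriv_scale: "dual_deriv n lam R c p Q (\<lambda>k. t * h k) (\<lambda>k. t *\<^sub>R H k) = t * dual_deriv n lam R c p Q h H"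
proof -
  have "dual_deriv_integrand n lam p Q (\<lambda>k. t * h k) (\<lambda>k. t *\<^sub>R H k) = (\<lambda>\<theta>. t * dual_deriv_integrand n lam p Q h H \<theta>)"
    by (simp add: dual_deriv_integrand_scale fun_eq_iff)
  then show ?thesis by (simp add: dual_deriv_def lin_part_scale algebra_simps)
qed

text \<open>The tangent is taken at the moved point and evaluated back at the starting point. In
  this form, minimality of the starting point yields a lower bound for the derivative at the moved
  point.\<close>

lemma dual_integrand_convex_line:
  assumes "p \<in> Bo n" "Q \<in> Bm n E" "\<theta> \<in> {0..2*pi}" "lam > 0"
    "(\<lambda>k. p k + t * h k) \<in> Bo n" "(\<lambda>k. Q k + t *\<^sub>R H k) \<in> Bm n E"
  shows "dual_integrand lam (peval n (\<lambda>k. p k + t * h k) \<theta>) (qeval n (\<lambda>k. Q k + t *\<^sub>R H k) \<theta>) + - t * dual_deriv_integrand n lam (\<lambda>k. p k + t * h k) (\<lambda>k. Q k + t *\<^sub>R H k) h H \<theta>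
      \<le> dual_integrand lam (peval n p \<theta>) (qeval n Q \<theta>)"
proof -
  define p' Q' where "p' = (\<lambda>k. p k + t * h k)" and "Q' = (\<lambda>k. Q k + t *\<^sub>R H k)"
  have pd: "peval n p \<theta> - peval n p' \<theta> = - t * pdir n h \<theta>"
    and qd: "qeval n Q \<theta> - qeval n Q' \<theta> = (- t) *\<^sub>R qeval n H \<theta>"
    by (simp_all add: p'_def Q'_def peval_add qeval_add)
  show ?thesis
    using dual_integrand_convex(1)[OF Bm_posdef[OF assms(6,3)] Bm_posdef[OF assms(2,3)] Bo_pos[OF assms(5,3)] Bo_pos[OF assms(1,3)] assms(4)]
    unfolding p'_def[symmetric] Q'_def[symmetric] pd qd trace_mult_scaleR dual_deriv_integrand_def by (simp add: right_diff_distrib mult.assoc)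
qed

lemma dual_fun_convex_line:
  assumes "p \<in> Bo n" "Q \<in> Bm n E" "lam > 0"
    "(\<lambda>k. p k + t * h k) \<in> Bo n" "(\<lambda>k. Q k + t *\<^sub>R H k) \<in> Bm n E"
  shows "dual_fun n lam R c (\<lambda>k. p k + t * h k) (\<lambda>k. Q k + t *\<^sub>R H k)
      - t * dual_deriv n lam R c (\<lambda>k. p k + t * h k) (\<lambda>k. Q k + t *\<^sub>R H k) h H \<le> dual_fun n lam R c p Q"
proof -
  define p' Q' where "p' = (\<lambda>k. p k + t * h k)" and "Q' = (\<lambda>k. Q k + t *\<^sub>R H k)"
  have B: "p' \<in> Bo n" "Q' \<in> Bm n E" using assms by (simp_all add: p'_def Q'_def)
  have di: "dual_deriv_integrand n lam p' Q' h H integrable_on {0..2*pi}"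
    by (intro integrable_continuous_interval dual_deriv_integrand_continuous[OF B])
  have gi: "(\<lambda>\<theta>. dual_integrand lam (peval n p' \<theta>) (qeval n Q' \<theta>)) integrable_on {0..2*pi}"
    by (rule dual_integrand_integrable[OF B])
  have "integral {0..2*pi} (\<lambda>\<theta>. dual_integrand lam (peval n p' \<theta>) (qeval n Q' \<theta>) + - t * dual_deriv_integrand n lam p' Q' h H \<theta>)
      \<le> integral {0..2*pi} (\<lambda>\<theta>. dual_integrand lam (peval n p \<theta>) (qeval n Q \<theta>))"
    using dual_integrand_convex_line[OF assms(1,2) _ assms(3,4,5)] unfolding p'_def[symmetric] Q'_def[symmetric]
    by (intro integral_le integrable_add gi integrable_on_mult_right di dual_integrand_integrable[OF assms(1,2)]) auto
  also have "integral {0..2*pi} (\<lambda>\<theta>. dual_integrand lam (peval n p' \<theta>) (qeval n Q' \<theta>) + - t * dual_deriv_integrand n lam p' Q' h H \<theta>)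
     = integral {0..2*pi} (\<lambda>\<theta>. dual_integrand lam (peval n p' \<theta>) (qeval n Q' \<theta>)) + - t * integral {0..2*pi} (dual_deriv_integrand n lam p' Q' h H)"
    by (subst integral_add[OF gi integrable_on_mult_right[OF di]]) (simp only: integral_mult_right)
  finally have "(integral {0..2*pi} (\<lambda>\<theta>. dual_integrand lam (peval n p' \<theta>) (qeval n Q' \<theta>)) + - t * integral {0..2*pi} (dual_deriv_integrand n lam p' Q' h H)) / (2*pi)
     \<le> integral {0..2*pi} (\<lambda>\<theta>. dual_integrand lam (peval n p \<theta>) (qeval n Q \<theta>)) / (2*pi)"
    by (intro divide_right_mono) auto
  moreover have "lin_part n R c p' Q' = lin_part n R c p Q + t * lin_part n R c h H"
    unfolding p'_def Q'_def by (rule lin_part_add)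
  ultimately show ?thesis
    unfolding p'_def[symmetric] Q'_def[symmetric] dual_fun_def dual_deriv_def
    by (simp add: add_divide_distrib diff_divide_distrib algebra_simps)
qed

text \<open>Convexity gives \<open>dual_deriv (x + t d) d \<ge> 0\<close> for small \<open>t > 0\<close> without differentiating the
  functional; let \<open>t \<rightarrow> 0\<close>.\<close>

lemma first_variation_nonneg:
  fixes Q :: "nat \<Rightarrow> real^'m::finite^'m"
  assumes t0: "t0 > 0" and lam: "lam > 0"
    and adm: "\<And>t. t \<in> {0..t0} \<Longrightarrow> (\<lambda>k. p k + t * h k) \<in> Bo n \<and> (\<lambda>k. Q k + t *\<^sub>R H k) \<in> Bm n E"
    and min: "\<And>t. t \<in> {0..t0} \<Longrightarrow> dual_fun n lam R c p Q \<le> dual_fun n lam R c (\<lambda>k. p k + t * h k) (\<lambda>k. Q k + t *\<^sub>R H k)"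
  shows "dual_deriv n lam R c p Q h H \<ge> 0"
proof -
  define D where "D t = dual_deriv n lam R c (\<lambda>k. p k + t * h k) (\<lambda>k. Q k + t *\<^sub>R H k) h H" for t
  have pQ: "p \<in> Bo n" "Q \<in> Bm n E" using adm[of 0] t0 by auto
  have "D t \<ge> 0" if t: "t \<in> {0<..t0}" for t
  proof -
    have "t * D t \<ge> 0"
      using dual_fun_convex_line[OF pQ lam, of t h H R c] adm[of t] min[of t] t by (auto simp: D_def)
    then show ?thesis using t by (simp add: zero_le_mult_iff)
  qed
  then have ev: "eventually (\<lambda>t. D t \<ge> 0) (at_right 0)"
    unfolding eventually_at_right_field using t0 by (metis greaterThanAtMost_iff less_eq_real_def)
  \<comment> \<open>Joint continuity on a compact rectangle makes the integral continuous in
    \<open>t\<close>, which lets the sign of \<open>D\<close> pass to \<open>t = 0\<close>.\<close>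
  have "continuous_on ({0..t0} \<times> cbox 0 (2*pi)) (\<lambda>(t, \<theta>). dual_deriv_integrand n lam (\<lambda>k. p k + t * h k) (\<lambda>k. Q k + t *\<^sub>R H k) h H \<theta>)"
    unfolding case_prod_beta
  proof (rule continuous_on_dint)
    show "continuous_on ({0..t0} \<times> cbox 0 (2*pi)) (\<lambda>x. \<lambda>k. p k + fst x * h k)"
      "continuous_on ({0..t0} \<times> cbox 0 (2*pi)) (\<lambda>x. \<lambda>k. Q k + fst x *\<^sub>R H k)"
      "continuous_on ({0..t0} \<times> cbox 0 (2*pi)) (snd :: real \<times> real \<Rightarrow> real)"
      by (intro continuous_intros)+
  qed (use adm Bo_pos Bm_posdef in fastforce)+
  then have "continuous_on {0..t0} (\<lambda>t. integral (cbox 0 (2*pi)) (dual_deriv_integrand n lam (\<lambda>k. p k + t * h k) (\<lambda>k. Q k + t *\<^sub>R H k) h H))"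
    by (rule integral_continuous_on_param)
  then have "continuous_on {0..t0} D"
    unfolding D_def dual_deriv_def cbox_interval by (intro continuous_intros) auto
  then have "(D \<longlongrightarrow> D 0) (at 0 within {0..t0})"
    using t0 by (simp add: continuous_on_def)
  then have "(D \<longlongrightarrow> D 0) (at_right 0)"
    using t0 by (simp add: at_within_Icc_at_right)
  then have "D 0 \<ge> 0" using ev by (intro tendsto_lowerbound) auto
  then show ?thesis by (simp add: D_def)
qed

section \<open>Compactness, and the moment pairing as an integral\<close>

text \<open>Tychonoff's theorem. Coefficients are functions on all of \<open>nat\<close>, so bounded
  closed sets of tuples get their compactness from the product topology.\<close>

lemma compact_coordinates:
  fixes C :: "'i \<Rightarrow> 'a::topological_space set"
  assumes "\<And>k. compact (C k)"
  shows "compact {f. \<forall>k. f k \<in> C k}"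
proof -
  have "compactin (product_topology (\<lambda>_. euclidean) UNIV) (PiE UNIV C)"
    using assms by (subst compactin_PiE) simp
  moreover have "PiE UNIV C = {f. \<forall>k. f k \<in> C k}" by (auto simp: PiE_def)
  ultimately show ?thesis by (simp add: euclidean_product_topology)
qed

lemma continuous_on_coef: "continuous_on S (\<lambda>f. f k :: 'a::topological_space)"
  by (rule continuous_on_subset[OF continuous_on_product_coordinates]) simp

lemma continuous_on_coef_entry: "continuous_on S (\<lambda>Q. Q k $ a $ b :: real)"
  by (intro continuous_on_component continuous_on_coef)

text \<open>The linear constraints of \<open>Bm\<close> without positivity, that is, the space in
  which directions of variation live.\<close>

definition Qspace :: "nat \<Rightarrow> ('m::finite \<times> 'm) set \<Rightarrow> (nat \<Rightarrow> real^'m^'m) set" where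
  "Qspace n E = {Q. transpose (Q 0) = Q 0 \<and> (\<forall>k>n. Q k = 0) \<and> (\<forall>k a b. (a,b) \<notin> E \<longrightarrow> Q k $ a $ b = 0)}"

lemma Bm_iff: "Q \<in> Bm n E \<longleftrightarrow> Q \<in> Qspace n E \<and> (\<forall>\<theta>\<in>Tset. posdef (qeval n Q \<theta>))"
  by (auto simp: Bm_def Qspace_def)

lemma Qspace_add: "Q \<in> Qspace n E \<Longrightarrow> H \<in> Qspace n E \<Longrightarrow> (\<lambda>k. Q k + t *\<^sub>R H k) \<in> Qspace n E"
  by (auto simp: Qspace_def transpose_def vec_eq_iff)

lemma Qspace_scale: "Q \<in> Qspace n E \<Longrightarrow> (\<lambda>k. t *\<^sub>R Q k) \<in> Qspace n E"
  by (auto simp: Qspace_def transpose_def vec_eq_iff)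

lemma Qspace_hermitian: "Q \<in> Qspace n E \<Longrightarrow> hermitian (qeval n Q \<theta>)"
  by (simp add: Qspace_def hermitian_qeval)

lemma closed_Qspace: "closed (Qspace n (E :: ('m::finite \<times> 'm) set))"
proof -
  have "Qspace n E = {Q. (\<forall>a b. Q 0 $ a $ b = Q 0 $ b $ a) \<and> (\<forall>k a b. k > n \<longrightarrow> Q k $ a $ b = 0)
     \<and> (\<forall>k a b. (a,b) \<notin> E \<longrightarrow> Q k $ a $ b = 0)}"
    by (auto simp: Qspace_def transpose_def vec_eq_iff)
  also have "closed \<dots>"
    by (intro closed_Collect_conj closed_Collect_all closed_Collect_imp closed_Collect_eq
         continuous_on_coef_entry continuous_on_const open_Collect_const)
  finally show ?thesis .
qed

text \<open>Serves twice: with \<open>\<eta> > 0\<close> as a compact piece of the interior on which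
  to minimise, and with \<open>\<eta> = 0\<close> as a bounded part of the closed cone, for the
  coercivity constant.\<close>

definition Bm_cpt :: "nat \<Rightarrow> ('m::finite \<times> 'm) set \<Rightarrow> real \<Rightarrow> real \<Rightarrow> (nat \<Rightarrow> real^'m^'m) set" where
  "Bm_cpt n E C \<eta> = {Q \<in> Qspace n E. coef_norm n Q \<le> C \<and>
     (\<forall>\<theta>\<in>{0..2*pi}. \<forall>v. \<eta> * (norm v)\<^sup>2 \<le> Re (qform (qeval n Q \<theta>) v))}"

text \<open>The bound 2 on the coefficients already follows from nonnegativity of the polynomial;
  stating it makes compactness immediate. With \<open>\<delta> = 0\<close> the set contains the
  closure of \<open>Bo\<close>.\<close>

definition Bo_cpt :: "nat \<Rightarrow> real \<Rightarrow> (nat \<Rightarrow> real) set" where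
  "Bo_cpt n \<delta> = {p. p 0 = 1 \<and> (\<forall>k>n. p k = 0) \<and> (\<forall>k. \<bar>p k\<bar> \<le> 2) \<and> (\<forall>\<theta>\<in>{0..2*pi}. \<delta> \<le> peval n p \<theta>)}"

lemma continuous_on_coef_norm: "continuous_on S (coef_norm n)"
  unfolding coef_norm_def[abs_def] by (intro continuous_on_sum continuous_on_norm continuous_on_coef)

lemma norm_le_coef_norm: "k \<le> n \<Longrightarrow> norm (Q k) \<le> coef_norm n Q"
  unfolding coef_norm_def by (rule member_le_sum) auto

lemma compact_Bm_cpt: "compact (Bm_cpt n E C \<eta>)"
proof -
  define A where "A = {Q :: nat \<Rightarrow> real^'a^'a. \<forall>k. Q k \<in> (if k \<le> n then cball 0 C else {0})}"
  define B where "B = {Q :: nat \<Rightarrow> real^'a^'a. coef_norm n Q \<le> C \<and>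
     (\<forall>\<theta> v. \<theta> \<in> {0..2*pi} \<longrightarrow> \<eta> * (norm v)\<^sup>2 \<le> Re (qform (qeval n Q \<theta>) v))}"
  have "closed B" unfolding B_def
    by (intro closed_Collect_conj closed_Collect_all closed_Collect_imp closed_Collect_le continuous_on_coef_norm
       continuous_on_const open_Collect_const continuous_on_qform continuous_on_qeval continuous_on_id)
  then have "closed (Qspace n E \<inter> B)" by (intro closed_Int closed_Qspace)
  moreover have "compact A" unfolding A_def by (rule compact_coordinates) auto
  ultimately have "compact (A \<inter> (Qspace n E \<inter> B))" by (rule compact_Int_closed[rotated])
  moreover have "A \<inter> (Qspace n E \<inter> B) = Bm_cpt n E C \<eta>"
  proof (intro set_eqI iffI)
    fix Q assume Q: "Q \<in> Bm_cpt n E C \<eta>"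
    have "Q k \<in> (if k \<le> n then cball 0 C else {0})" for k
      using Q norm_le_coef_norm[of k n Q] by (auto simp: Bm_cpt_def Qspace_def)
    then show "Q \<in> A \<inter> (Qspace n E \<inter> B)" using Q by (auto simp: A_def B_def Bm_cpt_def)
  qed (auto simp: B_def Bm_cpt_def)
  ultimately show ?thesis by simp
qed

lemma compact_Bo_cpt: "compact (Bo_cpt n \<delta>)"
proof -
  define A where "A = {p :: nat \<Rightarrow> real. \<forall>k. p k \<in> {-2..2}}"
  define B where "B = {p :: nat \<Rightarrow> real. p 0 = 1 \<and> (\<forall>k. k > n \<longrightarrow> p k = 0) \<and>
     (\<forall>\<theta>. \<theta> \<in> {0..2*pi} \<longrightarrow> \<delta> \<le> peval n p \<theta>)}"
  have "closed B" unfolding B_def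
    by (intro closed_Collect_conj closed_Collect_all closed_Collect_imp closed_Collect_le closed_Collect_eq
       continuous_on_const open_Collect_const continuous_on_peval continuous_on_id continuous_on_coef)
  moreover have "compact A" unfolding A_def by (rule compact_coordinates) auto
  ultimately have "compact (A \<inter> B)" by (rule compact_Int_closed[rotated])
  moreover have "A \<inter> B = Bo_cpt n \<delta>"
    by (auto simp: A_def B_def Bo_cpt_def abs_le_iff minus_le_iff)
  ultimately show ?thesis by simp
qed

section \<open>The moment pairing as an integral\<close>

lemma set_integrable_mult_cis:
  assumes "set_integrable lborel A f"
  shows "set_integrable lborel A (\<lambda>\<theta>. f \<theta> * cis (\<theta> * r))"
proof -
  have m: "(\<lambda>\<theta>. cis (\<theta> * r)) \<in> borel_measurable lborel"
    by (simp, intro borel_measurable_continuous_onI continuous_intros)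
  have f: "integrable lborel (\<lambda>\<theta>. indicator A \<theta> *\<^sub>R f \<theta>)"
    using assms by (simp add: set_integrable_def)
  have "integrable lborel (\<lambda>\<theta>. (indicator A \<theta> *\<^sub>R f \<theta>) * cis (\<theta> * r))"
    by (rule Bochner_Integration.integrable_bound[OF f borel_measurable_times[OF borel_measurable_integrable[OF f] m]])
      (simp add: norm_mult)
  then show ?thesis by (simp add: set_integrable_def)
qed

lemma trace_transpose_mult: "trace (transpose A ** B) = (\<Sum>a\<in>UNIV. \<Sum>b\<in>UNIV. A$a$b * (B :: real^'m::finite^'m)$a$b)"
  unfolding trace_def matrix_matrix_mult_def transpose_def by (simp, subst sum.swap, simp)

text \<open>Only the prescribed moments of the feasible density enter, since \<open>Q\<close> is supported in \<open>E\<close>.\<close>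

lemma lin_trace_integral:
  fixes Phib :: "real \<Rightarrow> complex^'m::finite^'m" and R :: "nat \<Rightarrow> real^'m^'m"
  assumes int: "\<And>a b. set_integrable lborel {0..2*pi} (\<lambda>\<theta>. Phib \<theta> $ a $ b)"
    and herm: "\<And>\<theta>. \<theta> \<in> Tset \<Longrightarrow> hermitian (Phib \<theta>)"
    and mom: "\<And>a b k. (a,b) \<in> E \<Longrightarrow> k \<le> n \<Longrightarrow>
           (LINT \<theta>:{0..2*pi}|lborel. Phib \<theta> $ a $ b * cis (\<theta> * real k)) / complex_of_real (2*pi)
             = complex_of_real (R k $ a $ b)"
    and E_sym: "\<And>a b. (a,b) \<in> E \<Longrightarrow> (b,a) \<in> E"
    and Q: "Q \<in> Qspace n E"
  shows "has_bochner_integral lborel (\<lambda>\<theta>. indicator {0..2*pi} \<theta> *\<^sub>R Re (trace (qeval n Q \<theta> ** Phib \<theta>)))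
     (2 * pi * (\<Sum>k=0..n. trace (transpose (Q k) ** R k)))"
proof -
  let ?I = "indicator {0..2*pi} :: real \<Rightarrow> real"
  let ?hb = "\<lambda>f v. has_bochner_integral lborel (\<lambda>\<theta>. ?I \<theta> *\<^sub>R (f \<theta> :: complex)) v"
  \<comment> \<open>The endpoint \<open>2 * pi\<close> lies outside \<open>Tset\<close> but forms a
    null set.\<close>
  have AEh: "AE \<theta> in lborel. \<theta> \<in> {0..2*pi} \<longrightarrow> hermitian (Phib \<theta>)"
    using AE_lborel_singleton[of "2*pi"] by eventually_elim (auto simp: Tset_def intro: herm)
  have pos: "?hb (\<lambda>\<theta>. Phib \<theta> $ a $ b * cis (\<theta> * real k)) (2 * pi * R k $ a $ b)" if "(a,b) \<in> E" "k \<le> n" for a b k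
  proof -
    have i: "integrable lborel (\<lambda>\<theta>. ?I \<theta> *\<^sub>R (Phib \<theta> $ a $ b * cis (\<theta> * real k)))"
      using set_integrable_mult_cis[OF int] by (simp add: set_integrable_def)
    have "(LINT \<theta>:{0..2*pi}|lborel. Phib \<theta> $ a $ b * cis (\<theta> * real k)) = complex_of_real (2*pi) * R k $ a $ b"
      using mom[OF that] by (simp add: field_simps)
    then show ?thesis using i by (simp add: has_bochner_integral_iff set_lebesgue_integral_def)
  qed
  \<comment> \<open>Conjugating the moment of order k at (a,b) gives the moment of order -k at
    (b,a), because the density is Hermitian; the value is unchanged because it is real.\<close>
  have neg: "?hb (\<lambda>\<theta>. Phib \<theta> $ b $ a * cis (- \<theta> * real k)) (2 * pi * R k $ a $ b)" if "(a,b) \<in> E" "k \<le> n" for a b k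
  proof -
    have h: "has_bochner_integral lborel (\<lambda>\<theta>. cnj (?I \<theta> *\<^sub>R (Phib \<theta> $ a $ b * cis (\<theta> * real k)))) (cnj (complex_of_real (2 * pi * R k $ a $ b)))"
      using pos[OF that] by (rule has_bochner_integral_cnj)
    have ae: "AE \<theta> in lborel. cnj (?I \<theta> *\<^sub>R (Phib \<theta> $ a $ b * cis (\<theta> * real k))) = ?I \<theta> *\<^sub>R (Phib \<theta> $ b $ a * cis (- \<theta> * real k))"
      using AEh
    proof eventually_elim
      case (elim \<theta>)
      show ?case
      proof (cases "\<theta> \<in> {0..2*pi}")
        case True
        then have "Phib \<theta> $ b $ a = cnj (Phib \<theta> $ a $ b)" using elim unfolding hermitian_def by blast
        then show ?thesis by (simp add: cis_cnj)
      qed simp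
    qed
    have "(\<lambda>\<theta>. ?I \<theta> *\<^sub>R (Phib \<theta> $ b $ a * cis (\<theta> * - real k))) \<in> borel_measurable lborel"
      using set_integrable_mult_cis[OF int, of b a "- real k"] unfolding set_integrable_def
      by (rule borel_measurable_integrable)
    then have ms: "(\<lambda>\<theta>. ?I \<theta> *\<^sub>R (Phib \<theta> $ b $ a * cis (- \<theta> * real k))) \<in> borel_measurable lborel" by simp
    show ?thesis
      using h unfolding has_bochner_integral_cong_AE[OF borel_measurable_has_bochner_integral[OF h] ms ae]
      by (simp only: complex_cnj_complex_of_real)
  qed
  define val where "val a b = Q 0 $ a $ b * R 0 $ b $ a + (1/2) * (\<Sum>k=1..n. Q k $ a $ b * R k $ a $ b + Q k $ b $ a * R k $ b $ a)" for a b
  have ent: "?hb (\<lambda>\<theta>. qeval n Q \<theta> $ a $ b * Phib \<theta> $ b $ a) (2 * pi * val a b)" for a b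
  proof (cases "(a,b) \<in> E")
    case True
    have ba: "(b,a) \<in> E" using E_sym[OF True] .
    have "has_bochner_integral lborel (\<lambda>\<theta>. complex_of_real (Q 0 $ a $ b) * (?I \<theta> *\<^sub>R (Phib \<theta> $ b $ a * cis (\<theta> * real 0))) + (1/2) * (\<Sum>k=1..n.
       complex_of_real (Q k $ a $ b) * (?I \<theta> *\<^sub>R (Phib \<theta> $ b $ a * cis (- \<theta> * real k)))
       + complex_of_real (Q k $ b $ a) * (?I \<theta> *\<^sub>R (Phib \<theta> $ b $ a * cis (\<theta> * real k)))))
      (complex_of_real (Q 0 $ a $ b) * complex_of_real (2 * pi * R 0 $ b $ a) + (1/2) * (\<Sum>k=1..n.
        complex_of_real (Q k $ a $ b) * complex_of_real (2 * pi * R k $ a $ b)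
        + complex_of_real (Q k $ b $ a) * complex_of_real (2 * pi * R k $ b $ a)))"
      by (intro has_bochner_integral_add has_bochner_integral_mult_right has_bochner_integral_sum pos[OF ba] neg[OF True]) auto
    then show ?thesis
      by (simp add: qeval_nth val_def algebra_simps sum_distrib_left sum_distrib_right sum.distrib scaleR_conv_of_real)
  next
    case False
    then have "(b,a) \<notin> E" using E_sym by blast
    then have "Q k $ a $ b = 0" "Q k $ b $ a = 0" for k
      using Q False by (auto simp: Qspace_def)
    then show ?thesis by (simp add: qeval_nth val_def has_bochner_integral_zero)
  qed
  have "?hb (\<lambda>\<theta>. \<Sum>a\<in>UNIV. \<Sum>b\<in>UNIV. qeval n Q \<theta> $ a $ b * Phib \<theta> $ b $ a) (\<Sum>a\<in>UNIV. \<Sum>b\<in>UNIV. complex_of_real (2 * pi * val a b))"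
    unfolding scaleR_sum_right by (intro has_bochner_integral_sum ent[unfolded of_real_mult[symmetric]])
  then have "has_bochner_integral lborel (\<lambda>\<theta>. Re (?I \<theta> *\<^sub>R trace (qeval n Q \<theta> ** Phib \<theta>))) (Re (\<Sum>a\<in>UNIV. \<Sum>b\<in>UNIV. complex_of_real (2 * pi * val a b)))"
    by (intro has_bochner_integral_Re) (simp add: trace_def matrix_matrix_mult_def)
  moreover have "Re (\<Sum>a\<in>UNIV. \<Sum>b\<in>UNIV. complex_of_real (2 * pi * val a b)) = 2 * pi * (\<Sum>k=0..n. trace (transpose (Q k) ** R k))"
  proof -
    have Q0: "Q 0 $ a $ b = Q 0 $ b $ a" for a b
      using Q by (auto simp: Qspace_def transpose_def vec_eq_iff)
    \<comment> \<open>After summation over all entries the transposed terms agree, so every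
      coefficient with \<open>k \<ge> 1\<close> is counted twice, which the factor 1/2 in
      \<open>qeval\<close> undoes.\<close>
    have s: "(\<Sum>a\<in>UNIV. \<Sum>b\<in>UNIV. Q k $ b $ a * R k $ b $ a) = (\<Sum>a\<in>UNIV. \<Sum>b\<in>UNIV. Q k $ a $ b * R k $ a $ b)" for k
      by (rule sum.swap)
    have "(\<Sum>a\<in>UNIV. \<Sum>b\<in>UNIV. val a b) = (\<Sum>a\<in>UNIV. \<Sum>b\<in>UNIV. Q 0 $ b $ a * R 0 $ b $ a)
       + (1/2) * (\<Sum>k=1..n. (\<Sum>a\<in>UNIV. \<Sum>b\<in>UNIV. Q k $ a $ b * R k $ a $ b) + (\<Sum>a\<in>UNIV. \<Sum>b\<in>UNIV. Q k $ b $ a * R k $ b $ a))"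
    proof -
      have "(\<Sum>a\<in>UNIV. \<Sum>b\<in>UNIV. \<Sum>k=1..n. f k a b) = (\<Sum>a\<in>UNIV. \<Sum>k=1..n. \<Sum>b\<in>UNIV. f k a b)" for f :: "nat \<Rightarrow> 'm \<Rightarrow> 'm \<Rightarrow> real"
        by (intro sum.cong refl sum.swap)
      also have "(\<Sum>a\<in>UNIV. \<Sum>k=1..n. \<Sum>b\<in>UNIV. f k a b) = (\<Sum>k=1..n. \<Sum>a\<in>UNIV. \<Sum>b\<in>UNIV. f k a b)" for f :: "nat \<Rightarrow> 'm \<Rightarrow> 'm \<Rightarrow> real"
        by (rule sum.swap)
      finally have sw: "(\<Sum>a\<in>UNIV. \<Sum>b\<in>UNIV. \<Sum>k=1..n. f k a b) = (\<Sum>k=1..n. \<Sum>a\<in>UNIV. \<Sum>b\<in>UNIV. f k a b)" for f :: "nat \<Rightarrow> 'm \<Rightarrow> 'm \<Rightarrow> real" .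
      have "(\<Sum>a\<in>UNIV. \<Sum>b\<in>UNIV. val a b) = (\<Sum>a\<in>UNIV. \<Sum>b\<in>UNIV. Q 0 $ a $ b * R 0 $ b $ a)
         + (1/2) * (\<Sum>a\<in>UNIV. \<Sum>b\<in>UNIV. \<Sum>k=1..n. Q k $ a $ b * R k $ a $ b + Q k $ b $ a * R k $ b $ a)"
        unfolding val_def sum.distrib sum_distrib_left[symmetric] by (rule refl)
      also have "(\<Sum>a\<in>UNIV. \<Sum>b\<in>UNIV. Q 0 $ a $ b * R 0 $ b $ a) = (\<Sum>a\<in>UNIV. \<Sum>b\<in>UNIV. Q 0 $ b $ a * R 0 $ b $ a)"
        by (intro sum.cong refl) (simp add: Q0)
      finally show ?thesis unfolding sw by (simp only: sum.distrib)
    qed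
    also have "\<dots> = (\<Sum>k=0..n. trace (transpose (Q k) ** R k))"
      by (simp add: s trace_transpose_mult sum.atLeast_Suc_atMost[of 0] flip: sum_distrib_left)
    finally show ?thesis by (simp add: Re_sum flip: sum_distrib_left)
  qed
  ultimately show ?thesis by simp
qed

section \<open>Coercivity\<close>

lemma possemidef_qeval_iff:
  "Q \<in> Qspace n E \<Longrightarrow> possemidef (qeval n Q \<theta>) \<longleftrightarrow> (\<forall>v. 0 \<le> Re (qform (qeval n Q \<theta>) v))"
  by (simp add: possemidef_def Qspace_hermitian)

text \<open>The integrand tr(Q \<Phi>) is nonnegative. If its integral were zero, \<open>Q\<close>
  would vanish almost everywhere on the interval where the density is definite, hence at infinitely
  many angles, hence in all its coefficients.\<close>

lemma lin_trace_pos: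
  fixes Phib :: "real \<Rightarrow> complex^'m::finite^'m" and R :: "nat \<Rightarrow> real^'m^'m"
  assumes int: "\<And>a b. set_integrable lborel {0..2*pi} (\<lambda>\<theta>. Phib \<theta> $ a $ b)"
    and psd: "\<And>\<theta>. \<theta> \<in> Tset \<Longrightarrow> possemidef (Phib \<theta>)"
    and ab: "\<alpha> < \<beta>" "{\<alpha><..<\<beta>} \<subseteq> Tset" "\<And>\<theta>. \<theta> \<in> {\<alpha><..<\<beta>} \<Longrightarrow> posdef (Phib \<theta>)"
    and mom: "\<And>a b k. (a,b) \<in> E \<Longrightarrow> k \<le> n \<Longrightarrow>
           (LINT \<theta>:{0..2*pi}|lborel. Phib \<theta> $ a $ b * cis (\<theta> * real k)) / complex_of_real (2*pi)
             = complex_of_real (R k $ a $ b)"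
    and E_sym: "\<And>a b. (a,b) \<in> E \<Longrightarrow> (b,a) \<in> E"
    and Q: "Q \<in> Qspace n E" "\<And>\<theta>. \<theta> \<in> Tset \<Longrightarrow> possemidef (qeval n Q \<theta>)"
    and nz: "k \<le> n" "Q k \<noteq> 0"
  shows "(\<Sum>k=0..n. trace (transpose (Q k) ** R k)) > 0"
proof -
  define g where "g \<theta> = indicator {0..2*pi} \<theta> *\<^sub>R Re (trace (qeval n Q \<theta> ** Phib \<theta>))" for \<theta>
  have hb: "has_bochner_integral lborel g (2 * pi * (\<Sum>k=0..n. trace (transpose (Q k) ** R k)))"
    unfolding g_def using psd by (intro lin_trace_integral[OF int _ mom E_sym Q(1)]) (auto simp: possemidef_def)
  have g0: "AE \<theta> in lborel. g \<theta> \<ge> 0"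
    using AE_lborel_singleton[of "2*pi"]
  proof eventually_elim
    case (elim \<theta>)
    show ?case
    proof (cases "\<theta> \<in> {0..2*pi}")
      case True
      then have "\<theta> \<in> Tset" using elim by (auto simp: Tset_def)
      then show ?thesis by (simp add: g_def trace_mult_possemidef[OF Q(2) psd])
    qed (simp add: g_def)
  qed
  have gi: "integrable lborel g" and ge: "integral\<^sup>L lborel g = 2 * pi * (\<Sum>k=0..n. trace (transpose (Q k) ** R k))"
    using hb by (auto simp: has_bochner_integral_iff)
  have "integral\<^sup>L lborel g \<ge> 0" by (rule integral_nonneg_AE[OF g0])
  moreover have "integral\<^sup>L lborel g \<noteq> 0"
  proof
    assume "integral\<^sup>L lborel g = 0"
    then have "AE \<theta> in lborel. g \<theta> = 0" using integral_nonneg_eq_0_iff_AE[OF gi g0] by simp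
    then have "AE \<theta> in lborel. \<theta> \<in> {\<alpha><..<\<beta>} \<longrightarrow> qeval n Q \<theta> = 0"
    proof eventually_elim
      case (elim \<theta>)
      show ?case
      proof
        assume t: "\<theta> \<in> {\<alpha><..<\<beta>}"
        then have T: "\<theta> \<in> Tset" using ab(2) by blast
        then have "Re (trace (qeval n Q \<theta> ** Phib \<theta>)) = 0" using elim by (auto simp: g_def Tset_def)
        then show "qeval n Q \<theta> = 0" by (rule trace_mult_posdef(2)[OF Q(2)[OF T] ab(3)[OF t]])
      qed
    qed
    then have "infinite {\<theta>\<in>{\<alpha><..<\<beta>}. qeval n Q \<theta> = 0}" by (rule AE_infinite[OF _ ab(1)])
    then have "Q k = 0" by (rule qeval_zero) (use ab(2) nz(1) in auto)
    then show False using nz(2) by simp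
  qed
  ultimately have "integral\<^sup>L lborel g > 0" by linarith
  then show ?thesis unfolding ge by (simp add: zero_less_mult_iff)
qed

lemma continuous_on_lin_trace:
  fixes R :: "nat \<Rightarrow> real^'m::finite^'m"
  shows "continuous_on S (\<lambda>Q. \<Sum>k=0..n. trace (transpose (Q k) ** R k))"
  unfolding trace_transpose_mult
  by (intro continuous_on_sum continuous_on_mult continuous_on_coef_entry continuous_on_const)

text \<open>A linear functional that is positive on the nonzero elements of a closed cone has a
  positive minimum on the compact unit slice; homogeneity extends the estimate to the whole
  cone.\<close>

lemma lin_trace_coercive:
  fixes R :: "nat \<Rightarrow> real^'m::finite^'m"
  assumes pos: "\<forall>Q\<in>Qspace n E. (\<forall>\<theta>\<in>Tset. possemidef (qeval n Q \<theta>)) \<longrightarrow> (\<exists>k\<le>n. Q k \<noteq> 0)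
      \<longrightarrow> (\<Sum>k=0..n. trace (transpose (Q k) ** R k)) > 0"
  obtains \<kappa> where "\<kappa> > 0" "\<And>Q. Q \<in> Qspace n E \<Longrightarrow> (\<And>\<theta>. \<theta> \<in> {0..2*pi} \<Longrightarrow> possemidef (qeval n Q \<theta>)) \<Longrightarrow>
     \<kappa> * coef_norm n Q \<le> (\<Sum>k=0..n. trace (transpose (Q k) ** R k))"
proof -
  define l where "l Q = (\<Sum>k=0..n. trace (transpose (Q k) ** R k))" for Q
  define S where "S = Bm_cpt n E 1 0 \<inter> {Q. coef_norm n Q = 1}"
  have "closed {Q :: nat \<Rightarrow> real^'m^'m. coef_norm n Q = 1}"
    by (intro closed_Collect_eq continuous_on_coef_norm continuous_on_const)
  then have cS: "compact S" unfolding S_def by (intro compact_Int_closed compact_Bm_cpt)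
  have S_pos: "l Q > 0" if "Q \<in> S" for Q
  proof -
    have Q: "Q \<in> Qspace n E" "coef_norm n Q = 1" "\<And>\<theta>. \<theta> \<in> Tset \<Longrightarrow> possemidef (qeval n Q \<theta>)"
      using that by (auto simp: S_def Bm_cpt_def possemidef_qeval_iff Tset_def)
    have "\<exists>k\<le>n. Q k \<noteq> 0"
    proof (rule ccontr)
      assume "\<not> ?thesis"
      then have "coef_norm n Q = 0" by (simp add: coef_norm_def)
      then show False using Q(2) by simp
    qed
    then show ?thesis using pos Q(1,3) by (auto simp: l_def)
  qed
  have "\<exists>\<kappa>>0. \<forall>Q\<in>S. \<kappa> \<le> l Q"
  \<comment> \<open>\<open>E\<close> is arbitrary here, so the slice may be empty; any positive
    constant then serves.\<close>
  proof (cases "S = {}")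
    case False
    have "continuous_on S l" unfolding l_def[abs_def] by (rule continuous_on_lin_trace)
    from continuous_attains_inf[OF cS False this] show ?thesis using S_pos by blast
  qed (auto intro: exI[of _ 1])
  then obtain \<kappa> where k: "\<kappa> > 0" "\<And>Q. Q \<in> S \<Longrightarrow> \<kappa> \<le> l Q" by blast
  have "\<kappa> * coef_norm n Q \<le> l Q" if Q: "Q \<in> Qspace n E" "\<And>\<theta>. \<theta> \<in> {0..2*pi} \<Longrightarrow> possemidef (qeval n Q \<theta>)" for Q
  proof (cases "coef_norm n Q = 0")
    case True
    then have "Q k = 0" if "k \<le> n" for k using norm_le_coef_norm[OF that, of Q] by simp
    then show ?thesis using True by (simp add: l_def trace_transpose_mult)
  next
    case False
    define N where "N = coef_norm n Q"
    have N: "N > 0" using False coef_norm_nonneg[of n Q] by (simp add: N_def less_le)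
    define Q' where "Q' = (\<lambda>k. (1 / N) *\<^sub>R Q k)"
    have "coef_norm n Q' = (1 / N) * coef_norm n Q"
      using N by (simp add: Q'_def coef_norm_def sum_distrib_left)
    then have "coef_norm n Q' = 1" using N by (simp add: N_def)
    moreover have "Q' \<in> Bm_cpt n E 1 0"
      using Q N calculation by (auto simp: Bm_cpt_def Q'_def Qspace_scale qeval_scale qform_scaleR possemidef_def)
    ultimately have "\<kappa> \<le> l Q'" by (intro k) (simp add: S_def)
    also have "l Q' = l Q / N"
      by (simp add: l_def Q'_def trace_transpose_mult sum_divide_distrib sum_distrib_left)
    finally show ?thesis using N by (simp add: N_def[symmetric] field_simps)
  qed
  then show ?thesis using that[OF k(1)] unfolding l_def by blast
qed

lemma Re_trace_qeval_le:
  fixes Q :: "nat \<Rightarrow> real^'m::finite^'m"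
  shows "Re (trace (qeval n Q \<theta>)) \<le> real CARD('m) * coef_norm n Q"
proof -
  have "Re (trace (qeval n Q \<theta>)) = (\<Sum>a\<in>UNIV. Re (qeval n Q \<theta> $ a $ a))" by (simp add: trace_def Re_sum)
  also have "\<dots> \<le> (\<Sum>a\<in>(UNIV::'m set). coef_norm n Q)"
    by (intro sum_mono order_trans[OF complex_Re_le_cmod norm_qeval_nth_le])
  finally show ?thesis by simp
qed

text \<open>The danger is \<open>- p * ln det A\<close> for large \<open>A\<close>. Comparing
  \<open>A\<close> with a multiple of the identity gives
  \<open>ln det A \<le> s * tr A - m - m * ln s\<close> for every \<open>s > 0\<close>, so the
  logarithmic growth is absorbed by a linear term of arbitrarily small slope. The entropy term is
  harmless, as \<open>p * ln p - p \<ge> -1\<close>.\<close>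

lemma dual_integrand_lower:
  fixes A :: "complex^'m::finite^'m"
  assumes p: "0 < p" "p \<le> b" and A: "posdef A" and tr: "Re (trace A) \<le> N" and s: "s > 0" and N: "N \<ge> 0"
  shows "lam / p - real CARD('m) - b * (s * N + \<bar>real CARD('m) + real CARD('m) * ln s\<bar>) \<le> dual_integrand lam p A"
proof -
  define m where "m = real CARD('m)"
  have "ln (1 / p) \<le> 1 / p - 1" using p by (intro ln_le_minus_one) simp
  then have "p * - ln p \<le> p * (1 / p - 1)" using p by (intro mult_left_mono) (auto simp: ln_div)
  then have "p - p * ln p \<le> 1" using p by (simp add: algebra_simps)
  then have "m * (p - p * ln p) \<le> m * 1" by (intro mult_left_mono) (simp_all add: m_def)
  then have 1: "- m \<le> m * p * ln p - m * p" by (simp add: algebra_simps)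
  have "posdef (s *\<^sub>R (mat 1 :: complex^'m^'m))" using s by (intro posdef_scaleR posdef_mat_1)
  from trace_mult_ge_ln_det(1)[OF this A]
  have "ln (Re (det A)) \<le> Re (trace ((s *\<^sub>R mat 1) ** A)) - m - ln (Re (det (s *\<^sub>R (mat 1 :: complex^'m^'m))))"
    by (simp add: m_def)
  also have "Re (trace ((s *\<^sub>R mat 1) ** A)) = s * Re (trace A)"
    using trace_mult_scaleR[of A s "mat 1"] trace_mul_sym[of "s *\<^sub>R mat 1" A] by simp
  also have "ln (Re (det (s *\<^sub>R (mat 1 :: complex^'m^'m)))) = m * ln s"
    using s by (simp add: det_scaleR_complex ln_realpow m_def flip: of_real_power)
  finally have "ln (Re (det A)) \<le> s * N + \<bar>m + m * ln s\<bar>"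
    using mult_left_mono[OF tr, of s] s by linarith
  then have "p * ln (Re (det A)) \<le> p * (s * N + \<bar>m + m * ln s\<bar>)" using p by (intro mult_left_mono) auto
  also have "\<dots> \<le> b * (s * N + \<bar>m + m * ln s\<bar>)" using p s N by (intro mult_right_mono) auto
  finally show ?thesis using 1 unfolding dual_integrand_def m_def[symmetric] by linarith
qed

lemma Bo_coeff_bound: "p \<in> Bo n \<Longrightarrow> \<bar>p k\<bar> \<le> 2"
  using nonneg_trig_poly_coeff_bound[of n p k] Bo_pos[of p n]
  by (cases "k = 0"; cases "k \<le> n") (auto simp: Bo_def less_imp_le)

lemma Bo_inverse_integrable: "p \<in> Bo n \<Longrightarrow> (\<lambda>\<theta>. 1 / peval n p \<theta>) integrable_on {0..2*pi}"
  by (intro integrable_continuous_interval continuous_on_divide continuous_on_const continuous_on_peval continuous_on_id)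
    (use Bo_pos in force)

lemma dual_fun_coercive:
  fixes R :: "nat \<Rightarrow> real^'m::finite^'m" and c :: "nat \<Rightarrow> real"
  assumes k: "\<kappa> > 0" and lam: "lam > 0"
    and coer: "\<And>Q. Q \<in> Qspace n E \<Longrightarrow> (\<And>\<theta>. \<theta> \<in> {0..2*pi} \<Longrightarrow> possemidef (qeval n Q \<theta>)) \<Longrightarrow>
     \<kappa> * coef_norm n Q \<le> (\<Sum>k=0..n. trace (transpose (Q k) ** R k))"
  obtains D where "\<And>p Q. p \<in> Bo n \<Longrightarrow> Q \<in> Bm n E \<Longrightarrow>
    \<kappa> / 2 * coef_norm n Q + lam * integral {0..2*pi} (\<lambda>\<theta>. 1 / peval n p \<theta>) / (2*pi) \<le> dual_fun n lam R c p Q + D"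
proof -
  define m where "m = real CARD('m)"
  have m: "m > 0" by (simp add: m_def)
  define b where "b = 1 + 2 * real n"
  have b: "b > 0" by (simp add: b_def add_pos_nonneg)
  \<comment> \<open>Chosen such that \<open>b * s * m = \<kappa> / 2\<close>, where \<open>b\<close>
    is the uniform bound on \<open>p\<close>: half of the linear growth of the moment pairing pays
    for the log determinant, and the other half remains.\<close>
  define s where "s = \<kappa> / (2 * b * m)"
  have s: "s > 0" using k b m by (simp add: s_def)
  define e where "e = m + b * \<bar>m + m * ln s\<bar>"
  \<comment> \<open>The second summand bounds the linear term in \<open>p\<close>, because
    admissible coefficients are at most 2 in modulus.\<close>
  define D where "D = e + (\<Sum>k=0..n. 2 * \<bar>c k\<bar>)"
  show ?thesis
  proof (rule that)
    fix p Q assume p: "p \<in> Bo n" and Q: "Q \<in> Bm n E"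
    define N where "N = coef_norm n Q"
    have N: "N \<ge> 0" by (simp add: N_def coef_norm_nonneg)
    have bs: "b * (s * (m * N)) = \<kappa> / 2 * N" using b m by (simp add: s_def)
    have pt: "lam * (1 / peval n p \<theta>) + (- e - \<kappa> / 2 * N) \<le> dual_integrand lam (peval n p \<theta>) (qeval n Q \<theta>)" if t: "\<theta> \<in> {0..2*pi}" for \<theta>
    proof -
      have "peval n p \<theta> \<le> b" using peval_le[of n p \<theta>] Bo_coeff_bound[OF p] by (simp add: b_def)
      from dual_integrand_lower[OF Bo_pos[OF p t] this Bm_posdef[OF Q t], of "m * N" s lam]
      show ?thesis using Re_trace_qeval_le[of n Q \<theta>] s N m bs
        by (simp add: m_def[symmetric] N_def[symmetric] e_def distrib_left)
    qed
    have ii: "(\<lambda>\<theta>. lam * (1 / peval n p \<theta>)) integrable_on {0..2*pi}"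
      by (intro integrable_on_mult_right Bo_inverse_integrable p)
    have "integral {0..2*pi} (\<lambda>\<theta>. lam * (1 / peval n p \<theta>) + (- e - \<kappa> / 2 * N)) \<le> integral {0..2*pi} (\<lambda>\<theta>. dual_integrand lam (peval n p \<theta>) (qeval n Q \<theta>))"
      using pt by (intro integral_le integrable_add ii integrable_const_ivl dual_integrand_integrable[OF p Q])
    also have "integral {0..2*pi} (\<lambda>\<theta>. lam * (1 / peval n p \<theta>) + (- e - \<kappa> / 2 * N))
       = lam * integral {0..2*pi} (\<lambda>\<theta>. 1 / peval n p \<theta>) + 2 * pi * (- e - \<kappa> / 2 * N)"
      by (subst integral_add[OF ii integrable_const_ivl]) (simp only: integral_mult_right, simp)
    finally have "(lam * integral {0..2*pi} (\<lambda>\<theta>. 1 / peval n p \<theta>) + 2 * pi * (- e - \<kappa> / 2 * N)) / (2*pi)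
       \<le> integral {0..2*pi} (\<lambda>\<theta>. dual_integrand lam (peval n p \<theta>) (qeval n Q \<theta>)) / (2*pi)"
      by (intro divide_right_mono) auto
    then have 1: "lam * integral {0..2*pi} (\<lambda>\<theta>. 1 / peval n p \<theta>) / (2*pi) + (- e - \<kappa> / 2 * N)
       \<le> integral {0..2*pi} (\<lambda>\<theta>. dual_integrand lam (peval n p \<theta>) (qeval n Q \<theta>)) / (2*pi)"
      by (simp add: add_divide_distrib)
    have 2: "\<kappa> * N \<le> (\<Sum>k=0..n. trace (transpose (Q k) ** R k))"
      unfolding N_def by (rule coer) (use Q Bm_posdef[OF Q] in \<open>auto simp: Bm_iff intro: posdef_imp_possemidef\<close>)
    have 3: "(\<Sum>k=0..n. p k * c k) \<le> (\<Sum>k=0..n. 2 * \<bar>c k\<bar>)"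
    proof (rule sum_mono)
      fix k
      have "p k * c k \<le> \<bar>p k\<bar> * \<bar>c k\<bar>" using abs_ge_self[of "p k * c k"] by (simp add: abs_mult)
      also have "\<dots> \<le> 2 * \<bar>c k\<bar>" by (intro mult_right_mono Bo_coeff_bound[OF p]) auto
      finally show "p k * c k \<le> 2 * \<bar>c k\<bar>" .
    qed
    show "\<kappa> / 2 * coef_norm n Q + lam * integral {0..2*pi} (\<lambda>\<theta>. 1 / peval n p \<theta>) / (2*pi) \<le> dual_fun n lam R c p Q + D"
      using 1 2 3 unfolding dual_fun_def lin_part_def D_def N_def by argo
  qed
qed

lemma Bo_cpt_subset_Bo: "\<delta> > 0 \<Longrightarrow> Bo_cpt n \<delta> \<subseteq> Bo n"
  by (force simp: Bo_cpt_def Bo_def Tset_def)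

lemma Bm_cpt_subset_Bm: "\<eta> > 0 \<Longrightarrow> Bm_cpt n E C \<eta> \<subseteq> Bm n E"
proof
  fix Q assume e: "\<eta> > 0" and Q: "Q \<in> Bm_cpt n E C \<eta>"
  have "Re (qform (qeval n Q \<theta>) v) > 0" if "\<theta> \<in> Tset" "v \<noteq> 0" for \<theta> v
  proof -
    have "0 < \<eta> * (norm v)\<^sup>2" using e that by simp
    also have "\<dots> \<le> Re (qform (qeval n Q \<theta>) v)" using Q that by (auto simp: Bm_cpt_def Tset_def)
    finally show ?thesis .
  qed
  then show "Q \<in> Bm n E" using Q by (auto simp: Bm_iff posdef_def Bm_cpt_def intro: Qspace_hermitian)
qed

lemma continuous_on_dual_fun:
  fixes R :: "nat \<Rightarrow> real^'m::finite^'m"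
  assumes "S \<subseteq> Bo n \<times> Bm n E"
  shows "continuous_on S (\<lambda>x. dual_fun n lam R c (fst x) (snd x))"
proof -
  have "continuous_on (S \<times> cbox 0 (2*pi)) (\<lambda>(x, \<theta>). dual_integrand lam (peval n (fst x) \<theta>) (qeval n (snd x) \<theta>))"
    unfolding case_prod_beta
  proof (rule continuous_on_gfun)
    show "continuous_on (S \<times> cbox 0 (2*pi)) (\<lambda>z. fst (fst z))" "continuous_on (S \<times> cbox 0 (2*pi)) (\<lambda>z. snd (fst z))"
      "continuous_on (S \<times> cbox 0 (2*pi)) snd"
      by (intro continuous_on_fst continuous_on_snd continuous_on_id)+
    fix z assume z: "z \<in> S \<times> cbox 0 (2*pi)"
    then have "fst (fst z) \<in> Bo n" "snd (fst z) \<in> Bm n E" "snd z \<in> {0..2*pi}" using assms by (auto simp: cbox_interval)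
    then show "0 < peval n (fst (fst z)) (snd z)" "posdef (qeval n (snd (fst z)) (snd z))"
      by (auto intro: Bo_pos Bm_posdef)
  qed
  then have 1: "continuous_on S (\<lambda>x. integral {0..2*pi} (\<lambda>\<theta>. dual_integrand lam (peval n (fst x) \<theta>) (qeval n (snd x) \<theta>)))"
    using integral_continuous_on_param by (fastforce simp: cbox_interval)
  have 2: "continuous_on S (\<lambda>x. fst x k)" for k
    by (rule continuous_on_product_then_coordinatewise[OF continuous_on_fst[OF continuous_on_id]])
  have 3: "continuous_on S (\<lambda>x. \<Sum>k=0..n. trace (transpose (snd x k) ** R k))"
    by (rule continuous_on_compose2[OF continuous_on_lin_trace[of UNIV]]) (auto intro: continuous_on_snd continuous_on_id)
  show ?thesis
    unfolding dual_fun_def lin_part_def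
    by (intro continuous_on_add continuous_on_diff continuous_on_divide continuous_on_sum continuous_on_mult
       continuous_on_const 1 2 3) auto
qed

lemma qform_qeval_bound:
  fixes Q :: "nat \<Rightarrow> real^'m::finite^'m"
  shows "\<bar>Re (qform (qeval n Q \<theta>) v)\<bar> \<le> (real CARD('m))\<^sup>2 * coef_norm n Q * (norm v)\<^sup>2"
  by (rule abs_qform_le) (rule norm_qeval_nth_le)

lemma coef_norm_add: "t \<ge> 0 \<Longrightarrow> coef_norm n (\<lambda>k. Q k + t *\<^sub>R H k) \<le> coef_norm n Q + t * coef_norm n H"
  unfolding coef_norm_def sum_distrib_left sum.distrib[symmetric]
  by (intro sum_mono order_trans[OF norm_triangle_ineq]) simp

section \<open>Existence of an interior stationary point\<close>

lemma continuous_on_peval_id: "continuous_on S (peval n p)"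
  by (intro continuous_on_peval[where f="\<lambda>_. p" and g="\<lambda>x. x"] continuous_on_const continuous_on_id)

lemma continuous_on_qform_qeval: "continuous_on S (\<lambda>\<theta>. Re (qform (qeval n Q \<theta>) v))"
  by (intro continuous_on_qform continuous_on_qeval continuous_on_const continuous_on_id)

text \<open>The summand 1 keeps the Lipschitz constant positive also for
  \<open>n = 0\<close>.\<close>

lemma Bo_lower_bound:
  assumes p: "p \<in> Bo n" and int: "integral {0..2*pi} (\<lambda>\<theta>. 1 / peval n p \<theta>) \<le> C" and t: "t \<in> {0..2*pi}"
  shows "(2 * (real n)\<^sup>2 + 1) * pi / (exp (C * (2 * (real n)\<^sup>2 + 1)) - 1) \<le> peval n p t"
proof (rule integral_inverse_lipschitz_bound(1)[OF _ continuous_on_peval_id _ _ int t])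
  fix \<theta> \<theta>'
  have "\<bar>peval n p \<theta> - peval n p \<theta>'\<bar> \<le> 2 * (real n)\<^sup>2 * \<bar>\<theta> - \<theta>'\<bar>"
    by (rule peval_lipschitz) (rule Bo_coeff_bound[OF p])
  then show "\<bar>peval n p \<theta> - peval n p \<theta>'\<bar> \<le> (2 * (real n)\<^sup>2 + 1) * \<bar>\<theta> - \<theta>'\<bar>"
    by (simp add: distrib_right)
qed (simp_all add: Bo_pos[OF p] add_nonneg_pos)

text \<open>Each unit vector \<open>w\<close> gives a scalar Lipschitz function, the form of
  \<open>Q\<close> at \<open>w\<close>, whose reciprocal is dominated by the trace of the inverse.
  The resulting bound does not depend on \<open>w\<close>, so it is a bound on the matrix.\<close>

lemma Bm_lower_bound:
  fixes Q :: "nat \<Rightarrow> real^'m::finite^'m"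
  assumes Q: "Q \<in> Bm n E" and N: "coef_norm n Q \<le> C1"
    and int: "integral {0..2*pi} (\<lambda>\<theta>. Re (trace (matrix_inv (qeval n Q \<theta>)))) \<le> C" and t: "t \<in> {0..2*pi}"
  defines "L \<equiv> (real CARD('m))\<^sup>2 * (real n * C1) + 1"
  shows "L * pi / (exp (C * L) - 1) * (norm v)\<^sup>2 \<le> Re (qform (qeval n Q t) v)"
proof (cases "v = 0")
  case True
  then show ?thesis by (simp add: qform_inner)
next
  case False
  have C1: "C1 \<ge> 0" using N coef_norm_nonneg[of n Q] by linarith
  have L: "L > 0" unfolding L_def using C1 by (intro add_nonneg_pos) auto
  define w where "w = (1 / norm v) *\<^sub>R v"
  have w: "norm w = 1" using False by (simp add: w_def)
  define f where "f \<theta> = Re (qform (qeval n Q \<theta>) w)" for \<theta>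
  have f: "f \<theta> > 0" if "\<theta> \<in> {0..2*pi}" for \<theta>
    using Bm_posdef[OF Q that] w unfolding f_def posdef_def by (metis norm_zero zero_neq_one)
  have fc: "continuous_on {0..2*pi} f" unfolding f_def[abs_def] by (rule continuous_on_qform_qeval)
  have lip: "\<bar>f \<theta> - f \<theta>'\<bar> \<le> L * \<bar>\<theta> - \<theta>'\<bar>" for \<theta> \<theta>'
  proof -
    have "\<bar>f \<theta> - f \<theta>'\<bar> \<le> (real CARD('m))\<^sup>2 * (real n * coef_norm n Q * \<bar>\<theta> - \<theta>'\<bar>) * (norm w)\<^sup>2"
      unfolding f_def by (rule qform_qeval_lipschitz)
    also have "\<dots> = (real CARD('m))\<^sup>2 * (real n * coef_norm n Q) * \<bar>\<theta> - \<theta>'\<bar>" using w by simp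
    also have "\<dots> \<le> L * \<bar>\<theta> - \<theta>'\<bar>"
    proof (rule mult_right_mono)
      have "(real CARD('m))\<^sup>2 * (real n * coef_norm n Q) \<le> (real CARD('m))\<^sup>2 * (real n * C1)"
        by (intro mult_left_mono N) auto
      then show "(real CARD('m))\<^sup>2 * (real n * coef_norm n Q) \<le> L" unfolding L_def by linarith
    qed simp
    finally show ?thesis .
  qed
  have "integral {0..2*pi} (\<lambda>\<theta>. 1 / f \<theta>) \<le> integral {0..2*pi} (\<lambda>\<theta>. Re (trace (matrix_inv (qeval n Q \<theta>))))"
  proof (rule integral_le)
    show "(\<lambda>\<theta>. 1 / f \<theta>) integrable_on {0..2*pi}"
      using f by (intro integrable_continuous_interval continuous_on_divide continuous_on_const fc) force
    have "det (qeval n Q \<theta>) \<noteq> 0" if "\<theta> \<in> {0..2*pi}" for \<theta>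
      using posdef_det[OF Bm_posdef[OF Q that]] by auto
    then show "(\<lambda>\<theta>. Re (trace (matrix_inv (qeval n Q \<theta>)))) integrable_on {0..2*pi}"
      by (intro integrable_continuous_interval continuous_on_Re continuous_on_trace continuous_on_matrix_inv
          continuous_on_qeval continuous_on_const continuous_on_id)
    fix \<theta> assume t: "\<theta> \<in> {0..2*pi}"
    have "1 \<le> Re (trace (matrix_inv (qeval n Q \<theta>))) * f \<theta>"
      using trace_inv_ge[OF Bm_posdef[OF Q t], of w] w by (simp add: f_def)
    then show "1 / f \<theta> \<le> Re (trace (matrix_inv (qeval n Q \<theta>)))" using f[OF t] by (simp add: divide_le_eq)
  qed
  then have "integral {0..2*pi} (\<lambda>\<theta>. 1 / f \<theta>) \<le> C" using int by linarith
  from integral_inverse_lipschitz_bound(1)[OF L fc f lip this t]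
  have "L * pi / (exp (C * L) - 1) \<le> f t" by blast
  then have "L * pi / (exp (C * L) - 1) * (norm v)\<^sup>2 \<le> f t * (norm v)\<^sup>2" by (rule mult_right_mono) simp
  also have "v = norm v *\<^sub>R w" using False by (simp add: w_def)
  then have "Re (qform (qeval n Q t) v) = f t * (norm v)\<^sup>2"
    unfolding f_def qform_inner by (metis (no_types, opaque_lifting) inner_scaleR_left inner_scaleR_right mult.assoc mult.commute mult_vec_scaleR power2_eq_square)
  then have "f t * (norm v)\<^sup>2 = Re (qform (qeval n Q t) v)" by simp
  finally show ?thesis .
qed

text \<open>Minimise over the compact set \<open>Bo_cpt \<times> Bm_cpt\<close>. The level bound keeps the minimiser off the constraints
  on \<open>p\<close> and on the size of \<open>Q\<close>; the first variation in the identity direction bounds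
  \<open>\<integral> tr Q\<^sup>-\<^sup>1\<close>, by a constant not involving \<open>\<eta>\<close>, which keeps it off the constraint \<open>Q \<ge> \<eta>\<close>.\<close>

lemma stationary_point_exists:
  fixes R :: "nat \<Rightarrow> real^'m::finite^'m" and c :: "nat \<Rightarrow> real"
  assumes k: "\<kappa> > 0" and lam: "lam > 0" and E_diag: "\<And>a. (a,a) \<in> E"
    and coer: "\<And>Q. Q \<in> Qspace n E \<Longrightarrow> (\<And>\<theta>. \<theta> \<in> {0..2*pi} \<Longrightarrow> possemidef (qeval n Q \<theta>)) \<Longrightarrow>
     \<kappa> * coef_norm n Q \<le> (\<Sum>k=0..n. trace (transpose (Q k) ** R k))"
  obtains p Q where "p \<in> Bo n" "Q \<in> Bm n E"
    "\<And>h H. h 0 = 0 \<Longrightarrow> (\<And>k. k > n \<Longrightarrow> h k = 0) \<Longrightarrow> H \<in> Qspace n E \<Longrightarrow> dual_deriv n lam R c p Q h H \<ge> 0"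
proof -
  obtain D where D: "\<And>p Q. p \<in> Bo n \<Longrightarrow> Q \<in> Bm n E \<Longrightarrow>
    \<kappa> / 2 * coef_norm n Q + lam * integral {0..2*pi} (\<lambda>\<theta>. 1 / peval n p \<theta>) / (2*pi) \<le> dual_fun n lam R c p Q + D"
    using dual_fun_coercive[where c = c, OF k lam coer] by blast
  \<comment> \<open>The constant pair p = 1, Q = I is the reference point: its value
    \<open>F0\<close> is the level that the minimiser cannot exceed.\<close>
  define p1 where "p1 = (\<lambda>k::nat. if k = 0 then 1 else 0 :: real)"
  define Q1 where "Q1 = (\<lambda>k::nat. if k = 0 then mat 1 else 0 :: real^'m^'m)"
  have p1: "peval n p1 \<theta> = 1" for \<theta> by (simp add: peval_eq p1_def)
  have Q1: "qeval n Q1 \<theta> = mat 1" for \<theta> by (simp add: vec_eq_iff qeval_nth Q1_def mat_def)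
  have Q1S: "Q1 \<in> Qspace n E" using E_diag by (auto simp: Qspace_def Q1_def transpose_def vec_eq_iff mat_def)
  define F0 where "F0 = dual_fun n lam R c p1 Q1"
  \<comment> \<open>The level bound gives \<open>coef_norm n Q \<le> C1 - 1\<close> at the
    minimiser, which leaves room 1 for variations; the middle summand admits the reference
    point.\<close>
  define C1 where "C1 = \<bar>2 * (F0 + D) / \<kappa>\<bar> + coef_norm n Q1 + 1"
  have C1: "C1 > 0" "coef_norm n Q1 \<le> C1"
    using coef_norm_nonneg[of n Q1] abs_ge_zero[of "2 * (F0 + D) / \<kappa>"] unfolding C1_def by linarith+
  define Lp where "Lp = 2 * (real n)\<^sup>2 + 1"
  have Lp: "Lp > 0" by (simp add: Lp_def add_nonneg_pos)
  \<comment> \<open>The bound on the integral of 1/p that the level \<open>F0\<close> enforces. The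
    maximum with 1, here and in \<open>CQ\<close>, keeps the denominators of \<open>dp\<close> and
    \<open>dq\<close> positive.\<close>
  define Cp where "Cp = max 1 (2 * pi * (F0 + D) / lam)"
  define dp where "dp = Lp * pi / (exp (Cp * Lp) - 1)"
  have dp: "dp > 0" unfolding dp_def using Lp by (intro divide_pos_pos mult_pos_pos) (auto simp: Cp_def)
  define \<delta> where "\<delta> = min 1 dp / 2"
  have \<delta>: "\<delta> > 0" "\<delta> \<le> 1" "\<delta> < dp" using dp by (auto simp: \<delta>_def)
  define LQ where "LQ = (real CARD('m))\<^sup>2 * (real n * C1) + 1"
  have LQ: "LQ > 0" unfolding LQ_def using C1 by (intro add_nonneg_pos) auto
  \<comment> \<open>Nonnegativity of the variation along \<open>Q1\<close> bounds the integral of p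
    tr(Q^-1) by \<open>2 * pi\<close> times this value of \<open>lin_part\<close>; the division by
    \<delta> removes the factor p.\<close>
  define CQ where "CQ = max 1 (2 * pi * lin_part n R c (\<lambda>_. 0) Q1 / \<delta>)"
  define dq where "dq = LQ * pi / (exp (CQ * LQ) - 1)"
  have dq: "dq > 0" unfolding dq_def using LQ by (intro divide_pos_pos mult_pos_pos) (auto simp: CQ_def)
  define \<eta> where "\<eta> = min 1 dq / 2"
  have \<eta>: "\<eta> > 0" "\<eta> \<le> 1" "\<eta> < dq" using dq by (auto simp: \<eta>_def)
  define K where "K = Bo_cpt n \<delta> \<times> Bm_cpt n E C1 \<eta>"
  have KB: "K \<subseteq> Bo n \<times> Bm n E" unfolding K_def by (intro Sigma_mono Bo_cpt_subset_Bo Bm_cpt_subset_Bm \<delta> \<eta>)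
  have "p1 0 = 1" "\<And>k. k > n \<Longrightarrow> p1 k = 0" "\<And>k. \<bar>p1 k\<bar> \<le> 2" by (auto simp: p1_def)
  then have in_K: "(p1, Q1) \<in> K"
    using \<delta> \<eta> C1 Q1S by (auto simp: K_def Bo_cpt_def Bm_cpt_def p1 Q1 qform_mat_1 mult_left_le_one_le)
  have "compact K" unfolding K_def by (intro compact_Times compact_Bo_cpt compact_Bm_cpt)
  then obtain x where x: "x \<in> K" "\<And>y. y \<in> K \<Longrightarrow> dual_fun n lam R c (fst x) (snd x) \<le> dual_fun n lam R c (fst y) (snd y)"
    using continuous_attains_inf[OF _ _ continuous_on_dual_fun[OF KB, of lam R c]] in_K by blast
  define p Q where "p = fst x" and "Q = snd x"
  have pQ: "(p, Q) \<in> K" "p \<in> Bo n" "Q \<in> Bm n E" using x(1) KB by (auto simp: p_def Q_def)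
  have min: "dual_fun n lam R c p Q \<le> dual_fun n lam R c q B" if "(q, B) \<in> K" for q B
    using x(2)[OF that] by (simp add: p_def Q_def)
  have p_cpt: "p \<in> Bo_cpt n \<delta>" and Q_cpt: "Q \<in> Bm_cpt n E C1 \<eta>" using pQ(1) by (auto simp: K_def)
  have QS: "Q \<in> Qspace n E" using pQ(3) by (simp add: Bm_iff)
  have Fle: "\<kappa> / 2 * coef_norm n Q + lam * integral {0..2*pi} (\<lambda>\<theta>. 1 / peval n p \<theta>) / (2*pi) \<le> F0 + D"
    using D[OF pQ(2,3)] min[OF in_K] by (simp add: F0_def)
  have I0: "0 \<le> lam * integral {0..2*pi} (\<lambda>\<theta>. 1 / peval n p \<theta>) / (2*pi)"
    using lam Bo_pos[OF pQ(2)]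
    by (intro divide_nonneg_nonneg mult_nonneg_nonneg integral_nonneg Bo_inverse_integrable pQ(2)) (auto intro: less_imp_le)
  have QC: "coef_norm n Q \<le> C1 - 1"
  proof -
    have "\<kappa> / 2 * coef_norm n Q \<le> F0 + D" using Fle I0 by linarith
    then have "coef_norm n Q \<le> 2 * (F0 + D) / \<kappa>" using k by (simp add: field_simps)
    then show ?thesis using coef_norm_nonneg[of n Q1] unfolding C1_def by linarith
  qed
  have pd: "dp \<le> peval n p \<theta>" if "\<theta> \<in> {0..2*pi}" for \<theta>
  proof -
    have "0 \<le> \<kappa> / 2 * coef_norm n Q" using k by (intro mult_nonneg_nonneg coef_norm_nonneg) auto
    then have "lam * integral {0..2*pi} (\<lambda>\<theta>. 1 / peval n p \<theta>) / (2*pi) \<le> F0 + D" using Fle by linarith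
    then have "integral {0..2*pi} (\<lambda>\<theta>. 1 / peval n p \<theta>) \<le> 2 * pi * (F0 + D) / lam"
      using lam by (simp add: field_simps)
    then have "integral {0..2*pi} (\<lambda>\<theta>. 1 / peval n p \<theta>) \<le> Cp" by (simp add: Cp_def)
    from Bo_lower_bound[OF pQ(2) this that] show ?thesis by (simp add: dp_def Lp_def)
  qed
  \<comment> \<open>The condition on the form is kept as a hypothesis because the two applications
    verify it differently: the identity direction does so before any slack in
    \<open>Q \<ge> \<eta>\<close> is known, and a general direction does so by that slack.\<close>
  have var: "dual_deriv n lam R c p Q h H \<ge> 0"
    if h: "h 0 = 0" "\<And>k. k > n \<Longrightarrow> h k = 0" and H: "H \<in> Qspace n E"
      and \<tau>: "\<tau> > 0" and \<tau>h: "\<tau> * (\<Sum>k=1..n. \<bar>h k\<bar>) \<le> dp - \<delta>" and \<tau>H: "\<tau> * coef_norm n H \<le> 1"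
      and qf: "\<And>t \<theta> v. t \<in> {0..\<tau>} \<Longrightarrow> \<theta> \<in> {0..2*pi} \<Longrightarrow> \<eta> * (norm v)\<^sup>2 \<le> Re (qform (qeval n Q \<theta>) v) + t * Re (qform (qeval n H \<theta>) v)"
    for h H \<tau>
  proof -
    have inK: "((\<lambda>k. p k + t * h k), (\<lambda>k. Q k + t *\<^sub>R H k)) \<in> K" if t: "t \<in> {0..\<tau>}" for t
    proof -
      have pe: "\<delta> \<le> peval n (\<lambda>k. p k + t * h k) \<theta>" if th: "\<theta> \<in> {0..2*pi}" for \<theta>
      proof -
        have "\<bar>t * pdir n h \<theta>\<bar> \<le> \<tau> * (\<Sum>k=1..n. \<bar>h k\<bar>)"
          unfolding abs_mult using t by (intro mult_mono abs_pdir_le) auto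
        then show ?thesis using \<tau>h pd[OF th] by (simp add: peval_add)
      qed
      have p0: "p 0 = 1" "\<And>k. k > n \<Longrightarrow> p k = 0" using pQ(2) by (auto simp: Bo_def)
      have "(\<lambda>k. p k + t * h k) \<in> Bo n"
        using pe \<delta>(1) h p0 by (force simp: Bo_def Tset_def)
      then have 1: "(\<lambda>k. p k + t * h k) \<in> Bo_cpt n \<delta>"
        using pe Bo_coeff_bound h p0 by (auto simp: Bo_cpt_def)
      have "coef_norm n (\<lambda>k. Q k + t *\<^sub>R H k) \<le> coef_norm n Q + t * coef_norm n H"
        using t by (intro coef_norm_add) auto
      also have "t * coef_norm n H \<le> \<tau> * coef_norm n H" using t by (intro mult_right_mono coef_norm_nonneg) auto
      finally have "coef_norm n (\<lambda>k. Q k + t *\<^sub>R H k) \<le> C1" using QC \<tau>H by linarith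
      then have 2: "(\<lambda>k. Q k + t *\<^sub>R H k) \<in> Bm_cpt n E C1 \<eta>"
        using qf[OF t] Qspace_add[OF QS H] by (auto simp: Bm_cpt_def qeval_add qform_add qform_scaleR)
      show ?thesis using 1 2 by (simp add: K_def)
    qed
    show ?thesis
      using inK KB by (intro first_variation_nonneg[OF \<tau> lam]) (auto intro: min)
  qed
  \<comment> \<open>Adding a multiple of the identity only raises the form, so the step length has
    to respect nothing but the size bound.\<close>
  have "dual_deriv n lam R c p Q (\<lambda>_. 0) Q1 \<ge> 0"
  proof (rule var[where \<tau> = "1 / (coef_norm n Q1 + 1)"])
    have N1: "coef_norm n Q1 + 1 > 0" using coef_norm_nonneg[of n Q1] by linarith
    then show "1 / (coef_norm n Q1 + 1) > 0" "1 / (coef_norm n Q1 + 1) * coef_norm n Q1 \<le> 1" by (auto simp: field_simps)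
    show "\<eta> * (norm v)\<^sup>2 \<le> Re (qform (qeval n Q \<theta>) v) + t * Re (qform (qeval n Q1 \<theta>) v)"
      if "t \<in> {0..1 / (coef_norm n Q1 + 1)}" "\<theta> \<in> {0..2*pi}" for t \<theta> v
      using Q_cpt that by (auto simp: Bm_cpt_def Q1 qform_mat_1 intro: add_increasing2)
  qed (use \<delta> Q1S in auto)
  moreover have "dual_deriv_integrand n lam p Q (\<lambda>_. 0) Q1 = (\<lambda>\<theta>. - (peval n p \<theta> * Re (trace (matrix_inv (qeval n Q \<theta>)))))"
    by (simp add: fun_eq_iff dual_deriv_integrand_def pdir_def Q1 trace_Phi_of_mult[of _ _ "mat 1", simplified])
  ultimately have trp: "integral {0..2*pi} (\<lambda>\<theta>. peval n p \<theta> * Re (trace (matrix_inv (qeval n Q \<theta>)))) \<le> 2 * pi * lin_part n R c (\<lambda>_. 0) Q1"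
    by (simp add: dual_deriv_def field_simps)
  have trI: "continuous_on {0..2*pi} (\<lambda>\<theta>. Re (trace (matrix_inv (qeval n Q \<theta>))))"
  proof -
    have "det (qeval n Q \<theta>) \<noteq> 0" if "\<theta> \<in> {0..2*pi}" for \<theta>
      using posdef_det[OF Bm_posdef[OF pQ(3) that]] by auto
    then show ?thesis
      by (intro continuous_on_Re continuous_on_trace continuous_on_matrix_inv
          continuous_on_qeval continuous_on_const continuous_on_id)
  qed
  have "\<delta> * integral {0..2*pi} (\<lambda>\<theta>. Re (trace (matrix_inv (qeval n Q \<theta>)))) = integral {0..2*pi} (\<lambda>\<theta>. \<delta> * Re (trace (matrix_inv (qeval n Q \<theta>))))"
    by simp
  also have "\<dots> \<le> integral {0..2*pi} (\<lambda>\<theta>. peval n p \<theta> * Re (trace (matrix_inv (qeval n Q \<theta>))))"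
  proof (intro integral_le integrable_continuous_interval continuous_on_mult continuous_on_const trI continuous_on_peval_id)
    fix \<theta> assume t: "\<theta> \<in> {0..2*pi}"
    have "0 \<le> Re (trace (matrix_inv (qeval n Q \<theta>)))"
      by (intro possemidef_trace_0 posdef_imp_possemidef posdef_inv Bm_posdef[OF pQ(3) t])
    then show "\<delta> * Re (trace (matrix_inv (qeval n Q \<theta>))) \<le> peval n p \<theta> * Re (trace (matrix_inv (qeval n Q \<theta>)))"
      using pd[OF t] \<delta> by (intro mult_right_mono) auto
  qed
  finally have "integral {0..2*pi} (\<lambda>\<theta>. Re (trace (matrix_inv (qeval n Q \<theta>)))) \<le> 2 * pi * lin_part n R c (\<lambda>_. 0) Q1 / \<delta>"
    using trp \<delta>(1) by (simp add: field_simps)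
  then have trC: "integral {0..2*pi} (\<lambda>\<theta>. Re (trace (matrix_inv (qeval n Q \<theta>)))) \<le> CQ" by (simp add: CQ_def)
  have Qd: "dq * (norm v)\<^sup>2 \<le> Re (qform (qeval n Q \<theta>) v)" if "\<theta> \<in> {0..2*pi}" for \<theta> v
    using Bm_lower_bound[OF pQ(3) _ trC that, of C1 v] QC by (simp add: dq_def LQ_def)
  show ?thesis
  proof (rule that[OF pQ(2,3)])
    fix h :: "nat \<Rightarrow> real" and H :: "nat \<Rightarrow> real^'m^'m" assume h: "h 0 = 0" "\<And>k. k > n \<Longrightarrow> h k = 0" and H: "H \<in> Qspace n E"
    define s where "s = (\<Sum>k=1..n. \<bar>h k\<bar>)"
    define N where "N = coef_norm n H"
    define M where "M = (real CARD('m))\<^sup>2 * N"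
    have s: "s \<ge> 0" by (simp add: s_def sum_nonneg)
    have N: "N \<ge> 0" by (simp add: N_def coef_norm_nonneg)
    have M: "M \<ge> 0" using N by (simp add: M_def)
    \<comment> \<open>Each entry is the room available, for \<open>p\<close>, for the size of
      \<open>Q\<close> and for its form, divided by the growth rate in the chosen direction; the
      added 1 keeps the denominators positive.\<close>
    define \<tau> where "\<tau> = min ((dp - \<delta>) / (s + 1)) (min (1 / (N + 1)) ((dq - \<eta>) / (M + 1)))"
    have le: "\<tau> * y \<le> a" if "\<tau> \<le> a / (y + 1)" "y \<ge> 0" "a > 0" for a y
    proof -
      have "\<tau> * y \<le> a / (y + 1) * y" using that by (intro mult_right_mono)
      also have "\<dots> \<le> a" using that by (simp add: field_simps)
      finally show ?thesis .
    qed
    have M1: "\<tau> * M \<le> dq - \<eta>" using le[of "dq - \<eta>" M] M \<eta> by (simp add: \<tau>_def)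
    show "dual_deriv n lam R c p Q h H \<ge> 0"
    proof (rule var[where h = h and H = H and \<tau> = \<tau>])
      show "h 0 = 0" "\<And>k. k > n \<Longrightarrow> h k = 0" "H \<in> Qspace n E" by (fact h H)+
      show "\<tau> > 0" using s N M \<delta> \<eta> by (simp add: \<tau>_def)
      show "\<tau> * (\<Sum>k=1..n. \<bar>h k\<bar>) \<le> dp - \<delta>" using le[of "dp - \<delta>" s] s \<delta> by (simp add: \<tau>_def s_def)
      show "\<tau> * coef_norm n H \<le> 1" using le[of 1 N] N by (simp add: \<tau>_def N_def)
      fix t \<theta> :: real and v :: "complex^'m"
      assume t: "t \<in> {0..\<tau>}" and th: "\<theta> \<in> {0..2*pi}"
      have "\<bar>t * Re (qform (qeval n H \<theta>) v)\<bar> \<le> \<tau> * (M * (norm v)\<^sup>2)"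
        unfolding abs_mult M_def N_def using t by (intro mult_mono qform_qeval_bound) auto
      also have "\<dots> \<le> (dq - \<eta>) * (norm v)\<^sup>2" using mult_right_mono[OF M1, of "(norm v)\<^sup>2"] by (simp add: mult.assoc)
      finally show "\<eta> * (norm v)\<^sup>2 \<le> Re (qform (qeval n Q \<theta>) v) + t * Re (qform (qeval n H \<theta>) v)"
        using Qd[OF th, of v] by (simp add: left_diff_distrib)
    qed
  qed
qed

section \<open>Moment conditions at a stationary point\<close>

lemma integral_reflect_2pi:
  fixes f :: "real \<Rightarrow> complex"
  assumes "f integrable_on {0..2*pi}"
  shows "integral {0..2*pi} (\<lambda>\<theta>. f (2 * pi - \<theta>)) = integral {0..2*pi} f"
proof -
  have "(f has_integral integral {0..2*pi} f) (cbox 0 (2*pi))"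
    using assms by (simp add: integrable_integral cbox_interval)
  from has_integral_affinity[OF this, of "-1" "2*pi"]
  have "((\<lambda>x. f (2 * pi - x)) has_integral integral {0..2*pi} f) ((\<lambda>x. 2 * pi - x) ` {0..2*pi})"
    by (simp add: cbox_interval)
  also have "(\<lambda>x. 2 * pi - x) ` {0..2*pi} = {0..2*pi}"
    by (simp add: image_diff_atLeastAtMost)
  finally show ?thesis by (rule integral_unique)
qed

text \<open>Stationarity yields real equations, while the moment conditions are complex. The
  reflection makes the integral equal to its own conjugate, so the real part carries all the
  information.\<close>

lemma Tint_real:
  assumes f: "continuous_on {0..2*pi} f" and refl: "\<And>\<theta>. \<theta> \<in> {0..2*pi} \<Longrightarrow> f (2 * pi - \<theta>) = cnj (f \<theta>)"
  shows "Tint f = complex_of_real (integral {0..2*pi} (\<lambda>\<theta>. Re (f \<theta>)) / (2*pi))"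
proof -
  have fi: "f integrable_on {0..2*pi}" by (rule integrable_continuous_interval[OF f])
  have "integral {0..2*pi} f = integral {0..2*pi} (\<lambda>\<theta>. f (2 * pi - \<theta>))"
    by (rule integral_reflect_2pi[OF fi, symmetric])
  also have "\<dots> = integral {0..2*pi} (\<lambda>\<theta>. cnj (f \<theta>))" by (rule integral_cong) (rule refl)
  also have "\<dots> = cnj (integral {0..2*pi} f)" by (rule integral_cnj[symmetric])
  finally have "Im (integral {0..2*pi} f) = Im (cnj (integral {0..2*pi} f))" by (rule arg_cong)
  then have "integral {0..2*pi} f = complex_of_real (Re (integral {0..2*pi} f))"
    by (simp add: complex_eq_iff)
  also have "Re (integral {0..2*pi} f) = integral {0..2*pi} (\<lambda>\<theta>. Re (f \<theta>))"
    using integral_linear[OF fi bounded_linear_Re] by (simp add: o_def)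
  finally show ?thesis by (simp add: Tint_def)
qed

lemma matrix_inv_cnj:
  fixes A B :: "complex^'m::finite^'m"
  assumes "invertible A" "\<And>a b. B $ a $ b = cnj (A $ a $ b)"
  shows "matrix_inv B $ a $ b = cnj (matrix_inv A $ a $ b)"
proof -
  have "B ** (\<chi> i j. cnj (matrix_inv A $ i $ j)) = (\<chi> i j. cnj ((A ** matrix_inv A) $ i $ j))"
    by (simp add: vec_eq_iff matrix_matrix_mult_def assms(2))
  also have "\<dots> = mat 1" using matrix_inv_works(1)[OF assms(1)] by (simp add: vec_eq_iff mat_def)
  finally show ?thesis using matrix_inv_unique[of B] by simp
qed

lemma Phi_of_reflect:
  assumes "Q \<in> Bm n E" "\<theta> \<in> {0..2*pi}"
  shows "Phi_of (peval n p (2 * pi - \<theta>)) (qeval n Q (2 * pi - \<theta>)) $ a $ b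
     = cnj (Phi_of (peval n p \<theta>) (qeval n Q \<theta>) $ a $ b)"
  using matrix_inv_cnj[OF posdef_invertible[OF Bm_posdef[OF assms]] qeval_reflect]
  by (simp add: Phi_of_def peval_reflect)

context
  fixes n :: nat and E :: "('m::finite \<times> 'm) set" and R :: "nat \<Rightarrow> real^'m^'m" and c :: "nat \<Rightarrow> real"
    and lam :: real and p :: "nat \<Rightarrow> real" and Q :: "nat \<Rightarrow> real^'m^'m"
  assumes E_sym: "\<And>a b. (a,b) \<in> E \<Longrightarrow> (b,a) \<in> E"
    and R0_sym: "transpose (R 0) = R 0"
    and p: "p \<in> Bo n" and Q: "Q \<in> Bm n E"
    and stat: "\<And>h H. h 0 = 0 \<Longrightarrow> (\<And>k. k > n \<Longrightarrow> h k = 0) \<Longrightarrow> H \<in> Qspace n E \<Longrightarrow> dual_deriv n lam R c p Q h H = 0"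
begin

abbreviation "spec_density \<theta> \<equiv> Phi_of (peval n p \<theta>) (qeval n Q \<theta>)"

lemma spec_density_continuous: "continuous_on {0..2*pi} spec_density"
  by (intro continuous_on_Phi_of[where f="\<lambda>_. p" and g="\<lambda>_. Q" and e="\<lambda>x. x"] continuous_on_const continuous_on_id Bm_posdef[OF Q])

lemma spec_density_posdef: "\<theta> \<in> {0..2*pi} \<Longrightarrow> posdef (spec_density \<theta>)"
  by (rule posdef_Phi_of[OF Bm_posdef[OF Q] Bo_pos[OF p]])

lemma spec_density_hermitian: "\<theta> \<in> {0..2*pi} \<Longrightarrow> spec_density \<theta> $ b $ a = cnj (spec_density \<theta> $ a $ b)"
  using spec_density_posdef[of \<theta>] unfolding posdef_def hermitian_def by blast

lemma covariance_matching:
  assumes ab: "(a,b) \<in> E" and k: "k \<le> n"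
  shows "Tint (\<lambda>\<theta>. cis (\<theta> * real k) * spec_density \<theta> $ a $ b) = complex_of_real (R k $ a $ b)"
proof -
  define f where "f \<theta> = cis (\<theta> * real k) * spec_density \<theta> $ a $ b" for \<theta>
  have fc: "continuous_on {0..2*pi} f"
    unfolding f_def by (intro continuous_on_mult continuous_on_component spec_density_continuous continuous_intros)
  have "f (2 * pi - \<theta>) = cnj (f \<theta>)" if "\<theta> \<in> {0..2*pi}" for \<theta>
    unfolding f_def Phi_of_reflect[OF Q that] cis_reflect by simp
  then have T: "Tint f = complex_of_real (integral {0..2*pi} (\<lambda>\<theta>. Re (f \<theta>)) / (2*pi))"
    by (rule Tint_real[OF fc])
  \<comment> \<open>The direction varies the single entry (a,b) of the coefficient \<open>k\<close>.
    For \<open>k = 0\<close> it is symmetrised, since the constant coefficient must be symmetric;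
    this doubles both sides of the equation, also when \<open>a = b\<close>, and \<open>s\<close>
    records that factor.\<close>
  define U where "U = (\<chi> i j. (if i = a \<and> j = b then 1 else 0) + (if (i = b \<and> j = a) \<and> k = 0 then 1 else (0::real)))"
  define H where "H = (\<lambda>j. if j = k then U else 0)"
  have U0: "U $ i $ j = 0" if "(i,j) \<notin> E" for i j
  proof -
    have n: "(i = a \<and> j = b) = False" "(i = b \<and> j = a) = False" using that ab E_sym[OF ab] by blast+
    show ?thesis unfolding U_def vec_lambda_beta n by simp
  qed
  have "U $ i $ j = U $ j $ i" if "k = 0" for i j
    using that by (simp add: U_def add.commute conj_commute)
  then have "transpose (H 0) = H 0"
    unfolding vec_eq_iff transpose_def H_def by simp
  then have H: "H \<in> Qspace n E"
    using U0 k by (simp add: Qspace_def H_def)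
  define s where "s = (if k = 0 then 2 else 1 :: real)"
  have lin: "lin_part n R c (\<lambda>_. 0) H = s * R k $ a $ b"
  proof -
    have "R 0 $ b $ a = R 0 $ a $ b" using arg_cong[OF R0_sym, of "\<lambda>M. M $ a $ b"] by (simp add: transpose_def)
    moreover have "(\<Sum>i\<in>UNIV. \<Sum>j\<in>UNIV. U $ i $ j * R k $ i $ j) = R k $ a $ b + (if k = 0 then R k $ b $ a else 0)"
    proof -
      have "(\<Sum>i\<in>UNIV. \<Sum>j\<in>UNIV. U $ i $ j * R k $ i $ j) = (\<Sum>i\<in>UNIV. \<Sum>j\<in>UNIV.
         (if i = a then if j = b then R k $ a $ b else 0 else 0) + (if i = b then if j = a then if k = 0 then R k $ b $ a else 0 else 0 else 0))"
        by (intro sum.cong refl) (simp add: U_def)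
      also have "\<dots> = (\<Sum>i\<in>UNIV. (if i = a then R k $ a $ b else 0) + (if i = b then if k = 0 then R k $ b $ a else 0 else 0))"
        by (intro sum.cong refl) (simp add: sum.distrib)
      finally show ?thesis by (simp add: sum.distrib)
    qed
    moreover have "(\<Sum>j=0..n. trace (transpose (H j) ** R j)) = (\<Sum>j=0..n. if j = k then (\<Sum>i\<in>UNIV. \<Sum>j\<in>UNIV. U $ i $ j * R k $ i $ j) else 0)"
      by (intro sum.cong refl) (simp add: H_def trace_transpose_mult)
    ultimately show ?thesis using k by (simp add: lin_part_def s_def)
  qed
  \<comment> \<open>For \<open>k \<ge> 1\<close> the two exponentials, each with weight 1/2, pair
    with conjugate entries of \<open>M\<close> and add up to a real part.\<close>
  have tr: "Re (trace (M ** qeval n H \<theta>)) = s * Re (cis (\<theta> * real k) * M $ a $ b)"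
    if M: "M $ b $ a = cnj (M $ a $ b)" for M :: "complex^'m^'m" and \<theta>
  proof -
    define z where "z = (if k = 0 then 1 else (1/2) * cis (- \<theta> * real k) :: complex)"
    define z' where "z' = (if k = 0 then 1 else (1/2) * cis (\<theta> * real k) :: complex)"
    have qe: "qeval n H \<theta> $ i $ j = (if i = a then if j = b then z else 0 else 0) + (if i = b then if j = a then z' else 0 else 0)" for i j
    proof (cases "k = 0")
      case True
      then have "(\<Sum>l=1..n. complex_of_real (H l $ i $ j) * cis (- \<theta> * real l) + complex_of_real (H l $ j $ i) * cis (\<theta> * real l)) = 0"
        by (intro sum.neutral) (simp add: H_def)
      then show ?thesis using True by (simp add: qeval_nth H_def U_def z_def z'_def)
    next
      case False
      have "(\<Sum>l=1..n. complex_of_real (H l $ i $ j) * cis (- \<theta> * real l) + complex_of_real (H l $ j $ i) * cis (\<theta> * real l))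
        = (\<Sum>l=1..n. if l = k then complex_of_real (U $ i $ j) * cis (- \<theta> * real k) + complex_of_real (U $ j $ i) * cis (\<theta> * real k) else 0)"
        by (intro sum.cong refl) (simp add: H_def)
      also have "\<dots> = complex_of_real (U $ i $ j) * cis (- \<theta> * real k) + complex_of_real (U $ j $ i) * cis (\<theta> * real k)"
        using False k by simp
      finally show ?thesis using False by (simp add: qeval_nth z_def z'_def H_def) (simp add: U_def)
    qed
    have "trace (M ** qeval n H \<theta>) = (\<Sum>j\<in>UNIV. \<Sum>i\<in>UNIV. (if i = a then if j = b then M $ b $ a * z else 0 else 0) + (if i = b then if j = a then M $ a $ b * z' else 0 else 0))"
      unfolding trace_def matrix_matrix_mult_def vec_lambda_beta
      by (intro sum.cong refl) (simp add: qe distrib_left)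
    also have "\<dots> = M $ b $ a * z + M $ a $ b * z'"
    proof -
      have "(\<Sum>i\<in>UNIV. (if i = a then if j = b then M $ b $ a * z else 0 else 0) + (if i = b then if j = a then M $ a $ b * z' else 0 else 0))
        = (if j = b then M $ b $ a * z else 0) + (if j = a then M $ a $ b * z' else 0)" for j
        by (simp add: sum.distrib)
      then show ?thesis by (simp add: sum.distrib)
    qed
    finally show ?thesis by (simp add: M z_def z'_def s_def)
  qed
  have "dual_deriv n lam R c p Q (\<lambda>_. 0) H = 0" by (intro stat H) auto
  moreover have "integral {0..2*pi} (dual_deriv_integrand n lam p Q (\<lambda>_. 0) H) = integral {0..2*pi} (\<lambda>\<theta>. - (s * Re (f \<theta>)))"
    by (intro integral_cong) (simp add: dual_deriv_integrand_def pdir_def tr[OF spec_density_hermitian] f_def)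
  ultimately have "s * integral {0..2*pi} (\<lambda>\<theta>. Re (f \<theta>)) / (2*pi) = s * R k $ a $ b"
    by (simp add: dual_deriv_def lin)
  then have "integral {0..2*pi} (\<lambda>\<theta>. Re (f \<theta>)) / (2*pi) = R k $ a $ b"
    by (simp add: s_def split: if_splits)
  then show ?thesis using T unfolding f_def by simp
qed

text \<open>Stationarity along \<open>cos (k * \<theta>)\<close>, a direction available for
  \<open>k \<ge> 1\<close> only, as the constant coefficient of \<open>p\<close> is fixed. The
  derivative of \<open>lam / p\<close> contributes the error term.\<close>

lemma log_moment_matching:
  assumes k: "1 \<le> k" "k \<le> n"
  shows "Tint (\<lambda>\<theta>. cis (\<theta> * real k) * Ln (det (spec_density \<theta>)))
     = complex_of_real (c k) + complex_of_real lam * Tint (\<lambda>\<theta>. cis (\<theta> * real k) / complex_of_real ((peval n p \<theta>)\<^sup>2))"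
proof -
  define L where "L \<theta> = ln (Re (det (spec_density \<theta>)))" for \<theta>
  have Ln: "Ln (det (spec_density \<theta>)) = complex_of_real (L \<theta>)" if "\<theta> \<in> {0..2*pi}" for \<theta>
  proof -
    have "det (spec_density \<theta>) = complex_of_real (Re (det (spec_density \<theta>)))" "Re (det (spec_density \<theta>)) > 0"
      using posdef_det[OF spec_density_posdef[OF that]] by (auto simp: complex_eq_iff)
    then show ?thesis unfolding L_def by (metis Ln_of_real)
  qed
  have Lc: "continuous_on {0..2*pi} L"
    unfolding L_def using posdef_det[OF spec_density_posdef]
    by (intro continuous_on_ln continuous_on_Re continuous_on_det spec_density_continuous) force
  have pc: "continuous_on {0..2*pi} (peval n p)" by (rule continuous_on_peval_id)
  have pnz: "peval n p \<theta> \<noteq> 0" if "\<theta> \<in> {0..2*pi}" for \<theta> using Bo_pos[OF p that] by simp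
  define f1 where "f1 \<theta> = cis (\<theta> * real k) * complex_of_real (L \<theta>)" for \<theta>
  define f2 where "f2 \<theta> = cis (\<theta> * real k) / complex_of_real ((peval n p \<theta>)\<^sup>2)" for \<theta>
  have f1c: "continuous_on {0..2*pi} f1" unfolding f1_def by (intro continuous_intros Lc)
  have f2c: "continuous_on {0..2*pi} f2" unfolding f2_def by (intro continuous_intros pc) (auto simp: pnz)
  have Lr: "L (2 * pi - \<theta>) = L \<theta>" if "\<theta> \<in> {0..2*pi}" for \<theta>
  proof -
    have "det (spec_density (2 * pi - \<theta>)) = cnj (det (spec_density \<theta>))"
      by (simp add: det_def Phi_of_reflect[OF Q that])
    then show ?thesis by (simp add: L_def)
  qed
  have T1: "Tint f1 = complex_of_real (integral {0..2*pi} (\<lambda>\<theta>. Re (f1 \<theta>)) / (2*pi))"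
    by (rule Tint_real[OF f1c]) (simp add: f1_def cis_reflect Lr)
  have T2: "Tint f2 = complex_of_real (integral {0..2*pi} (\<lambda>\<theta>. Re (f2 \<theta>)) / (2*pi))"
    by (rule Tint_real[OF f2c]) (simp add: f2_def cis_reflect peval_reflect)
  define h where "h j = (if j = k then 1 else 0 :: real)" for j :: nat
  have "dual_deriv n lam R c p Q h (\<lambda>_. 0) = 0"
    using k by (intro stat) (auto simp: h_def Qspace_def transpose_def vec_eq_iff)
  moreover have "lin_part n R c h (\<lambda>_. 0) = - c k"
  proof -
    have "(\<Sum>j=0..n. h j * c j) = (\<Sum>j=0..n. if j = k then c k else 0)" by (intro sum.cong refl) (simp add: h_def)
    then show ?thesis using k by (simp add: lin_part_def trace_transpose_mult)
  qed
  moreover have "integral {0..2*pi} (dual_deriv_integrand n lam p Q h (\<lambda>_. 0)) = integral {0..2*pi} (\<lambda>\<theta>. Re (f1 \<theta>) - lam * Re (f2 \<theta>))"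
  proof (rule integral_cong)
    fix \<theta>
    have "pdir n h \<theta> = (\<Sum>j=1..n. if j = k then cos (real k * \<theta>) else 0)"
      unfolding pdir_def by (intro sum.cong refl) (simp add: h_def)
    then have "pdir n h \<theta> = cos (real k * \<theta>)" using k by simp
    moreover have "qeval n (\<lambda>_. 0 :: real^'m^'m) \<theta> = 0" by (simp add: vec_eq_iff qeval_nth)
    moreover have "trace (M ** 0) = 0" for M :: "complex^'m^'m" by (simp add: trace_def matrix_matrix_mult_def)
    ultimately show "dual_deriv_integrand n lam p Q h (\<lambda>_. 0) \<theta> = Re (f1 \<theta>) - lam * Re (f2 \<theta>)"
      by (simp add: dual_deriv_integrand_def f1_def f2_def L_def Re_divide_of_real mult.commute right_diff_distrib flip: of_real_power)
  qed
  moreover have "integral {0..2*pi} (\<lambda>\<theta>. Re (f1 \<theta>) - lam * Re (f2 \<theta>)) = integral {0..2*pi} (\<lambda>\<theta>. Re (f1 \<theta>)) - lam * integral {0..2*pi} (\<lambda>\<theta>. Re (f2 \<theta>))"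
    by (subst integral_diff) (auto intro!: integrable_continuous_interval continuous_on_Re continuous_on_mult continuous_on_const f1c f2c)
  ultimately have "integral {0..2*pi} (\<lambda>\<theta>. Re (f1 \<theta>)) / (2*pi) = c k + lam * (integral {0..2*pi} (\<lambda>\<theta>. Re (f2 \<theta>)) / (2*pi))"
    by (simp add: dual_deriv_def diff_divide_distrib)
  then have "Tint f1 = complex_of_real (c k) + complex_of_real lam * Tint f2"
    unfolding T1 T2 by (simp only: of_real_add of_real_mult)
  moreover have "Tint (\<lambda>\<theta>. cis (\<theta> * real k) * Ln (det (spec_density \<theta>))) = Tint f1"
    unfolding Tint_def by (intro arg_cong2[of _ _ _ _ "(/)"] integral_cong) (simp_all add: Ln f1_def)
  ultimately show ?thesis by (simp only: f2_def[abs_def])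
qed

text \<open>Both constants are extreme values of the form over the compact product of the interval
  and the unit sphere; homogeneity covers all vectors.\<close>

lemma spec_density_bounded_coercive: "bounded_coercive spec_density"
proof -
  define S where "S = {0..2*pi} \<times> sphere (0 :: complex^'m) 1"
  define f where "f = (\<lambda>x. Re (qform (spec_density (fst x)) (snd x)))"
  have S: "compact S" unfolding S_def by (intro compact_Times compact_Icc compact_sphere)
  \<comment> \<open>Any index serves as a witness that the sphere is nonempty.\<close>
  have "(0, axis undefined 1) \<in> S" by (simp add: S_def)
  then have ne: "S \<noteq> {}" by blast
  have P: "continuous_on S (\<lambda>x. spec_density (fst x))"
    by (rule continuous_on_compose2[OF spec_density_continuous]) (auto simp: S_def intro: continuous_on_fst continuous_on_id)
  have fc: "continuous_on S f"
    unfolding f_def qform_def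
    by (intro continuous_on_Re continuous_on_sum continuous_on_mult continuous_on_cnj continuous_on_component P continuous_on_snd continuous_on_id)
  obtain x where x: "x \<in> S" "\<And>y. y \<in> S \<Longrightarrow> f x \<le> f y" using continuous_attains_inf[OF S ne fc] by blast
  obtain z where z: "z \<in> S" "\<And>y. y \<in> S \<Longrightarrow> f y \<le> f z" using continuous_attains_sup[OF S ne fc] by blast
  have "f x > 0"
  proof -
    have "fst x \<in> {0..2*pi}" "norm (snd x) = 1" using x(1) by (auto simp: S_def mem_Times_iff)
    moreover from this have "snd x \<noteq> 0" by auto
    ultimately show ?thesis using spec_density_posdef unfolding f_def posdef_def by blast
  qed
  moreover have "f x * (norm v)\<^sup>2 \<le> Re (qform (spec_density \<theta>) v) \<and> Re (qform (spec_density \<theta>) v) \<le> f z * (norm v)\<^sup>2" if t: "\<theta> \<in> {0..2*pi}" for \<theta> v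
  proof (cases "v = 0")
    case True
    then show ?thesis by (simp add: qform_inner)
  next
    case False
    define w where "w = (1 / norm v) *\<^sub>R v"
    have w: "norm w = 1" "v = norm v *\<^sub>R w" using False by (auto simp: w_def)
    have "Re (qform (spec_density \<theta>) (norm v *\<^sub>R w)) = (norm v)\<^sup>2 * Re (qform (spec_density \<theta>) w)"
      by (simp add: qform_inner mult_vec_scaleR power2_eq_square mult.assoc)
    then have q: "Re (qform (spec_density \<theta>) v) = f (\<theta>, w) * (norm v)\<^sup>2" using w(2) by (simp add: f_def mult.commute)
    have "(\<theta>, w) \<in> S" using t w by (simp add: S_def)
    then show ?thesis unfolding q using x(2) z(2) by (intro conjI mult_right_mono) auto
  qed
  moreover have "hermitian (spec_density \<theta>)" if "\<theta> \<in> {0..2*pi}" for \<theta> using spec_density_posdef[OF that] by (simp add: posdef_def)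
  moreover have "Tset \<subseteq> {0..2*pi}" by (auto simp: Tset_def)
  ultimately show ?thesis unfolding bounded_coercive_def by (meson subsetD)
qed

end

section \<open>Boundary points and uniqueness\<close>

lemma Bo_bar_subset: "Bo_bar n \<subseteq> Bo_cpt n 0"
  unfolding Bo_bar_def
proof (rule closure_minimal)
  show "Bo n \<subseteq> Bo_cpt n 0"
  proof
    fix p assume p: "p \<in> Bo n"
    then have "p 0 = 1" "\<forall>k>n. p k = 0" by (auto simp: Bo_def)
    then show "p \<in> Bo_cpt n 0" using Bo_coeff_bound[OF p] Bo_pos[OF p] by (auto simp: Bo_cpt_def less_imp_le)
  qed
  show "closed (Bo_cpt n 0)" by (rule compact_imp_closed[OF compact_Bo_cpt])
qed

text \<open>The linear constraints and semidefiniteness at every angle are closed conditions in the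
  product topology, so they survive in the closure.\<close>

lemma Bm_bar_subset:
  assumes "Q \<in> Bm_bar n E"
  shows "Q \<in> Qspace n E" "\<theta> \<in> {0..2*pi} \<Longrightarrow> possemidef (qeval n Q \<theta>)"
proof -
  define S where "S = Qspace n E \<inter> {Q. \<forall>\<theta> v. \<theta> \<in> {0..2*pi} \<longrightarrow> 0 \<le> Re (qform (qeval n Q \<theta>) v)}"
  have "closed S" unfolding S_def
    by (intro closed_Int closed_Qspace closed_Collect_all closed_Collect_imp closed_Collect_le
       continuous_on_const open_Collect_const continuous_on_qform continuous_on_qeval continuous_on_id)
  moreover have "Bm n E \<subseteq> S"
  proof
    fix Q assume Q: "Q \<in> Bm n E"
    have "0 \<le> Re (qform (qeval n Q \<theta>) v)" if "\<theta> \<in> {0..2*pi}" for \<theta> v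
      using posdef_imp_possemidef[OF Bm_posdef[OF Q that]] by (simp add: possemidef_def)
    then show "Q \<in> S" using Q by (simp add: S_def Bm_iff)
  qed
  ultimately have "closure (Bm n E) \<subseteq> S" by (intro closure_minimal)
  then have "Q \<in> S" using assms by (auto simp: Bm_bar_def)
  then show "Q \<in> Qspace n E" "\<theta> \<in> {0..2*pi} \<Longrightarrow> possemidef (qeval n Q \<theta>)"
    by (auto simp: S_def possemidef_qeval_iff)
qed

section \<open>The extended-real objective\<close>

lemma dual_integrand_split: "dual_integrand lam p A = dual_integrand 0 p A + lam * (1 / p)"
  by (simp add: dual_integrand_def)

text \<open>Where the determinant is nonzero, semidefiniteness improves to definiteness, so the
  logarithm can be expanded there.\<close>

lemma J_integrand_eq:
  fixes B :: "nat \<Rightarrow> real^'m::finite^'m"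
  assumes "peval n q \<theta> \<ge> 0" "possemidef (qeval n B \<theta>)"
  shows "J_integrand n q B \<theta> = (if peval n q \<theta> = 0 then 0 else if det (qeval n B \<theta>) = 0 then \<infinity>
     else ereal (dual_integrand 0 (peval n q \<theta>) (qeval n B \<theta>)))"
proof (cases "peval n q \<theta> = 0 \<or> det (qeval n B \<theta>) = 0")
  case False
  then have p: "peval n q \<theta> > 0" and d: "posdef (qeval n B \<theta>)"
    using assms by (auto intro: possemidef_det_nz)
  show ?thesis
    using False unfolding J_integrand_def Phi_of_def[symmetric] ln_det_Phi_of[OF d p]
    by (simp add: dual_integrand_def algebra_simps)
qed (auto simp: J_integrand_def)

lemma e2ennreal_max_ereal: "e2ennreal (max (ereal x) 0) = ennreal x"
  by (cases "x \<ge> 0") (auto simp: max_def ennreal_neg zero_ereal_def[symmetric] e2ennreal_ereal)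

lemma enn2ereal_scaled:
  assumes "a \<noteq> \<infinity>"
  shows "enn2ereal (ennreal (1 / (2*pi)) * a) = ereal (enn2real a / (2*pi))"
proof -
  obtain r where r: "a = ennreal r" "r \<ge> 0" using assms by (cases a) auto
  then have "ennreal (1 / (2*pi)) * a = ennreal (r / (2*pi))" by (simp flip: ennreal_mult')
  then show ?thesis using r by (simp add: enn2ereal_ennreal)
qed

lemma measurable_peval [measurable]: "peval n q \<in> borel_measurable borel"
  by (rule borel_measurable_continuous_onI[OF continuous_on_peval_id])

lemma measurable_det_qeval [measurable]:
  fixes B :: "nat \<Rightarrow> real^'m::finite^'m"
  shows "(\<lambda>\<theta>. det (qeval n B \<theta>)) \<in> borel_measurable borel"
  by (intro borel_measurable_continuous_onI continuous_on_det continuous_on_qeval continuous_on_const continuous_on_id)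

lemma measurable_gfun [measurable]:
  fixes B :: "nat \<Rightarrow> real^'m::finite^'m"
  shows "(\<lambda>\<theta>. dual_integrand lam (peval n q \<theta>) (qeval n B \<theta>)) \<in> borel_measurable borel"
  unfolding dual_integrand_def by measurable

text \<open>Kept apart from the regulariser because J and \<open>g_lambda\<close> are integrated
  separately as extended reals.\<close>

definition log_part :: "nat \<Rightarrow> (nat \<Rightarrow> real) \<Rightarrow> (nat \<Rightarrow> real^'m::finite^'m) \<Rightarrow> real \<Rightarrow> real" where
  "log_part n q B \<theta> = indicator {0..2*pi} \<theta> *\<^sub>R dual_integrand 0 (peval n q \<theta>) (qeval n B \<theta>)"

definition inv_part :: "nat \<Rightarrow> (nat \<Rightarrow> real) \<Rightarrow> real \<Rightarrow> real" where
  "inv_part n q \<theta> = indicator {0..2*pi} \<theta> *\<^sub>R (1 / peval n q \<theta>)"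

text \<open>Describes the competitors of finite value: such pairs have a real value by
  \<open>Jtilde_finite\<close>, and all others have value infinity by
  \<open>Jtilde_not_top_imp_regular\<close>.\<close>

definition regular :: "nat \<Rightarrow> (nat \<Rightarrow> real) \<Rightarrow> (nat \<Rightarrow> real^'m::finite^'m) \<Rightarrow> bool" where
  "regular n q B \<longleftrightarrow> (AE \<theta> in lborel. \<theta> \<in> {0..2*pi} \<longrightarrow> peval n q \<theta> > 0 \<and> posdef (qeval n B \<theta>))
     \<and> integrable lborel (log_part n q B) \<and> integrable lborel (inv_part n q)"

lemma measurable_log_part [measurable]: "log_part n q B \<in> borel_measurable borel"
  unfolding log_part_def[abs_def] by measurable

lemma measurable_inv_part [measurable]: "inv_part n q \<in> borel_measurable borel"
  unfolding inv_part_def[abs_def] by measurable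

context
  fixes n :: nat and R :: "nat \<Rightarrow> real^'m::finite^'m" and c :: "nat \<Rightarrow> real"
    and lam :: real and q :: "nat \<Rightarrow> real" and B :: "nat \<Rightarrow> real^'m^'m"
  assumes lam: "lam > 0"
    and q: "q \<in> Bo_cpt n 0"
    and psd: "\<And>\<theta>. \<theta> \<in> {0..2*pi} \<Longrightarrow> possemidef (qeval n B \<theta>)"
begin

lemma q_nonneg: "\<theta> \<in> {0..2*pi} \<Longrightarrow> peval n q \<theta> \<ge> 0"
  using q by (auto simp: Bo_cpt_def)

lemma Jtilde_finite:
  assumes "regular n q B"
  shows "Jtilde n lam R c q B
    = ereal ((integral\<^sup>L lborel (log_part n q B) + lam * integral\<^sup>L lborel (inv_part n q)) / (2*pi) + lin_part n R c q B)"
proof -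
  have ae: "AE \<theta> in lborel. \<theta> \<in> {0..2*pi} \<longrightarrow> peval n q \<theta> > 0 \<and> posdef (qeval n B \<theta>)"
    and vi: "integrable lborel (log_part n q B)" and ri: "integrable lborel (inv_part n q)"
    using assms by (auto simp: regular_def)
  have J: "J_integrand n q B \<theta> = ereal (dual_integrand 0 (peval n q \<theta>) (qeval n B \<theta>))"
    if "\<theta> \<in> {0..2*pi}" "peval n q \<theta> > 0 \<and> posdef (qeval n B \<theta>)" for \<theta>
    using that J_integrand_eq[OF q_nonneg psd, OF that(1,1)] posdef_det[of "qeval n B \<theta>"] by auto
  have P: "(\<integral>\<^sup>+\<theta>\<in>{0..2*pi}. e2ennreal (max (J_integrand n q B \<theta>) 0) \<partial>lborel) = (\<integral>\<^sup>+\<theta>. ennreal (log_part n q B \<theta>) \<partial>lborel)"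
    using ae by (intro nn_integral_cong_AE, eventually_elim) (auto simp: log_part_def J e2ennreal_max_ereal indicator_def)
  have N: "(\<integral>\<^sup>+\<theta>\<in>{0..2*pi}. e2ennreal (max (- J_integrand n q B \<theta>) 0) \<partial>lborel) = (\<integral>\<^sup>+\<theta>. ennreal (- log_part n q B \<theta>) \<partial>lborel)"
    using ae by (intro nn_integral_cong_AE, eventually_elim) (auto simp: log_part_def J e2ennreal_max_ereal indicator_def)
  have fin: "(\<integral>\<^sup>+\<theta>. ennreal (log_part n q B \<theta>) \<partial>lborel) \<noteq> \<infinity>" "(\<integral>\<^sup>+\<theta>. ennreal (- log_part n q B \<theta>) \<partial>lborel) \<noteq> \<infinity>"
    using vi by (auto simp: real_integrable_def)
  have T: "Tint_ereal (J_integrand n q B) = ereal (integral\<^sup>L lborel (log_part n q B) / (2*pi))"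
    unfolding Tint_ereal_def Tnn_int_def P N enn2ereal_scaled[OF fin(1)] enn2ereal_scaled[OF fin(2)]
    using real_lebesgue_integral_def[OF vi] by (simp add: diff_divide_distrib)
  have r0: "inv_part n q \<theta> \<ge> 0" for \<theta> using q_nonneg by (auto simp: inv_part_def indicator_def)
  have "(\<integral>\<^sup>+\<theta>\<in>{0..2*pi}. (if peval n q \<theta> = 0 then \<infinity> else ennreal (1 / peval n q \<theta>)) \<partial>lborel) = (\<integral>\<^sup>+\<theta>. ennreal (inv_part n q \<theta>) \<partial>lborel)"
    using ae by (intro nn_integral_cong_AE, eventually_elim) (auto simp: inv_part_def indicator_def)
  also have "\<dots> = ennreal (integral\<^sup>L lborel (inv_part n q))" using r0 by (intro nn_integral_eq_integral ri) auto
  finally have "g_lambda n lam q = ereal (lam * integral\<^sup>L lborel (inv_part n q) / (2*pi))"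
    unfolding g_lambda_def Tnn_int_def using r0 by (simp add: enn2ereal_scaled integral_nonneg_AE)
  then show ?thesis
    by (simp add: Jtilde_def Jfun_def T lin_part_def add_divide_distrib)
qed

lemma Jtilde_not_top_imp_regular:
  assumes "Jtilde n lam R c q B \<noteq> \<infinity>"
  shows "regular n q B"
proof -
  define rf where "rf \<theta> = (if peval n q \<theta> = 0 then \<infinity> else ennreal (1 / peval n q \<theta>)) * indicator {0..2*pi} \<theta>" for \<theta>
  define pf where "pf \<theta> = (if peval n q \<theta> = 0 then 0 else if det (qeval n B \<theta>) = 0 then \<infinity>
     else ennreal (dual_integrand 0 (peval n q \<theta>) (qeval n B \<theta>))) * indicator {0..2*pi} \<theta>" for \<theta>
  have [measurable]: "rf \<in> borel_measurable borel" unfolding rf_def by measurable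
  have [measurable]: "pf \<in> borel_measurable borel" unfolding pf_def by measurable
  have c1: "ennreal (1 / (2*pi)) \<noteq> 0" by simp
  have rfin: "(\<integral>\<^sup>+\<theta>. rf \<theta> \<partial>lborel) \<noteq> \<infinity>"
  proof
    assume "(\<integral>\<^sup>+\<theta>. rf \<theta> \<partial>lborel) = \<infinity>"
    then have "g_lambda n lam q = \<infinity>"
      using lam c1 unfolding g_lambda_def Tnn_int_def rf_def by (simp add: ennreal_mult_top)
    then show False using assms by (simp add: Jtilde_def)
  qed
  have pe: "(\<integral>\<^sup>+\<theta>\<in>{0..2*pi}. e2ennreal (max (J_integrand n q B \<theta>) 0) \<partial>lborel) = (\<integral>\<^sup>+\<theta>. pf \<theta> \<partial>lborel)"
    by (intro nn_integral_cong)
      (auto simp: pf_def J_integrand_eq[OF q_nonneg psd] e2ennreal_max_ereal indicator_def)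
  have pfin: "(\<integral>\<^sup>+\<theta>. pf \<theta> \<partial>lborel) \<noteq> \<infinity>"
  proof
    assume "(\<integral>\<^sup>+\<theta>. pf \<theta> \<partial>lborel) = \<infinity>"
    \<comment> \<open>In \<open>ereal\<close> a positive infinity absorbs every summand, so the
      negative part of the integrand needs no estimate here.\<close>
    then have "Tint_ereal (J_integrand n q B) = \<infinity>"
      using c1 unfolding Tint_ereal_def Tnn_int_def pe by (simp add: ennreal_mult_top minus_ereal_def)
    then have "Jtilde n lam R c q B = \<infinity>" by (simp add: Jtilde_def Jfun_def)
    then show False using assms by simp
  qed
  have "AE \<theta> in lborel. rf \<theta> \<noteq> \<infinity>" by (rule nn_integral_PInf_AE[OF _ rfin]) measurable
  moreover have "AE \<theta> in lborel. pf \<theta> \<noteq> \<infinity>" by (rule nn_integral_PInf_AE[OF _ pfin]) measurable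
  ultimately have ae: "AE \<theta> in lborel. \<theta> \<in> {0..2*pi} \<longrightarrow> peval n q \<theta> > 0 \<and> posdef (qeval n B \<theta>)"
  proof eventually_elim
    case (elim \<theta>)
    show ?case
    proof
      assume t: "\<theta> \<in> {0..2*pi}"
      then have 1: "peval n q \<theta> \<noteq> 0" using elim(1) by (auto simp: rf_def)
      then have "det (qeval n B \<theta>) \<noteq> 0" using elim(2) t by (auto simp: pf_def)
      then show "peval n q \<theta> > 0 \<and> posdef (qeval n B \<theta>)"
        using 1 q_nonneg[OF t] possemidef_det_nz[OF psd[OF t]] by auto
    qed
  qed
  have "(\<integral>\<^sup>+\<theta>. ennreal (norm (inv_part n q \<theta>)) \<partial>lborel) \<le> (\<integral>\<^sup>+\<theta>. rf \<theta> \<partial>lborel)"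
    using q_nonneg by (intro nn_integral_mono) (auto simp: rf_def inv_part_def indicator_def)
  then have ri: "integrable lborel (inv_part n q)"
    using rfin by (intro integrableI_bounded) (auto simp: top.not_eq_extremum intro: le_less_trans)
  define b where "b = 1 + 2 * real n"
  define N where "N = real CARD('m) * coef_norm n B"
  \<comment> \<open>The constant of \<open>dual_integrand_lower\<close> at \<open>s = 1\<close> and
    \<open>lam = 0\<close>: the integrand is bounded below on a bounded interval, so its negative
    part is integrable.\<close>
  define C where "C = real CARD('m) + b * (1 * N + \<bar>real CARD('m) + real CARD('m) * ln 1\<bar>)"
  have N: "N \<ge> 0" by (simp add: N_def coef_norm_nonneg)
  have C: "C \<ge> 0" using N by (simp add: C_def b_def)
  have "(\<integral>\<^sup>+\<theta>. ennreal (log_part n q B \<theta>) \<partial>lborel) = (\<integral>\<^sup>+\<theta>. pf \<theta> \<partial>lborel)"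
    using ae
  proof (intro nn_integral_cong_AE, eventually_elim)
    case (elim \<theta>)
    then show ?case using posdef_det[of "qeval n B \<theta>"] by (auto simp: log_part_def pf_def indicator_def)
  qed
  then have v1: "(\<integral>\<^sup>+\<theta>. ennreal (log_part n q B \<theta>) \<partial>lborel) \<noteq> \<infinity>" using pfin by simp
  have "(\<integral>\<^sup>+\<theta>. ennreal (- log_part n q B \<theta>) \<partial>lborel) \<le> (\<integral>\<^sup>+\<theta>. ennreal C * indicator {0..2*pi} \<theta> \<partial>lborel)"
    using ae
  proof (intro nn_integral_mono_AE, eventually_elim)
    case (elim \<theta>)
    show ?case
    proof (cases "\<theta> \<in> {0..2*pi}")
      case True
      have "\<bar>q k\<bar> \<le> 2" for k using q by (simp add: Bo_cpt_def)
      then have "peval n q \<theta> \<le> b" using peval_le[of n q \<theta>] by (simp add: b_def)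
      then have "- C \<le> dual_integrand 0 (peval n q \<theta>) (qeval n B \<theta>)"
        using dual_integrand_lower[of "peval n q \<theta>" b "qeval n B \<theta>" N 1 0] elim True N Re_trace_qeval_le[of n B \<theta>]
        by (simp add: C_def N_def)
      then show ?thesis using True by (simp add: log_part_def ennreal_leI)
    qed (simp add: log_part_def)
  qed
  also have "\<dots> < \<infinity>" using C by (simp add: nn_integral_cmult_indicator ennreal_mult_less_top)
  finally have v2: "(\<integral>\<^sup>+\<theta>. ennreal (- log_part n q B \<theta>) \<partial>lborel) \<noteq> \<infinity>" by simp
  have "integrable lborel (log_part n q B)" using v1 v2 by (simp add: real_integrable_def)
  then show "regular n q B" using ae ri by (simp add: regular_def)
qed

end

lemma continuous_indicator_integral:
  fixes f :: "real \<Rightarrow> real"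
  assumes "continuous_on {a..b} f"
  shows "integrable lborel (\<lambda>x. indicator {a..b} x *\<^sub>R f x)"
    and "integral\<^sup>L lborel (\<lambda>x. indicator {a..b} x *\<^sub>R f x) = integral {a..b} f"
proof -
  have "set_integrable lborel {a..b} f" by (rule borel_integrable_atLeastAtMost'[OF assms])
  then show "integrable lborel (\<lambda>x. indicator {a..b} x *\<^sub>R f x)"
    and "integral\<^sup>L lborel (\<lambda>x. indicator {a..b} x *\<^sub>R f x) = integral {a..b} f"
    using set_borel_integral_eq_integral(2)[of "{a..b}" f] by (simp_all add: set_integrable_def set_lebesgue_integral_def)
qed

lemma dual_integrand_continuous:
  assumes "p \<in> Bo n" "Q \<in> Bm n E"
  shows "continuous_on {0..2*pi} (\<lambda>\<theta>. dual_integrand lam (peval n p \<theta>) (qeval n Q \<theta>))"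
  by (intro continuous_on_gfun continuous_on_const continuous_on_id Bo_pos[OF assms(1)] Bm_posdef[OF assms(2)])

lemma Bm_subset_bar:
  fixes Q :: "nat \<Rightarrow> real^'m::finite^'m"
  assumes "Q \<in> Bm n E" shows "Q \<in> Bm_bar n E"
proof -
  have "det (qeval n Q 0) \<noteq> 0" using posdef_det[OF Bm_posdef[OF assms, of 0]] by auto
  then show ?thesis using assms closure_subset[of "Bm n E"] by (auto simp: Bm_bar_def Tset_def intro!: bexI[of _ 0])
qed

lemma Bo_subset_bar: "Bo n \<subseteq> Bo_bar n"
  by (simp add: Bo_bar_def closure_subset)

lemma Jtilde_interior:
  fixes Q :: "nat \<Rightarrow> real^'m::finite^'m"
  assumes lam: "lam > 0" and p: "p \<in> Bo n" and Q: "Q \<in> Bm n E"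
  shows "Jtilde n lam R c p Q = ereal (dual_fun n lam R c p Q)"
proof -
  have pP: "p \<in> Bo_cpt n 0" using p Bo_subset_bar Bo_bar_subset by blast
  have psd: "possemidef (qeval n Q \<theta>)" if "\<theta> \<in> {0..2*pi}" for \<theta>
    by (rule posdef_imp_possemidef[OF Bm_posdef[OF Q that]])
  have vc: "continuous_on {0..2*pi} (\<lambda>\<theta>. dual_integrand 0 (peval n p \<theta>) (qeval n Q \<theta>))" by (rule dual_integrand_continuous[OF p Q])
  have rc: "continuous_on {0..2*pi} (\<lambda>\<theta>. 1 / peval n p \<theta>)"
    using Bo_pos[OF p] by (intro continuous_on_divide continuous_on_const continuous_on_peval_id) force
  have g: "regular n p Q"
    using continuous_indicator_integral(1)[OF vc] continuous_indicator_integral(1)[OF rc] Bo_pos[OF p] Bm_posdef[OF Q]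
    unfolding regular_def log_part_def[abs_def] inv_part_def[abs_def] by auto
  have "integral {0..2*pi} (\<lambda>\<theta>. dual_integrand lam (peval n p \<theta>) (qeval n Q \<theta>)) = integral\<^sup>L lborel (log_part n p Q) + lam * integral\<^sup>L lborel (inv_part n p)"
    unfolding log_part_def[abs_def] inv_part_def[abs_def] continuous_indicator_integral(2)[OF vc] continuous_indicator_integral(2)[OF rc]
    unfolding dual_integrand_split[of lam]
    using integral_add[OF integrable_continuous_interval[OF vc] integrable_on_mult_right[OF integrable_continuous_interval[OF rc], of lam]]
    by (simp only: integral_mult_right)
  moreover have "Jtilde n lam R c p Q
    = ereal ((integral\<^sup>L lborel (log_part n p Q) + lam * integral\<^sup>L lborel (inv_part n p)) / (2*pi) + lin_part n R c p Q)"
    by (rule Jtilde_finite[OF lam pP _ g]) (rule psd)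
  ultimately show ?thesis by (simp add: dual_fun_def)
qed

text \<open>The pointwise inequality \<open>dual_integrand_convex\<close> at a stationary point, integrated: the linear terms
  cancel. It needs only that the competitor is regular almost everywhere.\<close>

lemma stationary_unique_min:
  fixes Q B :: "nat \<Rightarrow> real^'m::finite^'m"
  assumes lam: "lam > 0" and p: "p \<in> Bo n" and Q: "Q \<in> Bm n E"
    and stat: "\<And>h H. h 0 = 0 \<Longrightarrow> (\<And>k. k > n \<Longrightarrow> h k = 0) \<Longrightarrow> H \<in> Qspace n E \<Longrightarrow> dual_deriv n lam R c p Q h H = 0"
    and q: "q \<in> Bo_bar n" and B: "B \<in> Bm_bar n E"
  shows "Jtilde n lam R c p Q \<le> Jtilde n lam R c q B"
    and "Jtilde n lam R c q B \<le> Jtilde n lam R c p Q \<Longrightarrow> q = p \<and> B = Q"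
proof -
  have qP: "q \<in> Bo_cpt n 0" using q Bo_bar_subset by blast
  have psd: "possemidef (qeval n B \<theta>)" if "\<theta> \<in> {0..2*pi}" for \<theta> by (rule Bm_bar_subset(2)[OF B that])
  have BS: "B \<in> Qspace n E" by (rule Bm_bar_subset(1)[OF B])
  have QS: "Q \<in> Qspace n E" using Q by (simp add: Bm_iff)
  have Jp: "Jtilde n lam R c p Q = ereal (dual_fun n lam R c p Q)" by (rule Jtilde_interior[OF lam p Q])
  define h where "h = (\<lambda>k. q k - p k)"
  define H where "H = (\<lambda>k. B k - Q k)"
  have q_eq: "q = (\<lambda>k. p k + 1 * h k)" and B_eq: "B = (\<lambda>k. Q k + 1 *\<^sub>R H k)"
    by (simp_all add: h_def H_def)
  have qd: "peval n q \<theta> - peval n p \<theta> = pdir n h \<theta>" for \<theta>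
    using peval_add[of n p 1 h \<theta>] unfolding q_eq[symmetric] by simp
  have Bd: "qeval n B \<theta> - qeval n Q \<theta> = qeval n H \<theta>" for \<theta>
    using qeval_add[of n Q 1 H \<theta>] unfolding B_eq[symmetric] by simp
  have DF0: "dual_deriv n lam R c p Q h H = 0"
  proof (rule stat)
    show "h 0 = 0" "\<And>k. k > n \<Longrightarrow> h k = 0" using qP p by (auto simp: h_def Bo_cpt_def Bo_def)
    show "H \<in> Qspace n E" using Qspace_add[OF BS QS, of "-1"] by (simp add: H_def)
  qed
  define T where "T \<theta> = dual_integrand lam (peval n p \<theta>) (qeval n Q \<theta>) + dual_deriv_integrand n lam p Q h H \<theta>" for \<theta>
  have Tc: "continuous_on {0..2*pi} T"
    unfolding T_def by (intro continuous_on_add dual_integrand_continuous[OF p Q] dual_deriv_integrand_continuous[OF p Q])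
  have "integral {0..2*pi} T = integral {0..2*pi} (\<lambda>\<theta>. dual_integrand lam (peval n p \<theta>) (qeval n Q \<theta>)) + integral {0..2*pi} (dual_deriv_integrand n lam p Q h H)"
    unfolding T_def by (intro integral_add dual_integrand_integrable[OF p Q] integrable_continuous_interval dual_deriv_integrand_continuous[OF p Q])
  moreover have "lin_part n R c q B = lin_part n R c p Q + lin_part n R c h H"
    using lin_part_add[of n R c p 1 h Q H] unfolding q_eq[symmetric] B_eq[symmetric] by simp
  \<comment> \<open>By stationarity the tangent, integrated and completed by the linear part at the
    competitor, returns the value at the stationary point.\<close>
  ultimately have TF: "integral {0..2*pi} T / (2*pi) + lin_part n R c q B = dual_fun n lam R c p Q"
    using DF0 by (simp add: dual_fun_def dual_deriv_def add_divide_distrib)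
  have cv: "T \<theta> \<le> dual_integrand lam (peval n q \<theta>) (qeval n B \<theta>)"
      "T \<theta> = dual_integrand lam (peval n q \<theta>) (qeval n B \<theta>) \<Longrightarrow> peval n q \<theta> = peval n p \<theta> \<and> qeval n B \<theta> = qeval n Q \<theta>"
    if "\<theta> \<in> {0..2*pi}" "peval n q \<theta> > 0" "posdef (qeval n B \<theta>)" for \<theta>
    using dual_integrand_convex[OF Bm_posdef[OF Q that(1)] that(3) Bo_pos[OF p that(1)] that(2) lam]
    unfolding T_def dual_deriv_integrand_def qd Bd by auto
  \<comment> \<open>The pointwise gap above the tangent; its integral over \<open>2 * pi\<close> is
    exactly the excess of the competitor's value.\<close>
  define G where "G \<theta> = log_part n q B \<theta> + lam * inv_part n q \<theta> - indicator {0..2*pi} \<theta> *\<^sub>R T \<theta>" for \<theta>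
  have G: "G \<theta> = indicator {0..2*pi} \<theta> *\<^sub>R (dual_integrand lam (peval n q \<theta>) (qeval n B \<theta>) - T \<theta>)" for \<theta>
    by (simp add: G_def log_part_def inv_part_def dual_integrand_split[of lam] indicator_def)
  have main: "integrable lborel G \<and> (AE \<theta> in lborel. G \<theta> \<ge> 0) \<and>
      Jtilde n lam R c q B = ereal (dual_fun n lam R c p Q + integral\<^sup>L lborel G / (2*pi))" if reg: "regular n q B"
  proof -
    have li: "integrable lborel (log_part n q B)" "integrable lborel (inv_part n q)"
      and ae: "AE \<theta> in lborel. \<theta> \<in> {0..2*pi} \<longrightarrow> peval n q \<theta> > 0 \<and> posdef (qeval n B \<theta>)"
      using reg by (auto simp: regular_def)
    note Ti = continuous_indicator_integral[OF Tc]
    have Gi: "integrable lborel G"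
      unfolding G_def by (intro Bochner_Integration.integrable_diff Bochner_Integration.integrable_add integrable_mult_right li Ti(1))
    have "integral\<^sup>L lborel G = integral\<^sup>L lborel (log_part n q B) + lam * integral\<^sup>L lborel (inv_part n q) - integral {0..2*pi} T"
      unfolding G_def using li Ti by simp
    moreover have "Jtilde n lam R c q B
       = ereal ((integral\<^sup>L lborel (log_part n q B) + lam * integral\<^sup>L lborel (inv_part n q)) / (2*pi) + lin_part n R c q B)"
      by (rule Jtilde_finite[OF lam qP _ reg]) (rule psd)
    ultimately have "Jtilde n lam R c q B = ereal (dual_fun n lam R c p Q + integral\<^sup>L lborel G / (2*pi))"
      using TF by (simp add: field_simps)
    moreover have "AE \<theta> in lborel. G \<theta> \<ge> 0"
      using ae by eventually_elim (auto simp: G indicator_def cv(1))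
    ultimately show ?thesis using Gi by blast
  qed
  have reg: "regular n q B" if "Jtilde n lam R c q B \<noteq> \<infinity>"
    by (rule Jtilde_not_top_imp_regular[OF lam qP _ that]) (rule psd)
  show "Jtilde n lam R c p Q \<le> Jtilde n lam R c q B"
  proof (cases "Jtilde n lam R c q B = \<infinity>")
    case False
    then show ?thesis using main[OF reg] by (auto simp: Jp integral_nonneg_AE)
  qed simp
  assume le: "Jtilde n lam R c q B \<le> Jtilde n lam R c p Q"
  then have r: "regular n q B" by (intro reg) (auto simp: Jp)
  have G0: "AE \<theta> in lborel. G \<theta> \<ge> 0" and Gi: "integrable lborel G" using main[OF r] by auto
  have "integral\<^sup>L lborel G / (2*pi) \<le> 0" using le main[OF r] by (auto simp: Jp)
  then have "integral\<^sup>L lborel G \<le> 0" using pi_gt_zero by (auto simp: divide_le_0_iff)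
  then have "integral\<^sup>L lborel G = 0" using integral_nonneg_AE[OF G0] by simp
  then have "AE \<theta> in lborel. G \<theta> = 0" using integral_nonneg_eq_0_iff_AE[OF Gi G0] by simp
  moreover have "AE \<theta> in lborel. \<theta> \<in> {0..2*pi} \<longrightarrow> peval n q \<theta> > 0 \<and> posdef (qeval n B \<theta>)"
    using r by (simp add: regular_def)
  ultimately have "AE \<theta> in lborel. \<theta> \<in> {0<..<2*pi} \<longrightarrow> peval n q \<theta> = peval n p \<theta> \<and> qeval n H \<theta> = 0"
  proof eventually_elim
    case (elim \<theta>)
    show ?case
    proof
      assume "\<theta> \<in> {0<..<2*pi}"
      then have t: "\<theta> \<in> {0..2*pi}" by simp
      then have "T \<theta> = dual_integrand lam (peval n q \<theta>) (qeval n B \<theta>)" using elim by (simp add: G)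
      then show "peval n q \<theta> = peval n p \<theta> \<and> qeval n H \<theta> = 0" using cv(2)[OF t] elim t by (simp flip: Bd)
    qed
  qed
  \<comment> \<open>A zero integral of a nonnegative gap forces equality almost everywhere, and
    infinitely many angles determine the coefficients.\<close>
  then have inf: "infinite {\<theta>\<in>{0<..<2*pi}. peval n q \<theta> = peval n p \<theta> \<and> qeval n H \<theta> = 0}"
    by (rule AE_infinite) simp
  have sub: "{\<theta>\<in>{0<..<2*pi}. peval n q \<theta> = peval n p \<theta> \<and> qeval n H \<theta> = 0} \<subseteq> Tset"
    by (auto simp: Tset_def)
  have "q k = p k" for k
  proof (cases "1 \<le> k \<and> k \<le> n")
    case True
    show ?thesis by (rule peval_inj[OF inf sub]) (use True in auto)
  next
    case False
    then have "k = 0 \<or> k > n" by auto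
    then show ?thesis using qP p by (auto simp: Bo_cpt_def Bo_def)
  qed
  moreover have "B k = Q k" for k
  proof (cases "k \<le> n")
    case True
    have "H k = 0" by (rule qeval_zero[OF inf sub _ True]) simp
    then show ?thesis by (simp add: H_def)
  next
    case False
    then show ?thesis using BS QS by (simp add: Qspace_def)
  qed
  ultimately show "q = p \<and> B = Q" by auto
qed

theorem theorem1:
  fixes n :: nat and E :: "('m::finite \<times> 'm) set"
    and R :: "nat \<Rightarrow> real^'m^'m" and c :: "nat \<Rightarrow> real" and lam :: real
  assumes n_pos: "n > 0"
    and E_sym: "\<forall>a b. (a,b) \<in> E \<longrightarrow> (b,a) \<in> E"
    and E_diag: "\<forall>a. (a,a) \<in> E"
    and R0_sym: "transpose (R 0) = R 0"
    and lam_pos: "lam > 0"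
    and feasible: "\<exists>Phibar :: real \<Rightarrow> complex^'m^'m.
        (\<forall>a b. set_integrable lborel {0..2*pi} (\<lambda>\<theta>. Phibar \<theta> $ a $ b))
      \<and> (\<forall>\<theta>\<in>Tset. possemidef (Phibar \<theta>))
      \<and> (\<exists>\<alpha> \<beta>. \<alpha> < \<beta> \<and> {\<alpha><..<\<beta>} \<subseteq> Tset \<and> (\<forall>\<theta>\<in>{\<alpha><..<\<beta>}. posdef (Phibar \<theta>)))
      \<and> (\<forall>a b k. (a,b) \<in> E \<longrightarrow> k \<le> n \<longrightarrow>
           (LINT \<theta>:{0..2*pi}|lborel. Phibar \<theta> $ a $ b * cis (\<theta> * real k)) / complex_of_real (2*pi)
             = complex_of_real (R k $ a $ b))"
  shows "(\<exists>!pQ. fst pQ \<in> Bo_bar n \<and> snd pQ \<in> Bm_bar n E \<and>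
           (\<forall>p Q. p \<in> Bo_bar n \<longrightarrow> Q \<in> Bm_bar n E \<longrightarrow>
              Jtilde n lam R c (fst pQ) (snd pQ) \<le> Jtilde n lam R c p Q))
    \<and> (\<forall>p Q. p \<in> Bo_bar n \<longrightarrow> Q \<in> Bm_bar n E \<longrightarrow>
           (\<forall>p' Q'. p' \<in> Bo_bar n \<longrightarrow> Q' \<in> Bm_bar n E \<longrightarrow> Jtilde n lam R c p Q \<le> Jtilde n lam R c p' Q') \<longrightarrow>
           p \<in> Bo n \<and> Q \<in> Bm n E \<and>
           (let Phi = (\<lambda>\<theta>. peval n p \<theta> *\<^sub>R matrix_inv (qeval n Q \<theta>)) in
              bounded_coercive Phi
            \<and> (\<forall>k a b. k \<le> n \<longrightarrow> (a,b) \<in> E \<longrightarrow>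
                 Tint (\<lambda>\<theta>. cis (\<theta> * real k) * Phi \<theta> $ a $ b) = complex_of_real (R k $ a $ b))
            \<and> (\<forall>k. 1 \<le> k \<longrightarrow> k \<le> n \<longrightarrow>
                 Tint (\<lambda>\<theta>. cis (\<theta> * real k) * Ln (det (Phi \<theta>)))
                   = complex_of_real (c k)
                     + complex_of_real lam * Tint (\<lambda>\<theta>. cis (\<theta> * real k) / complex_of_real ((peval n p \<theta>)\<^sup>2)))))"
proof -
  obtain Phib :: "real \<Rightarrow> complex^'m^'m" and \<alpha> \<beta> where
    int: "\<And>a b. set_integrable lborel {0..2*pi} (\<lambda>\<theta>. Phib \<theta> $ a $ b)"
    and psd: "\<And>\<theta>. \<theta> \<in> Tset \<Longrightarrow> possemidef (Phib \<theta>)"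
    and ab: "\<alpha> < \<beta>" "{\<alpha><..<\<beta>} \<subseteq> Tset" "\<And>\<theta>. \<theta> \<in> {\<alpha><..<\<beta>} \<Longrightarrow> posdef (Phib \<theta>)"
    and mom: "\<And>a b k. (a,b) \<in> E \<Longrightarrow> k \<le> n \<Longrightarrow>
           (LINT \<theta>:{0..2*pi}|lborel. Phib \<theta> $ a $ b * cis (\<theta> * real k)) / complex_of_real (2*pi)
             = complex_of_real (R k $ a $ b)"
    using feasible by blast
  have Es: "(b,a) \<in> E" if "(a,b) \<in> E" for a b using E_sym that by blast
  have lin_pos: "\<forall>Q\<in>Qspace n E. (\<forall>\<theta>\<in>Tset. possemidef (qeval n Q \<theta>)) \<longrightarrow> (\<exists>k\<le>n. Q k \<noteq> 0)
      \<longrightarrow> (\<Sum>k=0..n. trace (transpose (Q k) ** R k)) > 0"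
    using lin_trace_pos[OF int psd ab mom Es] by blast
  obtain \<kappa> where k: "\<kappa> > 0" "\<And>Q. Q \<in> Qspace n E \<Longrightarrow> (\<And>\<theta>. \<theta> \<in> {0..2*pi} \<Longrightarrow> possemidef (qeval n Q \<theta>)) \<Longrightarrow>
     \<kappa> * coef_norm n Q \<le> (\<Sum>k=0..n. trace (transpose (Q k) ** R k))"
    using lin_trace_coercive[OF lin_pos] by blast
  obtain p Q where p: "p \<in> Bo n" and Q: "Q \<in> Bm n E" and
    ge: "\<And>h H. h 0 = 0 \<Longrightarrow> (\<And>k. k > n \<Longrightarrow> h k = 0) \<Longrightarrow> H \<in> Qspace n E \<Longrightarrow> dual_deriv n lam R c p Q h H \<ge> 0"
    using stationary_point_exists[where c = c, OF k(1) lam_pos _ k(2)] E_diag by blast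
  \<comment> \<open>The admissible directions form a linear space, so the one-sided inequality
    applied to a direction and its negative gives equality.\<close>
  have stat: "dual_deriv n lam R c p Q h H = 0" if "h 0 = 0" "\<And>k. k > n \<Longrightarrow> h k = 0" "H \<in> Qspace n E" for h H
  proof -
    have "dual_deriv n lam R c p Q (\<lambda>k. -1 * h k) (\<lambda>k. -1 *\<^sub>R H k) \<ge> 0"
      using that by (intro ge Qspace_scale) auto
    moreover have "dual_deriv n lam R c p Q h H \<ge> 0" by (rule ge) (fact that)+
    ultimately show ?thesis unfolding dual_deriv_scale by simp
  qed
  have min: "Jtilde n lam R c p Q \<le> Jtilde n lam R c q B"
    and min_unique: "Jtilde n lam R c q B \<le> Jtilde n lam R c p Q \<Longrightarrow> q = p \<and> B = Q"
    if "q \<in> Bo_bar n" "B \<in> Bm_bar n E" for q B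
    using stationary_unique_min[where c = c and R = R and n = n and E = E and p = p and Q = Q, OF lam_pos p Q _ that] stat by blast+
  have bar: "p \<in> Bo_bar n" "Q \<in> Bm_bar n E" using p Q Bo_subset_bar Bm_subset_bar by auto
  have uniq: "p' = p \<and> Q' = Q" if "p' \<in> Bo_bar n" "Q' \<in> Bm_bar n E"
    "\<forall>q B. q \<in> Bo_bar n \<longrightarrow> B \<in> Bm_bar n E \<longrightarrow> Jtilde n lam R c p' Q' \<le> Jtilde n lam R c q B" for p' Q'
    using min_unique[OF that(1,2)] that(3) bar by blast
  have ex1: "\<exists>!pQ. fst pQ \<in> Bo_bar n \<and> snd pQ \<in> Bm_bar n E \<and>
           (\<forall>p Q. p \<in> Bo_bar n \<longrightarrow> Q \<in> Bm_bar n E \<longrightarrow>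
              Jtilde n lam R c (fst pQ) (snd pQ) \<le> Jtilde n lam R c p Q)"
  proof (rule ex1I[of _ "(p, Q)"])
    show "fst (p, Q) \<in> Bo_bar n \<and> snd (p, Q) \<in> Bm_bar n E \<and>
           (\<forall>q B. q \<in> Bo_bar n \<longrightarrow> B \<in> Bm_bar n E \<longrightarrow>
              Jtilde n lam R c (fst (p, Q)) (snd (p, Q)) \<le> Jtilde n lam R c q B)"
      using bar min by simp
  qed (use uniq in \<open>auto simp: prod_eq_iff\<close>)
  have props: "bounded_coercive (\<lambda>\<theta>. Phi_of (peval n p \<theta>) (qeval n Q \<theta>))"
    "\<And>k a b. k \<le> n \<Longrightarrow> (a,b) \<in> E \<Longrightarrow>
       Tint (\<lambda>\<theta>. cis (\<theta> * real k) * Phi_of (peval n p \<theta>) (qeval n Q \<theta>) $ a $ b) = complex_of_real (R k $ a $ b)"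
    "\<And>k. 1 \<le> k \<Longrightarrow> k \<le> n \<Longrightarrow> Tint (\<lambda>\<theta>. cis (\<theta> * real k) * Ln (det (Phi_of (peval n p \<theta>) (qeval n Q \<theta>))))
       = complex_of_real (c k) + complex_of_real lam * Tint (\<lambda>\<theta>. cis (\<theta> * real k) / complex_of_real ((peval n p \<theta>)\<^sup>2))"
    using spec_density_bounded_coercive[OF Es R0_sym p Q stat] covariance_matching[OF Es R0_sym p Q stat]
      log_moment_matching[OF Es R0_sym p Q stat] by blast+
  show ?thesis
  proof (intro conjI allI impI)
    fix p' Q'
    assume a: "p' \<in> Bo_bar n" "Q' \<in> Bm_bar n E"
      "\<forall>q B. q \<in> Bo_bar n \<longrightarrow> B \<in> Bm_bar n E \<longrightarrow> Jtilde n lam R c p' Q' \<le> Jtilde n lam R c q B"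
    have eq: "p' = p" "Q' = Q" using uniq[OF a] by auto
    show "p' \<in> Bo n" "Q' \<in> Bm n E" using p Q eq by auto
    show "let Phi = (\<lambda>\<theta>. peval n p' \<theta> *\<^sub>R matrix_inv (qeval n Q' \<theta>)) in
              bounded_coercive Phi
            \<and> (\<forall>k a b. k \<le> n \<longrightarrow> (a,b) \<in> E \<longrightarrow>
                 Tint (\<lambda>\<theta>. cis (\<theta> * real k) * Phi \<theta> $ a $ b) = complex_of_real (R k $ a $ b))
            \<and> (\<forall>k. 1 \<le> k \<longrightarrow> k \<le> n \<longrightarrow>
                 Tint (\<lambda>\<theta>. cis (\<theta> * real k) * Ln (det (Phi \<theta>)))
                   = complex_of_real (c k)
                     + complex_of_real lam * Tint (\<lambda>\<theta>. cis (\<theta> * real k) / complex_of_real ((peval n p' \<theta>)\<^sup>2)))"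
      using props unfolding eq Let_def Phi_of_def by blast
  qed (rule ex1)
qed

end
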